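(* Let $q\ge 5$ be a prime, put $q^*=(-1)^{(q-1)/2}q$ and $u_q(j)=(3^j-q^*(-1)^j)/4$ for $j\ge 1$. For $n\ge 1$ let $D_q(n)$ be the smallest positive integer $m$ such that $u_q(1),\ldots,u_q(n)$ are pairwise incongruent modulo $m$. Then for every integer $n\ge 1$ (with $e,f$ ranging over nonnegative integers) $$D_q(n)=\begin{cases}\min\{2^e,q^f:2^e\ge n,~q^f\ge \frac{q}{q-1}n\} & \text{if } q \text{ is Artin but not Mirimanoff;}\\ \min\{2^e,q:2^e\ge n,~q\ge n+1\} & \text{if } q \text{ is Artin and Mirimanoff but not Fermat;}\\ \min\{2^e:2^e\ge n\} & \text{if } q \text{ is Artin, Mirimanoff and Fermat;}\\ \min\{2^e:2^e\ge n\} & \text{if } q \text{ is not Artin,}\end{cases}$$ except when $n=5$ and $q\equiv \pm1\pmod{28}$, in which case $D_q(5)=7$. Moreover, every power of $2$ occurs as a value $D_q(n)$ for some $n$; if $q$ is Artin, Mirimanoff but not Fermat then $q$ occurs as a value; and if $q$ is Artin but not Mirimanoff then, for an integer $f\ge 1$, $q^f$ occurs as a value $D_q(n)$ for some $n$ if and only if $$\Big\{f\frac{\log q}{\log 2}\Big\}>\frac{\log(q/(q-1))}{\log 2},$$ where $\{x\}$ denotes the fractional part of $x$.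
   Context: A prime $q$ is called Artin if $3$ is a primitive root modulo $q$; Fermat if $q=2^m+1$ for some $m\ge1$; Mirimanoff if $3^{q-1}\equiv 1\pmod{q^2}$. *)

theory Defs
  imports Complex_Main "HOL-Number_Theory.Number_Theory"
begin

definition Artin_prime :: "nat \<Rightarrow> bool" where
  "Artin_prime q \<longleftrightarrow> prime q \<and> residue_primroot q 3"

definition Fermat_prime :: "nat \<Rightarrow> bool" where
  "Fermat_prime q \<longleftrightarrow> prime q \<and> (\<exists>m\<ge>1. q = 2 ^ m + 1)"

definition Mirimanoff_prime :: "nat \<Rightarrow> bool" where
  "Mirimanoff_prime q \<longleftrightarrow> prime q \<and> [3 ^ (q - 1) = 1] (mod q\<^sup>2)"

definition qstar :: "nat \<Rightarrow> int" where
  "qstar q = (-1) ^ ((q - 1) div 2) * int q"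

text \<open>The integer division is exact for odd \<open>q\<close>; see \<open>of_int_u_seq\<close> below.\<close>

definition u_seq :: "nat \<Rightarrow> nat \<Rightarrow> int" where
  "u_seq q j = (3 ^ j - qstar q * (-1) ^ j) div 4"

definition discriminator :: "nat \<Rightarrow> nat \<Rightarrow> nat" where
  "discriminator q n =
     (LEAST m. m > 0 \<and> pairwise (\<lambda>i j. \<not> [u_seq q i = u_seq q j] (mod int m)) {1..n})"

lemma qstar_cong_1:
  assumes "odd q"
  shows "[qstar q = 1] (mod 4)"
proof -
  obtain k where k: "q = 2 * k + 1"
    using assms by (auto elim: oddE)
  show ?thesis
  proof (cases "even k")
    case True
    then obtain l where "k = 2 * l" by (auto elim: evenE)
    with k show ?thesis by (simp add: qstar_def cong_iff_dvd_diff)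
  next
    case False
    then obtain l where l: "k = 2 * l + 1" by (auto elim: oddE)
    have "qstar q - 1 = 4 * (- int l - 1)"
      using k l by (simp add: qstar_def)
    then show ?thesis by (simp only: cong_iff_dvd_diff dvd_triv_left)
  qed
qed

lemma u_seq_exact:
  assumes "odd q"
  shows "4 dvd 3 ^ j - qstar q * (-1) ^ j"
proof -
  have "[(3::int) ^ j = (-1) ^ j] (mod 4)"
    by (rule cong_pow) (simp add: cong_iff_dvd_diff)
  moreover have "[qstar q * (-1) ^ j = 1 * (-1) ^ j] (mod 4)"
    using qstar_cong_1[OF assms] by (rule cong_scalar_right)
  ultimately have "[3 ^ j = qstar q * (-1) ^ j] (mod 4)"
    by (metis cong_sym cong_trans mult_1)
  then show ?thesis by (simp add: cong_iff_dvd_diff)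
qed

lemma of_int_u_seq:
  assumes "odd q"
  shows "real_of_int (u_seq q j) = (3 ^ j - of_int (qstar q) * (-1) ^ j) / 4"
  using u_seq_exact[OF assms, of j] by (simp add: u_seq_def real_of_int_div)

end

theory Submission
  imports Defs
begin

text \<open>
  Let \<open>m\<close> be a discriminator value for \<open>n\<close> that is not a power of 2. Powers of 2 separate as many
  terms as they can, so every power of 2 below \<open>m\<close> is less than \<open>n\<close>; in particular \<open>m < 2n\<close>. The
  sequence modulo \<open>m\<close> has an even period, and this period is smaller than \<open>n\<close> unless \<open>m = p\<^sup>k\<close> for a
  prime \<open>p \<ge> 5\<close> modulo which 9 generates the nonzero squares. A collision of \<open>u\<^sub>i\<close> and \<open>u\<^sub>j\<close> with
  \<open>i\<close> even and \<open>j\<close> odd means \<open>3\<^sup>i - 3\<^sup>j = 2q\<^sup>*\<close> modulo \<open>p\<^sup>k\<close>.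

  If \<open>k \<ge> 2\<close>, a solution modulo \<open>p\<close> lifts to one with \<open>i, j \<le> n\<close> by the pigeonhole principle. If
  \<open>k = 1\<close> and \<open>p \<noteq> q\<close>, every residue \<open>v \<noteq> 0\<close> has the form \<open>3\<^sup>i - 3\<^sup>j\<close> with \<open>i, j \<le> n\<close>, apart from
  \<open>p = 7\<close> and \<open>v = 2\<close>. For \<open>p > 4096\<close> this is a point-line incidence bound: writing
  \<open>i = i\<^sub>1 + i\<^sub>2\<close> and \<open>j = j\<^sub>1 + j\<^sub>2\<close>, the point \<open>(3\<^bsup>i\<^sub>2\<^esup>, 3\<^bsup>j\<^sub>2\<^esup>)\<close> lies on the line with coefficients
  \<open>(3\<^bsup>i\<^sub>1\<^esup>, -3\<^bsup>j\<^sub>1\<^esup>)\<close>, and there are enough points and lines. For smaller \<open>p\<close> one uses that \<open>v\<close> being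
  covered by \<open>(i, j)\<close> implies \<open>9\<^sup>tv\<close> being covered by \<open>(i + 2t, j + 2t)\<close>: a few long arcs cover both
  orbits of the multiplication by 9.
\<close>

section \<open>Orbits of the multiplication by 9\<close>

text \<open>The prime p = q escapes these collisions: 2 \<open>qstar q\<close> = 0 modulo q, so one
  would need 3^i = 3^j modulo q with i even and j odd. That is impossible if 3 is a primitive root,
  because q - 1 is even; but it happens if 3 has the odd order (q - 1)/2, although 9 still generates
  the squares. Hence the Artin condition. A power q^f then separates up to its period q^(f-1) (q -
  1), as long as 3 stays primitive modulo q^2, which fails for Mirimanoff primes. It occurs as a
  value iff no power of 2 lies between that period and q^f; this is what the fractional part
  measures, and for f = 1 the only candidate is q - 1, so q would be a Fermat prime. The exception
  stems from p = 7: with i, j at most 5, the differences 3^i - 3^j miss the nonzero residue 2 only,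
  and 2 \<open>qstar q\<close> = 2 modulo 7 is combined with \<open>qstar q\<close> = 1 modulo 4.
  The bound 4096 is 8^4: each part of an exponent has about p/8 choices, so points times lines
  number about (p/8)^4, which has to exceed p^3.\<close>

lemma prime_3: "prime (3::nat)"
  by simp

lemma int_power_cong_iff:
  fixes m a :: nat
  assumes "coprime m a"
  shows "[int a ^ i = int a ^ j] (mod int m) \<longleftrightarrow> [i = j] (mod ord m a)"
  using order_divides_expdiff[OF assms, of i j] by (metis cong_int_iff of_nat_power)

lemma pow3_cong_iff_coprime:
  "coprime m (3::nat) \<Longrightarrow> [(3::int) ^ a = 3 ^ b] (mod int m) \<longleftrightarrow> [a = b] (mod ord m 3)"
  using int_power_cong_iff[of m 3 a b] by simp

lemma pow9_cong_iff_coprime: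
  "coprime m (9::nat) \<Longrightarrow> [(9::int) ^ a = 9 ^ b] (mod int m) \<longleftrightarrow> [a = b] (mod ord m 9)"
  using int_power_cong_iff[of m 9 a b] by simp

lemma pow9_cong_iff:
  fixes p a b :: nat
  assumes "prime p" "p \<noteq> 3"
  shows "[(9::int) ^ a = 9 ^ b] (mod int p) \<longleftrightarrow> [a = b] (mod ord p 9)"
proof -
  have "\<not> p dvd 3"
    using assms primes_dvd_imp_eq[of p 3] prime_3 by blast
  hence "coprime p (3::nat)"
    using assms(1) prime_imp_coprime by blast
  hence "coprime p ((3::nat) * 3)"
    by (simp only: coprime_mult_right_iff)
  thus ?thesis
    by (intro pow9_cong_iff_coprime) simp
qed

text \<open>The powers of 9 form a subgroup of index 2 in the units modulo \<open>p\<close>, and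
  \<open>\<nu>\<close> lies outside it, so \<open>x\<close> and \<open>\<nu> * x\<close> represent
  both cosets. The proof counts: two disjoint sets of \<open>(p - 1) div 2\<close> nonzero residues
  leave no others.\<close>

lemma two_orbits:
  fixes p :: nat and x \<nu> v :: int
  assumes p: "prime p" "p \<ge> 5" and ord: "ord p 9 = (p - 1) div 2"
    and nu: "\<not> int p dvd \<nu>" "\<And>t. \<not> [\<nu> = 9 ^ t] (mod int p)"
    and x: "\<not> int p dvd x" and v: "\<not> int p dvd v"
  shows "\<exists>t. [v = x * 9 ^ t] (mod int p) \<or> [v = \<nu> * x * 9 ^ t] (mod int p)"
proof -
  define h where "h = (p - 1) div 2"
  have "odd p" using p prime_odd_nat[of p] by simp
  hence h: "p - 1 = 2 * h" by (simp add: h_def)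
  have P: "prime (int p)" using p by simp
  have n9: "\<not> int p dvd 9 ^ t" for t
  proof
    assume "int p dvd 9 ^ t"
    hence "int p dvd 3 ^ 2" using P by (simp add: prime_dvd_power)
    hence "p dvd 3" using P by (metis int_dvd_int_iff of_nat_numeral prime_dvd_power)
    thus False using p by (auto dest: dvd_imp_le)
  qed
  have inj: "inj_on (\<lambda>t. c * 9 ^ t mod int p) {..<h}" if "\<not> int p dvd c" for c
  proof (rule inj_onI)
    fix a b assume ab: "a \<in> {..<h}" "b \<in> {..<h}" "c * 9 ^ a mod int p = c * 9 ^ b mod int p"
    hence "[c * 9 ^ a = c * 9 ^ b] (mod int p)" by (simp add: cong_def)
    moreover have "coprime c (int p)" using P that by (metis coprime_commute prime_imp_coprime)
    ultimately have "[(9::int) ^ a = 9 ^ b] (mod int p)" by (simp add: cong_mult_lcancel)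
    hence "[a = b] (mod h)" using pow9_cong_iff[of p] p ord by (simp add: h_def)
    thus "a = b" using ab by (simp add: cong_less_modulus_unique_nat)
  qed
  have nux: "\<not> int p dvd \<nu> * x" using nu x P by (simp add: prime_dvd_mult_iff)
  define A where "A = (\<lambda>t. x * 9 ^ t mod int p) ` {..<h}"
  define B where "B = (\<lambda>t. \<nu> * x * 9 ^ t mod int p) ` {..<h}"
  have "A \<inter> B = {}"
  proof (rule ccontr)
    assume "A \<inter> B \<noteq> {}"
    then obtain s t where st: "s < h" "t < h" "[x * 9 ^ s = \<nu> * x * 9 ^ t] (mod int p)"
      by (auto simp: A_def B_def cong_def)
    have "[x * 9 ^ s = x * (\<nu> * 9 ^ t)] (mod int p)" using st(3) by (simp add: mult_ac)
    moreover have "coprime x (int p)" using P x by (metis coprime_commute prime_imp_coprime)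
    ultimately have "[9 ^ s = \<nu> * 9 ^ t] (mod int p)" by (simp add: cong_mult_lcancel)
    \<comment> \<open>\<open>9 ^ (h - t)\<close> inverts \<open>9 ^ t\<close>, as 9 has order
      \<open>h\<close>; this exhibits \<open>\<nu>\<close> as a power of 9.\<close>
    hence "[9 ^ s * 9 ^ (h - t) = \<nu> * 9 ^ t * 9 ^ (h - t)] (mod int p)" by (rule cong_scalar_right)
    hence "[9 ^ (s + (h - t)) = \<nu> * 9 ^ h] (mod int p)"
      using st by (simp add: mult.assoc flip: power_add)
    moreover have "[(9::int) ^ h = 9 ^ 0] (mod int p)"
      using pow9_cong_iff[of p h 0] p ord by (simp add: h_def cong_0_iff)
    hence "[\<nu> * 9 ^ h = \<nu>] (mod int p)" using cong_scalar_left by fastforce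
    ultimately show False using nu(2) cong_sym cong_trans by blast
  qed
  moreover have "card A = h" "card B = h"
    using inj[OF x] inj[OF nux] by (auto simp: A_def B_def card_image)
  moreover have fin: "finite A" "finite B" by (auto simp: A_def B_def)
  ultimately have "card (A \<union> B) = p - 1" using h by (simp add: card_Un_disjoint)
  moreover have "c * 9 ^ t mod int p \<in> {1..<int p}" if "\<not> int p dvd c" for c t
  proof -
    have "\<not> int p dvd c * 9 ^ t" using that n9 P by (simp add: prime_dvd_mult_iff)
    hence "c * 9 ^ t mod int p \<noteq> 0" by (simp add: dvd_eq_mod_eq_0)
    moreover have "c * 9 ^ t mod int p \<ge> 0" "c * 9 ^ t mod int p < int p" using p by auto
    ultimately show ?thesis unfolding atLeastLessThan_iff by linarith
  qed
  hence sub: "A \<union> B \<subseteq> {1..<int p}" using x nux by (auto simp: A_def B_def simp del: atLeastLessThan_iff)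
  ultimately have "A \<union> B = {1..<int p}" by (intro card_subset_eq) auto
  moreover have "v mod int p \<in> {1..<int p}"
  proof -
    have "v mod int p \<noteq> 0" using v by (simp add: dvd_eq_mod_eq_0)
    moreover have "v mod int p \<ge> 0" "v mod int p < int p" using p by auto
    ultimately show ?thesis unfolding atLeastLessThan_iff by linarith
  qed
  ultimately have "v mod int p \<in> A \<union> B" by simp
  thus ?thesis by (auto simp: A_def B_def cong_def)
qed

text \<open>Modulo an even order the parity of an exponent is well defined, but 3 = 9^t would give
  9^1 = 9^(2t). As (p - 1)/2 is even or odd according to p modulo 4, this lemma and the next one
  supply the factor \<open>\<nu>\<close> of \<open>two_orbits\<close>.\<close>

lemma three_not_pow9:
  assumes p: "prime p" "p \<noteq> 3" and ord: "even (ord p 9)"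
  shows "\<not> [3 = (9::int) ^ t] (mod int p)"
proof
  assume "[3 = (9::int) ^ t] (mod int p)"
  hence "[3 ^ 2 = (9 ^ t) ^ 2] (mod int p)" by (rule cong_pow)
  hence "[(9::int) ^ 1 = 9 ^ (2 * t)] (mod int p)" by (simp add: power_mult mult.commute power_even_eq)
  hence "[1 = 2 * t] (mod ord p 9)" using pow9_cong_iff[OF p] by blast
  with ord show False
    by (metis cong_dvd_iff cong_dvd_modulus_nat dvd_triv_left odd_one)
qed

text \<open>A group of odd order contains no element of order 2.\<close>

lemma minus_one_not_pow9:
  assumes p: "prime p" "p \<ge> 5" and ord: "odd (ord p 9)"
  shows "\<not> [-1 = (9::int) ^ t] (mod int p)"
proof
  assume *: "[-1 = (9::int) ^ t] (mod int p)"
  hence "[(-1) ^ 2 = (9 ^ t) ^ 2] (mod int p)" by (rule cong_pow)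
  hence "[(9::int) ^ 0 = 9 ^ (2 * t)] (mod int p)" by (simp add: power_mult mult.commute power_even_eq)
  hence "[0 = 2 * t] (mod ord p 9)" using pow9_cong_iff[of p 0 "2 * t"] p by auto
  hence "ord p 9 dvd 2 * t" by (metis cong_0_iff cong_sym)
  hence "ord p 9 dvd t" using ord by (metis coprime_commute coprime_dvd_mult_right_iff coprime_left_2_iff_odd)
  hence "[(9::int) ^ t = 9 ^ 0] (mod int p)" using pow9_cong_iff[of p t 0] p by (auto simp: cong_0_iff)
  with * have "[-1 = (1::int)] (mod int p)" by (metis cong_trans power_0)
  hence "int p dvd 2" by (simp add: cong_iff_dvd_diff)
  thus False using p by (auto dest: zdvd_imp_le)
qed

section \<open>Small primes\<close>

text \<open>The target of interest is \<open>v = 2 * qstar q\<close>. General \<open>v\<close> are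
  allowed because multiplication by 9 carries one target to another.\<close>

definition covered :: "int \<Rightarrow> nat \<Rightarrow> int \<Rightarrow> bool" where
  "covered p n v \<longleftrightarrow>
     (\<exists>i j. even i \<and> odd j \<and> i \<in> {1..n} \<and> j \<in> {1..n} \<and> [3 ^ i - 3 ^ j = v] (mod p))"

lemma covered_cong: "covered p n v \<Longrightarrow> [v = v'] (mod p) \<Longrightarrow> covered p n v'"
  unfolding covered_def by (meson cong_trans)

lemma covered_mono: "covered p m v \<Longrightarrow> m \<le> n \<Longrightarrow> covered p n v"
  unfolding covered_def by (meson atLeastAtMost_iff order_trans)

section \<open>Powers modulo p by repeated squaring\<close>

fun squares_mod :: "int \<Rightarrow> nat \<Rightarrow> int \<Rightarrow> int list" where
  "squares_mod p 0 t = []"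
| "squares_mod p (Suc k) t = t # squares_mod p k (t * t mod p)"

text \<open>The binary digits of the exponent select from the repeated squares in the list. The
  value 0 for an empty list stands for an exponent with too many digits, which
  \<open>pow_num_correct\<close> excludes by its bound \<open>2 ^ l\<close>.\<close>

fun pow_num :: "int \<Rightarrow> int list \<Rightarrow> num \<Rightarrow> int" where
  "pow_num p [] k = 0"
| "pow_num p (t # ts) num.One = t"
| "pow_num p (t # ts) (num.Bit0 k) = pow_num p ts k"
| "pow_num p (t # ts) (num.Bit1 k) = t * pow_num p ts k mod p"

fun even_num :: "num \<Rightarrow> bool" where
  "even_num num.One \<longleftrightarrow> False"
| "even_num (num.Bit0 k) \<longleftrightarrow> True"
| "even_num (num.Bit1 k) \<longleftrightarrow> False"

definition num_of_int :: "int \<Rightarrow> num" where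
  "num_of_int k = num_of_nat (nat k)"

text \<open>As a code equation this merely strips a constructor, so the exponents in a certificate
  yield their binary digits without conversion.\<close>

lemma num_of_int_Pos [code]: "num_of_int (Int.Pos k) = k"
  by (simp add: num_of_int_def num_of_nat_numeral_eq)

lemma numeral_num_of_int: "0 < k \<Longrightarrow> numeral (num_of_int k) = nat k"
  by (simp add: num_of_int_def numeral_num_of_nat)

lemma even_num_of_int: "0 < k \<Longrightarrow> even_num (num_of_int k) \<longleftrightarrow> even (nat k)"
proof -
  have "even_num m \<longleftrightarrow> even (numeral m :: nat)" for m by (cases m) auto
  thus "0 < k \<Longrightarrow> ?thesis" by (metis numeral_num_of_int)
qed

lemma pow_num_correct:
  assumes "numeral k < (2::nat) ^ l" "[t = b] (mod p)"
  shows "[pow_num p (squares_mod p l t) k = b ^ numeral k] (mod p)"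
  using assms
proof (induction k arbitrary: l t b)
  case One
  thus ?case by (cases l) auto
next
  case (Bit0 k)
  then obtain m where l: "l = Suc m" by (cases l) auto
  have "[t * t mod p = b ^ 2] (mod p)"
    using Bit0.prems by (simp add: power2_eq_square cong_mult)
  moreover have "numeral k < (2::nat) ^ m" using Bit0.prems unfolding l numeral_Bit0[of k] power_Suc by linarith
  ultimately have "[pow_num p (squares_mod p m (t * t mod p)) k = (b ^ 2) ^ numeral k] (mod p)"
    by (intro Bit0.IH)
  thus ?case by (simp add: l power_numeral_even power2_eq_square power_mult_distrib Let_def)
next
  case (Bit1 k)
  then obtain m where l: "l = Suc m" by (cases l) auto
  have "[t * t mod p = b ^ 2] (mod p)"
    using Bit1.prems by (simp add: power2_eq_square cong_mult)
  moreover have "numeral k < (2::nat) ^ m" using Bit1.prems unfolding l numeral_Bit1[of k] power_Suc by linarith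
  ultimately have "[pow_num p (squares_mod p m (t * t mod p)) k = (b ^ 2) ^ numeral k] (mod p)"
    by (intro Bit1.IH)
  hence "[t * pow_num p (squares_mod p m (t * t mod p)) k = b * (b ^ 2) ^ numeral k] (mod p)"
    using Bit1.prems by (intro cong_mult)
  thus ?case by (simp add: l power_numeral_odd power2_eq_square power_mult_distrib Let_def mult.assoc cong_def)
qed

definition pow_tab :: "int \<Rightarrow> int list \<Rightarrow> int \<Rightarrow> int" where
  "pow_tab p ts k = pow_num p ts (num_of_int k)"

text \<open>Twelve squares serve all exponents below 2^12 = 4096.\<close>

lemma pow_tab_correct:
  assumes "0 < k" "k < 4096"
  shows "[pow_tab p (squares_mod p 12 b) k = b ^ nat k] (mod p)"
  using pow_num_correct[of "num_of_int k" 12 b b p] assms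
  by (simp add: pow_tab_def numeral_num_of_int nat_less_iff)

definition pow_diff :: "int \<Rightarrow> int list \<Rightarrow> int \<Rightarrow> int \<Rightarrow> int" where
  "pow_diff p ts i j = (pow_tab p ts i - pow_tab p ts j) mod p"

text \<open>
  An arc \<open>(i, j, g)\<close> starts at \<open>v = 3\<^sup>i - 3\<^sup>j\<close> and covers \<open>v, 9v, 9\<^sup>2v, \<dots>\<close> up to, but excluding,
  \<open>3\<^sup>gv\<close>, where the next arc has to start. The last arc must lead back to the starting point \<open>x\<close> of the
  first one, so that a whole orbit of the multiplication by 9 is covered.
\<close>

fun arcs_ok :: "int \<Rightarrow> int list \<Rightarrow> int \<Rightarrow> int \<Rightarrow> (int \<times> int \<times> int) list \<Rightarrow> int \<Rightarrow> bool" where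
  "arcs_ok p ts n x [] v \<longleftrightarrow> v = x"
| "arcs_ok p ts n x ((i, j, g) # as) v \<longleftrightarrow>
     0 < i \<and> 0 < j \<and> 0 < g \<and> i + g \<le> n + 2 \<and> j + g \<le> n + 2 \<and>
     even_num (num_of_int i) \<and> \<not> even_num (num_of_int j) \<and> even_num (num_of_int g) \<and>
     pow_diff p ts i j = v \<and> arcs_ok p ts n x as (v * pow_tab p ts g mod p)"

text \<open>\<open>G\<close> is half the sum of the gaps. An arc (i, j, g) ends with the pair (i + g
  - 2, j + g - 2), which is why i + g may reach n + 2. Positivity of \<open>G\<close> allows the
  next lemma to reduce exponents modulo \<open>G\<close>.\<close>

lemma arcs_ok_correct:
  assumes "arcs_ok p (squares_mod p 12 3) n x as v" "n < 4096"
  shows "\<exists>G. (as \<noteq> [] \<longrightarrow> 0 < G) \<and> (\<forall>t<G. covered p (nat n) (v * 9 ^ t)) \<and>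
             [v * 9 ^ G = x] (mod p)"
  using assms
proof (induction p "squares_mod p 12 3" n x as v rule: arcs_ok.induct)
  case (1 p n x v)
  thus ?case by (intro exI[of _ 0]) auto
next
  case (2 p n x i j g as v)
  let ?T = "squares_mod p 12 3"
  from 2 have ok: "0 < i" "0 < j" "0 < g" "i + g \<le> n + 2" "j + g \<le> n + 2" "n < 4096"
    "even (nat i)" "odd (nat j)" "even (nat g)" "pow_diff p ?T i j = v"
    "arcs_ok p ?T n x as (v * pow_tab p ?T g mod p)"
    by (auto simp: even_num_of_int)
  from \<open>even (nat g)\<close> obtain h where h: "nat g = 2 * h" by blast
  with ok have h': "h > 0" "g = 2 * int h" by auto
  from 2(1)[OF ok(11,6)] obtain G where G:
    "\<forall>t<G. covered p (nat n) (v * pow_tab p ?T g mod p * 9 ^ t)"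
    "[v * pow_tab p ?T g mod p * 9 ^ G = x] (mod p)" by blast
  \<comment> \<open>A positive even \<open>i\<close> is at least 2, so
    \<open>i + g \<le> n + 2\<close> keeps \<open>g\<close> below 4096, the range of the
    table.\<close>
  have "nat i \<noteq> 1" using ok(7) by auto
  hence "2 \<le> i" using ok(1) by linarith
  hence "[pow_tab p ?T g = 3 ^ nat g] (mod p)"
    using ok h' by (intro pow_tab_correct) auto
  hence eq: "[v * pow_tab p ?T g mod p = v * 9 ^ h] (mod p)"
    by (simp add: h power_mult cong_scalar_left)
  hence shift: "[v * pow_tab p ?T g mod p * 9 ^ t = v * 9 ^ (h + t)] (mod p)" for t
    using cong_scalar_right[OF eq, of "9 ^ t"] by (simp only: power_add mult.assoc[symmetric])
  have "[pow_tab p ?T i - pow_tab p ?T j = 3 ^ nat i - 3 ^ nat j] (mod p)"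
    using ok h' by (intro cong_diff pow_tab_correct) auto
  hence v: "[3 ^ nat i - 3 ^ nat j = v] (mod p)"
    using ok(10) by (metis pow_diff_def cong_mod_left cong_sym)
  have "covered p (nat n) (v * 9 ^ t)" if "t < h + G" for t
  proof (cases "t < h")
    case True
    have "[(3 ^ nat i - 3 ^ nat j) * 9 ^ t = v * 9 ^ t] (mod p)"
      using v by (rule cong_scalar_right)
    hence "[3 ^ (nat i + 2 * t) - 3 ^ (nat j + 2 * t) = v * 9 ^ t] (mod p)"
      by (simp add: power_add power_mult left_diff_distrib)
    moreover have "nat i + 2 * t \<in> {1..nat n}" "nat j + 2 * t \<in> {1..nat n}"
      using True ok h' by auto
    ultimately show ?thesis
      unfolding covered_def using ok(7,8)
      by (intro exI[of _ "nat i + 2 * t"] exI[of _ "nat j + 2 * t"]) auto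
  next
    case False
    with that G(1) have "covered p (nat n) (v * pow_tab p ?T g mod p * 9 ^ (t - h))" by auto
    with shift[of "t - h"] False show ?thesis using covered_cong by force
  qed
  moreover have "[v * 9 ^ (h + G) = x] (mod p)"
    using shift[of G] G(2) cong_sym cong_trans by blast
  ultimately show ?case using h' by (intro exI[of _ "h + G"]) auto
qed

text \<open>Once the chain closes up, multiplication by \<open>9 ^ G\<close> fixes \<open>x\<close>,
  and the first \<open>G\<close> steps already run through the whole orbit.\<close>

lemma arcs_ok_orbit:
  assumes "arcs_ok p (squares_mod p 12 3) n x as x" "as \<noteq> []" "n < 4096"
  shows "covered p (nat n) (x * 9 ^ t)"
proof -
  obtain G where G: "0 < G" "\<forall>t<G. covered p (nat n) (x * 9 ^ t)" "[x * 9 ^ G = x] (mod p)"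
    using arcs_ok_correct[OF assms(1,3)] assms(2) by blast
  have "[x * 9 ^ (s + G * k) = x * 9 ^ s] (mod p)" for s k
  proof (induction k)
    case (Suc k)
    have "[x * 9 ^ G * 9 ^ (s + G * k) = x * 9 ^ (s + G * k)] (mod p)"
      using G(3) by (rule cong_scalar_right)
    hence "[x * 9 ^ (s + G * Suc k) = x * 9 ^ (s + G * k)] (mod p)"
      by (simp add: power_add mult_ac)
    thus ?case using Suc cong_trans by blast
  qed simp
  from this[of "t mod G" "t div G"] have "[x * 9 ^ (t mod G) = x * 9 ^ t] (mod p)"
    by (simp add: cong_sym)
  thus ?thesis using G covered_cong by (meson mod_less_divisor)
qed

text \<open>
  \<open>Small_order k\<close> shows that 9 has order at most \<open>k < (p - 1)/2\<close>, so that \<open>p\<close> is irrelevant;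
  \<open>Arcs g as bs\<close> covers two orbits, whose starting points differ by the factor \<open>\<nu> 3\<^sup>g\<close>
  with \<open>\<nu> \<in> {3, -1}\<close> not a power of 9.
\<close>

datatype cert = Small_order int | Arcs int "(int \<times> int \<times> int) list" "(int \<times> int \<times> int) list"

text \<open>
  Separating \<open>n\<close> terms modulo a prime \<open>p\<close> that is the discriminator requires \<open>n\<close> to exceed the largest
  power of 2 below \<open>p\<close>. For \<open>p > 32\<close> the weaker bound \<open>n > p/2\<close> suffices.
\<close>

definition range_bound :: "int \<Rightarrow> int" where
  "range_bound p = (if p < 16 then 9 else if p < 32 then 17 else (p + 1) div 2)"

fun start :: "int \<Rightarrow> int list \<Rightarrow> (int \<times> int \<times> int) list \<Rightarrow> int" where
  "start p ts [] = 0"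
| "start p ts ((i, j, g) # as) = pow_diff p ts i j"

text \<open>The table and both starting points are parameters so that their values are shared. The
  final equation puts \<open>y\<close> into the other coset: \<open>g\<close> is even, hence
  \<open>3 ^ g\<close> is a power of 9, and it lets the second chain start anywhere on its
  orbit.\<close>

definition arcs_cert_ok ::
  "int \<Rightarrow> int list \<Rightarrow> int \<Rightarrow> int \<Rightarrow> (int \<times> int \<times> int) list \<Rightarrow> (int \<times> int \<times> int) list \<Rightarrow>
   int \<Rightarrow> int \<Rightarrow> bool" where
  "arcs_cert_ok p ts n g as bs x y \<longleftrightarrow>
     as \<noteq> [] \<and> bs \<noteq> [] \<and> 0 < x \<and> x < p \<and>
     arcs_ok p ts n x as x \<and> arcs_ok p ts n y bs y \<and>
     0 < g \<and> g < 4096 \<and> even_num (num_of_int g) \<and>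
     (if p mod 4 = 1 then 3 else -1) * x * pow_tab p ts g mod p = y"

fun arcs_cert :: "int \<Rightarrow> int list \<Rightarrow> int \<Rightarrow> (int \<times> int \<times> int) list \<Rightarrow> (int \<times> int \<times> int) list \<Rightarrow> bool" where
  "arcs_cert p ts g as bs = arcs_cert_ok p ts (range_bound p) g as bs (start p ts as) (start p ts bs)"

fun cert_ok :: "int \<Rightarrow> cert \<Rightarrow> bool" where
  "cert_ok p (Small_order k) \<longleftrightarrow> 0 < k \<and> 2 * k < p - 1 \<and> pow_tab p (squares_mod p 12 9) k = 1"
| "cert_ok p (Arcs g as bs) \<longleftrightarrow> arcs_cert p (squares_mod p 12 3) g as bs"

lemma cert_ok_correct:
  assumes p: "prime p" "11 \<le> p" "p < 4096" and ok: "cert_ok (int p) c"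
    and ord: "ord p 9 = (p - 1) div 2" and v: "\<not> int p dvd v"
  shows "covered (int p) (nat (range_bound (int p))) v"
proof (cases c)
  case (Small_order k)
  with ok have k: "0 < k" "2 * k < int p - 1" "pow_tab p (squares_mod p 12 9) k = 1" by auto
  hence "[(9::int) ^ nat k = 9 ^ 0] (mod int p)"
    using pow_tab_correct[of k p 9] p by (simp add: cong_sym)
  hence "ord p 9 dvd nat k"
    using pow9_cong_iff[of p "nat k" 0] p by (simp add: cong_0_iff)
  hence "ord p 9 \<le> nat k" using k by (intro dvd_imp_le) auto
  moreover have "p - 1 = 2 * ((p - 1) div 2)" using p prime_odd_nat[of p] by simp
  ultimately show ?thesis using ord k p by linarith
next
  case (Arcs g as bs)
  let ?p = "int p" and ?n = "range_bound (int p)" and ?T = "squares_mod (int p) 12 3"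
  define x where "x = start ?p ?T as"
  define y where "y = start ?p ?T bs"
  define \<nu> :: int where "\<nu> = (if ?p mod 4 = 1 then 3 else -1)"
  have *: "arcs_cert_ok ?p ?T ?n g as bs x y" using ok Arcs by (simp add: x_def y_def)
  hence x: "0 < x" "x < ?p" and g: "0 < g" "g < 4096" "even (nat g)"
    and as: "arcs_ok ?p ?T ?n x as x" "as \<noteq> []" and bs: "arcs_ok ?p ?T ?n y bs y" "bs \<noteq> []"
    and y: "\<nu> * x * pow_tab ?p ?T g mod ?p = y"
    by (auto simp: arcs_cert_ok_def \<nu>_def even_num_of_int)
  have n: "?n < 4096" using p by (auto simp: range_bound_def)
  have "odd p" using p prime_odd_nat[of p] by simp
  have nu: "\<not> ?p dvd \<nu> \<and> (\<forall>t. \<not> [\<nu> = 9 ^ t] (mod ?p))"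
  proof (cases "?p mod 4 = 1")
    case True
    hence "p mod 4 = 1" by presburger
    hence "even (ord p 9)" unfolding ord by presburger
    thus ?thesis using three_not_pow9[of p] p True by (auto simp: \<nu>_def dest: zdvd_imp_le)
  next
    case False
    hence "p mod 4 = 3" using \<open>odd p\<close> by presburger
    hence "odd (ord p 9)" unfolding ord by presburger
    thus ?thesis using minus_one_not_pow9[of p] p False by (auto simp: \<nu>_def)
  qed
  have "\<not> ?p dvd x" using x by (auto dest: zdvd_imp_le)
  then obtain t where "[v = x * 9 ^ t] (mod ?p) \<or> [v = \<nu> * x * 9 ^ t] (mod ?p)"
    using two_orbits[of p \<nu> x v] p ord nu v by auto
  thus ?thesis
  proof
    assume "[v = x * 9 ^ t] (mod ?p)"
    thus ?thesis using arcs_ok_orbit[OF as n, of t] covered_cong cong_sym by blast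
  next
    assume v': "[v = \<nu> * x * 9 ^ t] (mod ?p)"
    obtain h where h: "nat g = 2 * h" using g(3) by blast
    have "[pow_tab ?p ?T g = 3 ^ nat g] (mod ?p)" using g by (intro pow_tab_correct)
    hence "[y = \<nu> * x * 9 ^ h] (mod ?p)"
      unfolding y[symmetric] by (simp add: h power_mult cong_scalar_left)
    \<comment> \<open>The second chain starts at \<open>\<nu> * x * 9 ^ h\<close>, so
      \<open>s\<close> must represent t - h modulo the order of 9; adding h times that order keeps
      it natural.\<close>
    obtain s where s: "[9 ^ (h + s) = 9 ^ t] (mod ?p)"
    proof -
      have "ord p 9 > 0" using ord p by simp
      have "[h + (t + h * (ord p 9 - 1)) = t + h * ord p 9] (mod ord p 9)"
        using \<open>ord p 9 > 0\<close> by (cases "ord p 9") (auto simp: algebra_simps)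
      hence "[h + (t + h * (ord p 9 - 1)) = t] (mod ord p 9)"
        by (metis cong_add_lcancel_0_nat cong_mult_self_right cong_trans)
      hence "[(9::int) ^ (h + (t + h * (ord p 9 - 1))) = 9 ^ t] (mod ?p)"
        using pow9_cong_iff[of p] p by auto
      thus ?thesis using that by blast
    qed
    have "[y * 9 ^ s = \<nu> * x * 9 ^ h * 9 ^ s] (mod ?p)"
      using \<open>[y = \<nu> * x * 9 ^ h] (mod ?p)\<close> by (rule cong_scalar_right)
    also have "\<nu> * x * 9 ^ h * 9 ^ s = \<nu> * x * 9 ^ (h + s)" by (simp add: power_add)
    also have "[\<nu> * x * 9 ^ (h + s) = \<nu> * x * 9 ^ t] (mod ?p)" using s by (rule cong_scalar_left)
    also have "[\<nu> * x * 9 ^ t = v] (mod ?p)" using v' by (rule cong_sym)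
    finally show ?thesis using arcs_ok_orbit[OF bs n, of s] covered_cong by blast
  qed
qed

text \<open>These are the primes below 64, enough to detect every composite below 64^2 = 4096. Only
  soundness needs proof: a composite that slipped through would make the check fail. The test
  \<open>d < m\<close> spares the listed primes themselves.\<close>

definition has_small_divisor :: "int \<Rightarrow> bool" where
  "has_small_divisor m \<longleftrightarrow>
     list_ex (\<lambda>d. d < m \<and> m mod d = 0)
       [2, 3, 5, 7, 11, 13, 17, 19, 23, 29, 31, 37, 41, 43, 47, 53, 59, 61]"

lemma not_has_small_divisor_prime:
  assumes "prime p"
  shows "\<not> has_small_divisor (int p)"
proof
  assume "has_small_divisor (int p)"
  then obtain d :: int where "d \<in> set [2, 3, 5, 7, 11, 13, 17, 19, 23, 29, 31, 37, 41, 43, 47, 53, 59, 61]"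
    and d: "d < int p" "int p mod d = 0"
    unfolding has_small_divisor_def list_ex_iff by (elim bexE conjE) (rule that)
  hence "1 < d" and "d dvd int p" by auto
  moreover have "prime (int p)" using assms by simp
  ultimately have "d = 1 \<or> d = int p"
    unfolding prime_int_iff by (meson less_imp_le order_less_trans zero_less_one)
  with \<open>1 < d\<close> d(1) show False by simp
qed

text \<open>Every number between consecutive listed primes must have a small divisor, so a
  successful check also shows that no prime from \<open>a\<close> to \<open>b - 1\<close> was left
  out.\<close>

fun certs_ok :: "int \<Rightarrow> (int \<times> cert) list \<Rightarrow> int \<Rightarrow> bool" where
  "certs_ok a [] b \<longleftrightarrow> list_all has_small_divisor [a..b - 1]"
| "certs_ok a ((p, c) # cs) b \<longleftrightarrow>
     list_all has_small_divisor [a..p - 1] \<and> cert_ok p c \<and> certs_ok (p + 1) cs b"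

lemma certs_ok_correct:
  assumes "certs_ok a cs b" "prime p" "a \<le> int p" "int p < b"
  shows "\<exists>c. cert_ok (int p) c"
  using assms
proof (induction cs arbitrary: a)
  case Nil
  thus ?case using not_has_small_divisor_prime[of p] by (auto simp: list_all_iff)
next
  case (Cons x cs)
  obtain q c where x: "x = (q, c)" by force
  consider "int p < q" | "int p = q" | "int p > q" by linarith
  thus ?case
  proof cases
    case 1
    thus ?thesis
      using Cons.prems x not_has_small_divisor_prime[of p] by (auto simp: list_all_iff)
  qed (use Cons x in auto)
qed

text \<open>How to read an entry: modulo 11 the arc (2,3,6) starts at 9 - 27 = 4 and stops before 4
  * 3^6 = 1, where (4,1,4) starts with 81 - 3 = 1; then 3^4 = 4 closes the orbit. The other list
  starts at 9 - 3 = 6 = (-1) * 4 * 3^4, whence the leading 4.\<close>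

lemma certs_11_512: "certs_ok 11
   [(11, Arcs 4 [(2,3,6), (4,1,4)] [(2,1,8), (2,5,2)]), (13, Small_order 3),
    (17, Arcs 6 [(2,3,16)] [(2,1,16)]), (19, Arcs 8 [(2,1,10), (2,3,8)] [(4,1,10), (2,5,8)]),
    (23, Arcs 12 [(2,1,16), (4,1,6)] [(2,3,16), (2,5,6)]),
    (29, Arcs 14 [(2,1,16), (8,1,10), (4,1,2)] [(2,3,16), (2,9,10), (2,5,2)]),
    (31, Arcs 4 [(4,1,14), (12,1,2), (2,5,14)] [(2,1,16), (2,3,14)]), (37, Small_order 9),
    (41, Small_order 4),
    (43, Arcs 8 [(2,1,22), (2,3,20)] [(8,1,16), (14,1,6), (2,9,14), (18,1,6)]),
    (47, Arcs 24 [(2,1,12), (8,1,16), (2,5,18)] [(2,3,12), (2,9,14), (4,1,20)]),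
    (53, Arcs 26 [(2,1,16), (6,1,16), (4,1,20)] [(2,3,16), (2,7,16), (2,5,20)]),
    (59, Arcs 28 [(2,3,26), (4,1,14), (8,1,18)] [(2,1,30), (6,1,12), (2,9,16)]),
    (61, Small_order 5), (67, Small_order 11),
    (71, Arcs 36 [(2,1,32), (6,1,22), (2,9,16)] [(2,3,32), (2,7,20), (8,1,18)]),
    (73, Small_order 6),
    (79, Arcs 44 [(8,1,34), (16,1,6), (2,9,22), (12,1,16)] [(2,1,40), (2,3,38)]),
    (83, Arcs 40 [(2,3,28), (2,7,22), (10,1,32)] [(2,1,28), (6,1,24), (2,11,30)]),
    (89, Arcs 42 [(2,3,32), (14,1,20), (2,9,36)] [(2,1,18), (12,1,34), (8,1,36)]),
    (97, Small_order 24),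
    (101, Arcs 50 [(2,1,14), (4,1,40), (6,1,46)] [(2,3,30), (8,1,24), (2,7,46)]),
    (103, Small_order 17),
    (107, Arcs 52 [(2,3,40), (2,7,26), (2,9,40)] [(2,1,40), (6,1,26), (8,1,40)]),
    (109, Small_order 27),
    (113, Arcs 54 [(2,3,36), (2,7,30), (8,1,46)] [(2,1,36), (6,1,32), (2,9,44)]),
    (127, Arcs 6 [(8,1,52), (16,1,30), (2,13,44)] [(2,1,64), (2,3,62)]),
    (131, Arcs 64 [(2,3,16), (2,7,60), (14,1,54)] [(2,1,16), (6,1,62), (2,15,52)]),
    (137, Arcs 66 [(2,3,52), (14,1,56), (2,7,28)] [(2,1,54), (2,15,54), (6,1,28)]),
    (139, Arcs 8 [(2,1,70), (2,3,68)] [(10,1,56), (14,1,14), (2,11,56), (2,15,12)]),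
    (149, Arcs 74 [(2,1,74), (2,9,68), (6,1,6)] [(2,3,72), (8,1,30), (2,11,46)]),
    (151, Small_order 25), (157, Small_order 39),
    (163, Arcs 120 [(2,1,82), (2,3,80)] [(4,1,30), (16,1,52), (2,5,30), (2,17,50)]),
    (167, Arcs 84 [(2,1,58), (12,1,72), (2,11,36)] [(2,3,58), (2,13,70), (10,1,38)]),
    (173, Arcs 86 [(2,1,66), (8,1,44), (6,1,62)] [(2,3,66), (2,9,44), (2,7,62)]),
    (179, Arcs 88 [(2,3,60), (10,1,74), (2,9,44)] [(2,1,62), (2,11,72), (8,1,44)]),
    (181, Small_order 45),
    (191, Arcs 96 [(2,1,70), (2,13,62), (4,1,58)] [(2,3,68), (12,1,64), (2,5,58)]),
    (193, Small_order 8),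
    (197, Arcs 98 [(2,1,32), (2,5,96), (2,9,68)] [(2,3,30), (4,1,96), (8,1,70)]),
    (199, Arcs 8 [(14,1,34), (18,1,66), (2,15,34), (2,19,64)] [(2,1,100), (2,3,98)]),
    (211, Arcs 156 [(2,1,106), (2,3,104)] [(2,9,52), (12,1,74), (10,1,84)]),
    (223, Arcs 186 [(4,1,46), (2,15,88), (2,13,88)] [(2,1,112), (2,3,110)]),
    (227, Arcs 112 [(2,3,70), (2,7,90), (4,1,66)] [(2,1,70), (6,1,92), (2,5,64)]),
    (229, Small_order 57),
    (233, Arcs 114 [(2,3,102), (2,9,60), (2,7,70)] [(2,1,102), (8,1,60), (6,1,70)]),
    (239, Arcs 120 [(2,1,58), (6,1,106), (2,5,74)] [(2,3,82), (8,1,80), (4,1,76)]),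
    (241, Small_order 60),
    (251, Arcs 124 [(2,3,42), (2,7,110), (2,5,98)] [(2,1,42), (6,1,110), (4,1,98)]),
    (257, Arcs 126 [(2,3,106), (2,5,30), (2,7,120)] [(2,1,106), (4,1,30), (6,1,120)]),
    (263, Arcs 132 [(2,1,114), (2,9,116), (2,25,32)] [(2,3,112), (8,1,116), (24,1,34)]),
    (269, Arcs 134 [(2,1,104), (2,9,94), (4,1,70)] [(2,3,102), (8,1,96), (2,5,70)]),
    (271, Small_order 15), (277, Small_order 69),
    (281, Arcs 138 [(2,3,64), (10,1,84), (4,1,132)] [(2,1,96), (12,1,130), (6,1,54)]),
    (283, Arcs 108 [(2,1,142), (2,3,140)] [(10,1,52), (12,1,128), (16,1,102)]),
    (293, Arcs 146 [(2,1,86), (2,9,134), (10,1,72)] [(2,3,84), (8,1,136), (2,11,72)]),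
    (307, Small_order 17),
    (311, Arcs 156 [(2,1,116), (12,1,134), (4,1,60)] [(2,3,116), (2,13,134), (2,5,60)]),
    (313, Small_order 39),
    (317, Arcs 158 [(2,1,150), (8,1,112), (2,11,54)] [(2,3,150), (2,9,110), (10,1,56)]),
    (331, Arcs 310 [(2,1,166), (2,3,164)] [(4,1,86), (2,11,80), (2,5,84), (10,1,80)]),
    (337, Small_order 84),
    (347, Arcs 172 [(2,3,104), (2,5,152), (10,1,90)] [(2,1,104), (4,1,154), (2,11,88)]),
    (349, Small_order 87),
    (353, Arcs 174 [(2,3,160), (4,1,54), (2,11,138)] [(2,1,162), (2,5,52), (10,1,138)]),
    (359, Arcs 180 [(2,1,150), (2,13,136), (2,5,72)] [(2,3,148), (12,1,136), (4,1,74)]),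
    (367, Small_order 61), (373, Small_order 93),
    (379, Arcs 332 [(2,1,190), (2,3,188)] [(4,1,82), (14,1,108), (2,5,82), (2,15,106)]),
    (383, Arcs 192 [(2,1,162), (10,1,100), (6,1,120)] [(2,3,162), (2,11,100), (2,7,120)]),
    (389, Arcs 194 [(2,1,178), (2,11,172), (8,1,38)] [(2,3,176), (10,1,174), (2,9,38)]),
    (397, Small_order 99),
    (401, Arcs 198 [(2,3,118), (4,1,170), (32,1,112)] [(2,1,200), (2,49,148), (2,23,52)]),
    (409, Small_order 102),
    (419, Arcs 208 [(2,3,98), (10,1,146), (2,7,174)] [(2,1,100), (2,11,144), (6,1,174)]),
    (421, Small_order 105), (431, Small_order 43), (433, Small_order 27), (439, Small_order 73),
    (443, Arcs 220 [(2,3,208), (2,5,86), (8,1,148)] [(2,1,208), (4,1,186), (10,1,48)]),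
    (449, Arcs 222 [(2,3,212), (2,9,126), (4,1,110)] [(2,1,212), (8,1,128), (2,5,108)]),
    (457, Small_order 114),
    (461, Arcs 230 [(2,1,136), (2,5,222), (6,1,102)] [(2,3,134), (4,1,224), (2,7,102)]),
    (463, Arcs 176 [(4,1,152), (2,23,80), (2,5,150), (22,1,80)] [(2,1,232), (2,3,230)]),
    (467, Arcs 232 [(2,3,202), (2,5,58), (12,1,206)] [(2,1,202), (4,1,60), (2,13,204)]),
    (479, Arcs 238 [(2,5,236), (14,1,132), (2,17,110)] [(4,1,238), (2,15,130), (16,1,110)]),
    (487, Arcs 442 [(4,1,214), (12,1,126), (10,1,146)] [(2,1,244), (2,3,242)]),
    (491, Small_order 49), (499, Small_order 83),
    (503, Arcs 252 [(2,1,242), (2,15,226), (2,13,34)] [(2,3,240), (14,1,226), (12,1,36)]),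
    (509, Arcs 254 [(2,1,184), (2,5,92), (2,9,232)] [(2,3,182), (4,1,92), (8,1,234)])] 512"
  by code_simp

lemma certs_512_1024: "certs_ok 512
   [(521, Arcs 258 [(2,3,76), (2,7,218), (2,5,226)] [(2,1,76), (6,1,218), (4,1,226)]),
    (523, Small_order 29), (541, Small_order 135), (547, Small_order 7),
    (557, Arcs 278 [(2,1,250), (2,5,112), (10,1,194)] [(2,3,248), (4,1,114), (2,11,194)]),
    (563, Arcs 280 [(2,3,146), (12,1,256), (14,1,160)] [(2,1,148), (2,13,256), (2,15,158)]),
    (569, Arcs 282 [(2,3,158), (2,7,174), (10,1,236)] [(2,1,158), (6,1,176), (2,11,234)]),
    (571, Arcs 462 [(2,1,286), (2,3,284)] [(8,1,186), (12,1,100), (2,9,186), (2,13,98)]),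
    (577, Small_order 24),
    (587, Arcs 294 [(4,1,232), (8,1,66), (2,7,288)] [(2,5,232), (2,9,64), (6,1,290)]),
    (593, Arcs 294 [(2,3,154), (4,1,234), (8,1,204)] [(2,1,156), (2,5,166), (6,1,270)]),
    (599, Arcs 300 [(2,1,198), (6,1,270), (2,11,130)] [(2,3,198), (2,7,268), (10,1,132)]),
    (601, Small_order 75),
    (607, Arcs 320 [(8,1,170), (12,1,244), (2,11,192)] [(2,1,304), (2,3,302)]),
    (613, Small_order 51),
    (617, Arcs 306 [(2,3,228), (2,7,232), (8,1,156)] [(2,1,228), (6,1,234), (2,9,154)]),
    (619, Small_order 103),
    (631, Arcs 124 [(4,1,192), (2,9,124), (2,5,190), (8,1,124)] [(2,1,316), (2,3,314)]),
    (641, Arcs 318 [(2,3,136), (8,1,256), (2,7,248)] [(2,1,138), (2,9,254), (6,1,248)]),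
    (643, Small_order 107),
    (647, Arcs 324 [(2,1,154), (2,9,234), (10,1,258)] [(2,3,152), (8,1,236), (2,11,258)]),
    (653, Arcs 326 [(2,1,284), (6,1,132), (2,11,236)] [(2,3,284), (2,7,130), (10,1,238)]),
    (659, Arcs 328 [(2,3,300), (16,1,304), (2,13,54)] [(2,1,302), (2,17,302), (12,1,54)]),
    (661, Small_order 11), (673, Small_order 84),
    (677, Arcs 338 [(2,1,332), (4,1,278), (6,1,66)] [(2,3,332), (2,5,278), (2,7,66)]),
    (683, Small_order 31),
    (691, Arcs 86 [(2,1,346), (2,3,344)] [(4,1,198), (2,9,148), (2,5,196), (8,1,148)]),
    (701, Arcs 350 [(2,1,28), (4,1,346), (6,1,326)] [(2,3,28), (2,5,346), (2,7,326)]),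
    (709, Small_order 177),
    (719, Arcs 360 [(2,1,274), (2,17,308), (8,1,136)] [(2,3,272), (16,1,310), (2,9,136)]),
    (727, Small_order 121), (733, Small_order 183),
    (739, Arcs 264 [(2,1,370), (2,3,368)] [(4,1,228), (2,13,224), (2,15,286)]),
    (743, Arcs 372 [(2,1,256), (6,1,324), (2,5,162)] [(2,3,256), (2,7,322), (4,1,164)]),
    (751, Arcs 200 [(10,1,214), (16,1,350), (2,13,186)] [(2,1,376), (2,3,374)]),
    (757, Small_order 9), (761, Small_order 76), (769, Small_order 24),
    (773, Arcs 386 [(2,1,260), (2,9,340), (6,1,172)] [(2,3,258), (8,1,342), (2,7,172)]),
    (787, Small_order 131),
    (797, Arcs 398 [(2,1,180), (8,1,284), (4,1,332)] [(2,3,180), (2,9,284), (2,5,332)]),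
    (809, Arcs 402 [(2,3,308), (8,1,202), (14,1,298)] [(2,1,310), (2,9,202), (2,15,296)]),
    (811, Arcs 544 [(2,1,406), (2,3,404)] [(4,1,340), (2,9,66), (2,5,338), (8,1,66)]),
    (821, Arcs 410 [(2,1,162), (2,5,334), (12,1,324)] [(2,3,160), (4,1,336), (2,13,324)]),
    (823, Arcs 464 [(10,1,360), (14,1,52), (2,11,360), (2,15,50)] [(2,1,412), (2,3,410)]),
    (827, Arcs 412 [(2,3,180), (10,1,340), (2,17,306)] [(2,1,182), (2,11,338), (16,1,306)]),
    (829, Small_order 207),
    (839, Arcs 420 [(2,1,264), (2,5,382), (8,1,192)] [(2,3,262), (4,1,384), (2,9,192)]),
    (853, Small_order 71),
    (857, Arcs 426 [(2,3,276), (2,11,330), (26,1,250)] [(2,1,276), (10,1,178), (20,1,402)]),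
    (859, Arcs 178 [(2,1,430), (2,3,428)] [(8,1,204), (10,1,226), (2,9,204), (2,11,224)]),
    (863, Arcs 432 [(2,1,404), (12,1,352), (8,1,106)] [(2,3,404), (2,13,352), (2,9,106)]),
    (877, Small_order 219),
    (881, Arcs 438 [(2,3,166), (2,5,356), (8,1,358)] [(2,1,166), (4,1,358), (2,9,356)]),
    (883, Small_order 63),
    (887, Arcs 444 [(2,1,306), (2,9,258), (10,1,322)] [(2,3,304), (8,1,260), (2,11,322)]),
    (907, Arcs 520 [(2,1,454), (2,3,452)] [(8,1,184), (10,1,416), (12,1,306)]),
    (911, Arcs 456 [(2,1,146), (4,1,316), (2,9,448)] [(2,3,146), (2,5,314), (8,1,450)]),
    (919, Small_order 153),
    (929, Arcs 462 [(2,3,392), (4,1,278), (8,1,258)] [(2,1,394), (2,5,460), (10,1,74)]),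
    (937, Small_order 117),
    (941, Arcs 470 [(2,1,348), (8,1,314), (2,5,278)] [(2,3,348), (2,9,312), (4,1,280)]),
    (947, Arcs 472 [(2,3,454), (2,27,430), (2,13,62)] [(2,1,454), (26,1,430), (12,1,62)]),
    (953, Arcs 474 [(2,3,342), (2,5,284), (8,1,326)] [(2,1,342), (4,1,280), (6,1,330)]),
    (967, Small_order 161),
    (971, Arcs 484 [(2,3,476), (20,1,464), (2,13,30)] [(2,1,200), (4,1,326), (2,19,444)]),
    (977, Arcs 486 [(2,3,340), (2,7,474), (4,1,162)] [(2,1,340), (6,1,476), (2,5,160)]),
    (983, Arcs 492 [(2,1,308), (2,11,468), (2,5,206)] [(2,3,306), (10,1,468), (4,1,208)]),
    (991, Small_order 165), (997, Small_order 83), (1009, Small_order 84),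
    (1013, Arcs 506 [(2,1,192), (10,1,338), (12,1,482)] [(2,3,192), (2,11,498), (8,1,322)]),
    (1019, Arcs 508 [(2,3,382), (2,7,268), (2,9,368)] [(2,1,382), (6,1,268), (8,1,368)]),
    (1021, Small_order 17)] 1024"
  by code_simp

lemma certs_1024_1536: "certs_ok 1024
   [(1031, Arcs 516 [(2,1,292), (2,9,282), (4,1,456)] [(2,3,290), (8,1,284), (2,5,456)]),
    (1033, Small_order 258),
    (1039, Arcs 284 [(8,1,512), (2,15,504), (12,1,22)] [(2,1,520), (2,3,518)]),
    (1049, Arcs 522 [(2,3,140), (2,5,422), (2,9,486)] [(2,1,140), (4,1,422), (8,1,486)]),
    (1051, Small_order 105),
    (1061, Arcs 530 [(2,1,366), (2,9,380), (2,5,314)] [(2,3,364), (8,1,380), (4,1,316)]),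
    (1063, Arcs 846 [(10,1,492), (12,1,258), (14,1,312)] [(2,1,532), (2,3,530)]),
    (1069, Small_order 267),
    (1087, Arcs 1078 [(2,5,464), (10,1,288), (2,9,334)] [(2,1,544), (2,3,542)]),
    (1091, Small_order 109), (1093, Small_order 7),
    (1097, Arcs 546 [(2,3,182), (4,1,390), (14,1,524)] [(2,1,184), (2,5,390), (2,15,522)]),
    (1103, Arcs 552 [(2,1,428), (2,11,492), (2,5,182)] [(2,3,426), (10,1,492), (4,1,184)]),
    (1109, Arcs 554 [(2,1,408), (6,1,548), (2,13,152)] [(2,3,408), (2,7,546), (12,1,154)]),
    (1117, Small_order 93),
    (1123, Arcs 34 [(2,1,562), (2,3,560)] [(4,1,492), (12,1,104), (2,15,526)]),
    (1129, Small_order 282),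
    (1151, Arcs 576 [(2,1,476), (2,5,520), (2,9,154)] [(2,3,474), (4,1,520), (8,1,156)]),
    (1153, Small_order 288),
    (1163, Arcs 580 [(2,3,444), (4,1,190), (2,9,528)] [(2,1,446), (2,5,188), (8,1,528)]),
    (1171, Small_order 117), (1181, Small_order 10),
    (1187, Arcs 592 [(2,3,484), (8,1,226), (2,7,476)] [(2,1,486), (2,9,224), (6,1,476)]),
    (1193, Arcs 594 [(2,3,258), (2,5,528), (2,9,406)] [(2,1,258), (4,1,528), (8,1,406)]),
    (1201, Small_order 150), (1213, Small_order 303),
    (1217, Arcs 606 [(2,3,324), (10,1,578), (2,7,314)] [(2,1,326), (2,11,576), (6,1,314)]),
    (1223, Small_order 47),
    (1229, Arcs 614 [(2,1,548), (2,15,594), (6,1,86)] [(2,3,546), (14,1,596), (2,7,86)]),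
    (1231, Arcs 542 [(8,1,496), (10,1,120), (2,9,496), (2,11,118)] [(2,1,616), (2,3,614)]),
    (1237, Small_order 309), (1249, Small_order 104),
    (1259, Arcs 628 [(2,3,154), (4,1,504), (2,9,600)] [(2,1,156), (2,5,502), (8,1,600)]),
    (1277, Arcs 638 [(2,1,592), (6,1,572), (4,1,112)] [(2,3,592), (2,7,572), (2,5,112)]),
    (1279, Arcs 1198 [(2,5,538), (10,1,378), (8,1,362)] [(2,1,640), (2,3,638)]),
    (1283, Arcs 640 [(2,3,252), (2,7,486), (2,11,544)] [(2,1,252), (6,1,486), (10,1,544)]),
    (1289, Small_order 92),
    (1291, Arcs 1070 [(2,1,646), (2,3,644)] [(8,1,148), (2,11,498), (2,9,146), (10,1,498)]),
    (1297, Small_order 81),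
    (1301, Arcs 650 [(2,1,532), (2,11,628), (6,1,140)] [(2,3,530), (10,1,630), (2,7,140)]),
    (1303, Small_order 217),
    (1307, Arcs 652 [(2,3,468), (2,11,556), (4,1,282)] [(2,1,468), (10,1,558), (2,5,280)]),
    (1319, Arcs 660 [(2,1,634), (12,1,286), (6,1,398)] [(2,3,634), (2,13,562), (16,1,122)]),
    (1321, Small_order 55),
    (1327, Arcs 938 [(2,9,378), (12,1,628), (16,1,320)] [(2,1,664), (2,3,662)]),
    (1361, Arcs 678 [(2,3,322), (2,7,426), (2,9,612)] [(2,1,322), (6,1,426), (8,1,612)]),
    (1367, Arcs 684 [(2,1,380), (6,1,558), (2,5,428)] [(2,3,380), (2,7,556), (4,1,430)]),
    (1373, Arcs 686 [(2,1,438), (2,5,466), (6,1,468)] [(2,3,436), (4,1,468), (2,7,468)]),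
    (1381, Small_order 345), (1399, Small_order 233),
    (1409, Arcs 702 [(2,3,596), (2,7,238), (4,1,574)] [(2,1,596), (6,1,240), (2,5,572)]),
    (1423, Arcs 1144 [(4,1,458), (10,1,626), (12,1,338)] [(2,1,712), (2,3,710)]),
    (1427, Arcs 712 [(2,3,608), (10,1,448), (2,9,370)] [(2,1,610), (2,11,562), (12,1,254)]),
    (1429, Small_order 357),
    (1433, Arcs 714 [(2,3,708), (2,7,448), (2,9,276)] [(2,1,708), (6,1,448), (8,1,276)]),
    (1439, Arcs 720 [(2,1,438), (10,1,424), (2,9,576)] [(2,3,426), (2,7,434), (8,1,578)]),
    (1447, Arcs 1104 [(10,1,116), (2,15,608), (2,11,126), (16,1,596)] [(2,1,724), (2,3,722)]),
    (1451, Arcs 724 [(2,3,152), (2,25,684), (26,1,614)] [(2,1,722), (2,31,674), (14,1,54)]),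
    (1453, Small_order 363),
    (1459, Arcs 810 [(2,1,730), (2,3,728)] [(8,1,530), (10,1,364), (12,1,564)]),
    (1471, Small_order 147),
    (1481, Arcs 738 [(2,3,704), (8,1,646), (2,7,130)] [(2,1,706), (2,9,644), (6,1,130)]),
    (1483, Arcs 410 [(2,1,742), (2,3,740)] [(10,1,526), (26,1,622), (22,1,334)]),
    (1487, Arcs 744 [(2,1,122), (6,1,694), (2,13,670)] [(2,3,122), (2,7,692), (12,1,672)]),
    (1489, Small_order 372),
    (1493, Arcs 746 [(2,1,686), (6,1,236), (2,5,570)] [(2,3,686), (2,7,234), (4,1,572)]),
    (1499, Arcs 748 [(2,3,680), (12,1,374), (14,1,444)] [(2,1,682), (2,13,392), (16,1,424)]),
    (1511, Small_order 151),
    (1523, Arcs 760 [(2,3,390), (2,13,458), (18,1,674)] [(2,1,390), (12,1,460), (2,19,672)]),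
    (1531, Small_order 85)] 1536"
  by code_simp

lemma certs_1536_2048: "certs_ok 1536
   [(1543, Small_order 257), (1549, Small_order 129),
    (1553, Arcs 774 [(2,3,420), (8,1,690), (4,1,442)] [(2,1,422), (2,9,690), (2,5,440)]),
    (1559, Arcs 780 [(2,1,378), (14,1,676), (2,9,504)] [(2,3,200), (2,7,606), (12,1,752)]),
    (1567, Arcs 474 [(4,1,518), (12,1,698), (2,11,350)] [(2,1,784), (2,3,782)]),
    (1571, Arcs 784 [(2,3,682), (10,1,392), (2,7,496)] [(2,1,684), (2,11,390), (6,1,496)]),
    (1579, Arcs 784 [(2,1,790), (2,3,788)] [(4,1,548), (2,9,242), (2,5,546), (8,1,242)]),
    (1583, Small_order 113), (1597, Small_order 19),
    (1601, Arcs 798 [(2,3,418), (8,1,606), (4,1,576)] [(2,1,420), (2,9,606), (2,5,574)]),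
    (1607, Arcs 804 [(2,1,656), (2,13,542), (16,1,408)] [(2,3,654), (12,1,544), (2,17,408)]),
    (1609, Small_order 134),
    (1613, Arcs 806 [(2,1,574), (2,15,744), (12,1,294)] [(2,3,572), (14,1,746), (2,13,294)]),
    (1619, Arcs 808 [(2,3,746), (2,9,432), (2,7,440)] [(2,1,746), (8,1,432), (6,1,440)]),
    (1621, Small_order 45),
    (1627, Arcs 1608 [(2,1,814), (2,3,812)] [(4,1,272), (8,1,542), (2,5,272), (2,9,540)]),
    (1637, Arcs 818 [(2,1,572), (6,1,398), (8,1,666)] [(2,3,572), (2,7,806), (10,1,258)]),
    (1657, Small_order 207),
    (1663, Arcs 146 [(8,1,624), (10,1,208), (2,9,624), (2,11,206)] [(2,1,832), (2,3,830)]),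
    (1667, Arcs 832 [(2,3,120), (2,11,792), (2,7,754)] [(2,1,120), (10,1,792), (6,1,754)]),
    (1669, Small_order 139), (1693, Small_order 423),
    (1697, Arcs 846 [(2,3,762), (2,9,760), (4,1,174)] [(2,1,762), (8,1,762), (2,5,172)]),
    (1699, Arcs 722 [(2,1,850), (2,3,848)] [(14,1,776), (20,1,406), (2,17,516)]),
    (1709, Arcs 854 [(2,1,624), (6,1,788), (2,5,296)] [(2,3,624), (2,7,786), (4,1,298)]),
    (1721, Arcs 858 [(2,3,768), (18,1,834), (2,15,118)] [(2,1,770), (2,19,832), (14,1,118)]),
    (1723, Arcs 1510 [(2,1,862), (2,3,860)] [(2,5,38), (12,1,834), (10,1,850)]),
    (1733, Arcs 866 [(2,1,772), (16,1,250), (4,1,710)] [(2,3,772), (2,17,728), (18,1,232)]),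
    (1741, Small_order 435),
    (1747, Arcs 564 [(2,1,874), (2,3,872)] [(2,5,350), (8,1,848), (10,1,548)]),
    (1753, Small_order 438), (1759, Small_order 293), (1777, Small_order 444),
    (1783, Small_order 297),
    (1787, Arcs 892 [(2,3,682), (8,1,310), (2,7,794)] [(2,1,622), (2,5,370), (6,1,794)]),
    (1789, Small_order 447), (1801, Small_order 225),
    (1811, Arcs 904 [(2,3,668), (2,7,840), (2,11,302)] [(2,1,668), (6,1,840), (10,1,302)]),
    (1823, Arcs 912 [(2,1,582), (6,1,416), (8,1,824)] [(2,3,582), (2,7,416), (2,9,824)]),
    (1831, Arcs 168 [(4,1,228), (10,1,688), (2,5,228), (2,11,686)] [(2,1,916), (2,3,914)]),
    (1847, Arcs 924 [(2,1,888), (4,1,594), (6,1,364)] [(2,3,888), (2,5,594), (2,7,364)]),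
    (1861, Small_order 155), (1867, Small_order 311), (1871, Small_order 17),
    (1873, Small_order 468), (1877, Small_order 134), (1879, Small_order 313),
    (1889, Arcs 942 [(2,3,862), (2,5,768), (10,1,258)] [(2,1,862), (4,1,438), (8,1,588)]),
    (1901, Arcs 950 [(2,1,436), (4,1,868), (6,1,596)] [(2,3,436), (2,5,868), (2,7,596)]),
    (1907, Arcs 952 [(2,3,378), (2,5,624), (2,9,904)] [(2,1,378), (4,1,624), (8,1,904)]),
    (1913, Arcs 954 [(2,3,378), (2,7,676), (10,1,858)] [(2,1,378), (6,1,678), (2,11,856)]),
    (1931, Arcs 964 [(2,3,782), (12,1,720), (2,9,428)] [(2,1,784), (2,13,932), (16,1,214)]),
    (1933, Small_order 161),
    (1949, Arcs 974 [(2,1,456), (2,9,834), (6,1,658)] [(2,3,454), (8,1,836), (2,7,658)]),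
    (1951, Arcs 354 [(8,1,42), (2,11,934), (2,9,40), (10,1,934)] [(2,1,976), (2,3,974)]),
    (1973, Arcs 986 [(2,1,654), (2,13,842), (4,1,476)] [(2,3,652), (12,1,844), (2,5,476)]),
    (1979, Arcs 988 [(2,3,974), (2,21,898), (26,1,106)] [(2,1,974), (20,1,664), (2,13,340)]),
    (1987, Arcs 1942 [(2,1,994), (2,3,992)] [(4,1,634), (16,1,522), (2,15,830)]),
    (1993, Small_order 249),
    (1997, Arcs 998 [(2,1,384), (2,5,946), (6,1,666)] [(2,3,382), (4,1,948), (2,7,666)]),
    (1999, Arcs 264 [(8,1,332), (14,1,668), (2,9,332), (2,15,666)] [(2,1,1000), (2,3,998)]),
    (2003, Arcs 1000 [(2,3,554), (2,5,482), (2,7,966)] [(2,1,554), (4,1,482), (6,1,966)]),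
    (2011, Arcs 364 [(2,1,1006), (2,3,1004)] [(10,1,624), (2,15,640), (16,1,746)]),
    (2017, Small_order 504),
    (2027, Arcs 1012 [(2,3,786), (8,1,926), (2,7,314)] [(2,1,788), (2,9,924), (6,1,314)]),
    (2029, Small_order 169),
    (2039, Arcs 1020 [(2,1,944), (8,1,660), (6,1,434)] [(2,3,944), (2,9,660), (2,7,434)])] 2048"
  by code_simp

lemma certs_2048_2560: "certs_ok 2048
   [(2053, Small_order 513),
    (2063, Arcs 1032 [(2,1,566), (4,1,716), (12,1,780)] [(2,3,566), (2,5,716), (2,13,780)]),
    (2069, Arcs 1034 [(2,1,816), (2,5,538), (8,1,714)] [(2,3,814), (4,1,974), (10,1,280)]),
    (2081, Arcs 1038 [(2,3,754), (2,7,476), (2,11,850)] [(2,1,754), (6,1,476), (10,1,850)]),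
    (2083, Arcs 338 [(2,1,1042), (2,3,1040)] [(2,11,524), (14,1,594), (16,1,964)]),
    (2087, Arcs 1044 [(2,1,682), (2,11,786), (8,1,618)] [(2,3,680), (10,1,788), (2,9,618)]),
    (2089, Small_order 522),
    (2099, Arcs 1048 [(2,3,1032), (2,11,768), (4,1,298)] [(2,1,1032), (10,1,770), (2,5,296)]),
    (2111, Small_order 211), (2113, Small_order 528),
    (2129, Arcs 1062 [(2,3,372), (2,15,876), (2,5,880)] [(2,1,372), (14,1,892), (16,1,864)]),
    (2131, Small_order 71), (2137, Small_order 267),
    (2141, Arcs 1070 [(2,1,740), (4,1,638), (2,9,762)] [(2,3,740), (2,5,636), (8,1,764)]),
    (2143, Arcs 1252 [(4,1,896), (8,1,176), (2,5,896), (2,9,174)] [(2,1,1072), (2,3,1070)]),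
    (2153, Arcs 1074 [(2,3,734), (2,15,1036), (2,7,382)] [(2,1,734), (14,1,1036), (6,1,382)]),
    (2161, Small_order 108), (2179, Small_order 121), (2203, Small_order 367),
    (2207, Arcs 1104 [(2,1,944), (10,1,824), (6,1,438)] [(2,3,944), (2,11,824), (2,7,438)]),
    (2213, Arcs 1106 [(2,1,1086), (6,1,220), (10,1,906)] [(2,3,1086), (2,7,220), (2,11,906)]),
    (2221, Small_order 185),
    (2237, Arcs 1118 [(2,1,260), (2,9,1006), (4,1,970)] [(2,3,258), (8,1,1008), (2,5,970)]),
    (2239, Arcs 392 [(8,1,20), (10,1,1100), (2,9,20), (2,11,1098)] [(2,1,1120), (2,3,1118)]),
    (2243, Arcs 1120 [(2,3,1072), (2,7,558), (8,1,612)] [(2,1,1072), (6,1,560), (2,9,610)]),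
    (2251, Small_order 125),
    (2267, Arcs 1132 [(2,3,322), (16,1,896), (2,13,1048)] [(2,1,38), (14,1,1122), (2,11,1106)]),
    (2269, Small_order 21),
    (2273, Arcs 1134 [(2,3,376), (2,11,994), (2,7,902)] [(2,1,376), (10,1,994), (6,1,902)]),
    (2281, Small_order 114), (2287, Small_order 381), (2293, Small_order 573),
    (2297, Small_order 164),
    (2309, Arcs 1154 [(2,1,964), (2,9,826), (10,1,518)] [(2,3,962), (8,1,828), (2,11,518)]),
    (2311, Arcs 172 [(2,9,628), (18,1,728), (20,1,954)] [(2,1,1156), (2,3,1154)]),
    (2333, Arcs 1166 [(2,1,48), (6,1,1162), (8,1,1122)] [(2,3,48), (2,7,1162), (2,9,1122)]),
    (2339, Arcs 1168 [(2,3,1048), (8,1,822), (2,11,468)] [(2,1,1050), (2,9,820), (10,1,468)]),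
    (2341, Small_order 195),
    (2347, Arcs 1938 [(2,1,1174), (2,3,1172)] [(4,1,1130), (10,1,44), (2,5,1130), (2,11,42)]),
    (2351, Arcs 1176 [(2,1,540), (6,1,1052), (10,1,758)] [(2,3,540), (2,7,1052), (2,11,758)]),
    (2357, Arcs 1178 [(2,1,700), (6,1,708), (18,1,948)] [(2,3,700), (2,7,708), (2,19,948)]),
    (2371, Arcs 1004 [(2,1,1186), (2,3,1184)] [(4,1,968), (2,11,218), (2,5,966), (10,1,218)]),
    (2377, Small_order 594),
    (2381, Arcs 1190 [(2,1,460), (2,11,740), (12,1,1180)] [(2,3,852), (2,15,832), (2,7,696)]),
    (2383, Small_order 397), (2389, Small_order 199),
    (2393, Arcs 1194 [(2,3,980), (2,13,842), (2,7,570)] [(2,1,980), (12,1,842), (6,1,570)]),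
    (2399, Arcs 1200 [(2,1,394), (2,9,984), (10,1,1020)] [(2,3,392), (8,1,966), (2,7,1040)]),
    (2411, Arcs 1204 [(2,3,978), (2,9,1190), (4,1,242)] [(2,1,978), (8,1,1192), (2,5,240)]),
    (2417, Arcs 1206 [(2,3,1008), (2,25,1082), (2,19,326)] [(2,1,118), (6,1,1142), (20,1,1156)]),
    (2423, Arcs 1212 [(2,1,852), (2,9,608), (2,17,962)] [(2,3,850), (8,1,608), (16,1,964)]),
    (2437, Small_order 609), (2441, Small_order 244),
    (2447, Arcs 1224 [(2,1,1054), (16,1,848), (2,13,544)] [(2,3,1054), (2,17,846), (12,1,546)]),
    (2459, Arcs 1228 [(2,3,840), (2,19,914), (2,11,704)] [(2,1,840), (18,1,914), (10,1,704)]),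
    (2467, Arcs 1286 [(2,1,1234), (2,3,1232)] [(12,1,1128), (14,1,1158), (16,1,180)]),
    (2473, Small_order 309),
    (2477, Arcs 1238 [(2,1,704), (10,1,622), (12,1,1150)] [(2,3,704), (2,11,622), (2,13,1150)]),
    (2503, Arcs 2468 [(4,1,188), (10,1,1064), (2,5,188), (2,11,1062)] [(2,1,1252), (2,3,1250)]),
    (2521, Small_order 63),
    (2531, Arcs 1264 [(2,3,644), (10,1,996), (8,1,890)] [(2,1,646), (2,11,996), (2,9,888)]),
    (2539, Arcs 120 [(2,1,1270), (2,3,1268)] [(2,11,1198), (2,13,1016), (16,1,324)]),
    (2543, Arcs 1272 [(2,1,740), (2,11,684), (6,1,1118)] [(2,3,738), (10,1,686), (2,7,1118)]),
    (2549, Arcs 1274 [(2,1,1058), (20,1,1250), (10,1,240)] [(2,3,546), (16,1,886), (2,15,1116)]),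
    (2551, Small_order 75), (2557, Small_order 639)] 2560"
  by code_simp

lemma certs_2560_3072: "certs_ok 2560
   [(2579, Arcs 1288 [(2,3,610), (2,7,1152), (2,9,816)] [(2,1,610), (6,1,1152), (8,1,816)]),
    (2591, Small_order 259), (2593, Small_order 324),
    (2609, Arcs 1302 [(2,3,718), (2,7,1058), (2,15,832)] [(2,1,718), (6,1,1058), (14,1,832)]),
    (2617, Small_order 218), (2621, Small_order 262),
    (2633, Arcs 1314 [(2,3,736), (4,1,834), (8,1,1062)] [(2,1,738), (2,5,834), (2,9,1060)]),
    (2647, Arcs 986 [(4,1,578), (12,1,1252), (2,11,816)] [(2,1,1324), (2,3,1322)]),
    (2657, Arcs 1326 [(2,3,82), (4,1,1302), (2,15,1272)] [(2,1,770), (16,1,1042), (2,13,844)]),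
    (2659, Arcs 2454 [(2,1,1330), (2,3,1328)] [(4,1,1084), (8,1,246), (2,5,1084), (2,9,244)]),
    (2663, Arcs 1332 [(2,1,1138), (10,1,1210), (2,5,314)] [(2,3,1138), (2,11,1208), (4,1,316)]),
    (2671, Small_order 445), (2677, Small_order 669),
    (2683, Arcs 1512 [(2,1,1342), (2,3,1340)] [(4,1,902), (10,1,774), (2,9,1006)]),
    (2687, Arcs 1344 [(2,1,634), (6,1,830), (4,1,1222)] [(2,3,634), (2,7,1092), (8,1,960)]),
    (2689, Small_order 672),
    (2693, Arcs 1346 [(2,1,1194), (2,5,1102), (6,1,396)] [(2,3,1192), (4,1,1104), (2,7,396)]),
    (2699, Arcs 1348 [(2,3,838), (8,1,722), (2,7,1138)] [(2,1,840), (2,9,852), (10,1,1006)]),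
    (2707, Arcs 1436 [(2,1,1354), (2,3,1352)] [(10,1,418), (12,1,936), (2,11,418), (2,13,934)]),
    (2711, Arcs 1356 [(2,1,978), (8,1,846), (2,11,886)] [(2,3,978), (2,9,844), (10,1,888)]),
    (2713, Small_order 226),
    (2719, Arcs 1310 [(4,1,418), (10,1,1204), (8,1,1096)] [(2,1,1360), (2,3,1358)]),
    (2729, Arcs 1362 [(2,3,648), (2,7,892), (2,5,1188)] [(2,1,648), (6,1,892), (4,1,1188)]),
    (2731, Arcs 1404 [(2,1,1366), (2,3,1364)] [(8,1,782), (14,1,584), (2,9,782), (2,15,582)]),
    (2741, Arcs 1370 [(2,1,1190), (6,1,998), (12,1,552)] [(2,3,1190), (2,7,998), (2,13,552)]),
    (2749, Small_order 687),
    (2753, Arcs 1374 [(2,3,1136), (2,5,636), (2,7,980)] [(2,1,1136), (4,1,636), (6,1,980)]),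
    (2767, Arcs 1634 [(4,1,622), (8,1,762), (2,5,622), (2,9,760)] [(2,1,1384), (2,3,1382)]),
    (2777, Arcs 1386 [(2,3,1162), (4,1,608), (10,1,1006)] [(2,1,1164), (2,5,608), (2,11,1004)]),
    (2789, Arcs 1394 [(2,1,982), (2,11,1364), (6,1,442)] [(2,3,980), (10,1,1366), (2,7,442)]),
    (2791, Small_order 279), (2797, Small_order 699),
    (2801, Arcs 1398 [(2,3,802), (2,7,1194), (2,15,804)] [(2,1,802), (6,1,1194), (14,1,804)]),
    (2803, Small_order 467),
    (2819, Arcs 1408 [(2,3,736), (10,1,1010), (4,1,1072)] [(2,1,738), (2,11,1010), (2,5,1070)]),
    (2833, Small_order 354),
    (2837, Arcs 1418 [(2,1,610), (6,1,1178), (4,1,1048)] [(2,3,610), (2,7,1178), (2,5,1048)]),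
    (2843, Small_order 203), (2851, Small_order 19), (2857, Small_order 42),
    (2861, Arcs 1430 [(2,1,524), (6,1,1244), (4,1,1092)] [(2,3,524), (2,7,1244), (2,5,1092)]),
    (2879, Arcs 1440 [(2,1,1288), (2,5,742), (6,1,848)] [(2,3,1286), (4,1,744), (2,7,848)]),
    (2887, Small_order 39),
    (2897, Arcs 1446 [(2,3,1272), (2,7,1066), (4,1,558)] [(2,1,1272), (6,1,1068), (2,5,556)]),
    (2903, Arcs 1452 [(2,1,800), (2,23,1370), (6,1,732)] [(2,3,798), (22,1,1372), (2,7,732)]),
    (2909, Arcs 1454 [(2,1,1276), (6,1,382), (4,1,1250)] [(2,3,1276), (2,7,382), (2,5,1250)]),
    (2917, Small_order 729), (2927, Small_order 209),
    (2939, Arcs 1468 [(2,3,756), (2,11,1198), (2,5,984)] [(2,1,480), (6,1,1466), (8,1,992)]),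
    (2953, Small_order 369),
    (2957, Arcs 1478 [(2,1,1318), (2,9,520), (16,1,1118)] [(2,3,1316), (8,1,334), (14,1,1306)]),
    (2963, Arcs 1480 [(2,3,1460), (2,5,444), (16,1,1058)] [(2,1,1460), (4,1,446), (2,17,1056)]),
    (2969, Arcs 1482 [(2,3,1376), (14,1,1002), (10,1,590)] [(2,1,1378), (2,15,1002), (2,11,588)]),
    (2971, Small_order 495),
    (2999, Arcs 1500 [(2,1,850), (6,1,758), (2,19,1390)] [(2,3,850), (2,7,756), (18,1,1392)]),
    (3001, Small_order 250),
    (3011, Arcs 1504 [(2,3,1406), (2,7,458), (4,1,1146)] [(2,1,1406), (6,1,460), (2,5,1144)]),
    (3019, Small_order 503),
    (3023, Arcs 1512 [(2,1,422), (16,1,1478), (2,15,1122)] [(2,3,978), (20,1,970), (4,1,1074)]),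
    (3037, Small_order 759),
    (3041, Arcs 1518 [(2,3,1040), (2,11,1046), (2,9,954)] [(2,1,1040), (10,1,1046), (8,1,954)]),
    (3049, Small_order 254), (3061, Small_order 765), (3067, Small_order 511)] 3072"
  by code_simp

lemma certs_3072_3584: "certs_ok 3072
   [(3079, Small_order 57),
    (3083, Arcs 1540 [(2,3,1216), (14,1,1130), (2,9,736)] [(2,1,1218), (2,15,1128), (8,1,736)]),
    (3089, Arcs 1542 [(2,3,684), (2,7,1082), (4,1,1322)] [(2,1,684), (6,1,1084), (2,5,1320)]),
    (3109, Small_order 259),
    (3119, Arcs 1560 [(2,1,1008), (4,1,642), (10,1,1468)] [(2,3,1008), (2,5,996), (12,1,1114)]),
    (3121, Small_order 780),
    (3137, Arcs 1566 [(2,3,1562), (2,9,84), (10,1,1490)] [(2,1,1562), (8,1,86), (2,11,1488)]),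
    (3163, Arcs 3120 [(2,1,1582), (2,3,1580)] [(2,11,1422), (14,1,1438), (16,1,302)]),
    (3167, Arcs 1584 [(2,1,310), (6,1,1448), (10,1,1408)] [(2,3,310), (2,7,1448), (2,11,1408)]),
    (3169, Small_order 396), (3181, Small_order 265), (3187, Small_order 59),
    (3191, Small_order 319),
    (3203, Arcs 1600 [(2,3,1428), (16,1,1208), (10,1,566)] [(2,1,1430), (2,17,1208), (2,11,564)]),
    (3209, Arcs 1602 [(2,3,1528), (2,9,1454), (2,7,226)] [(2,1,1528), (8,1,1454), (6,1,226)]),
    (3217, Small_order 268), (3221, Small_order 322), (3229, Small_order 807),
    (3251, Arcs 1624 [(2,3,1492), (2,9,868), (10,1,890)] [(2,1,1492), (8,1,1592), (12,1,166)]),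
    (3253, Small_order 271),
    (3257, Arcs 1626 [(2,3,538), (4,1,1272), (10,1,1446)] [(2,1,540), (2,5,1272), (2,11,1444)]),
    (3259, Arcs 1996 [(2,1,1630), (2,3,1628)] [(8,1,1574), (2,13,194), (14,1,1490)]),
    (3271, Arcs 68 [(2,5,802), (10,1,1338), (8,1,1130)] [(2,1,1636), (2,3,1634)]),
    (3299, Arcs 1648 [(2,3,1204), (12,1,910), (2,17,1184)] [(2,1,1206), (2,13,908), (16,1,1184)]),
    (3301, Small_order 825),
    (3307, Arcs 1950 [(2,1,1654), (2,3,1652)] [(4,1,1480), (18,1,174), (2,5,1480), (2,19,172)]),
    (3313, Small_order 828), (3319, Small_order 553),
    (3323, Arcs 1660 [(2,3,1356), (4,1,1218), (2,7,748)] [(2,1,1358), (2,5,1216), (6,1,748)]),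
    (3329, Arcs 1662 [(2,3,152), (8,1,1616), (2,19,1560)] [(2,1,340), (20,1,1496), (2,11,1492)]),
    (3331, Arcs 880 [(2,1,1666), (2,3,1664)] [(10,1,176), (2,13,1490), (2,11,174), (12,1,1490)]),
    (3343, Small_order 557),
    (3347, Arcs 1672 [(2,3,654), (4,1,1638), (8,1,1054)] [(2,1,874), (10,1,1420), (2,9,1052)]),
    (3359, Arcs 1680 [(2,1,1126), (12,1,1644), (2,5,588)] [(2,3,1126), (2,13,1642), (4,1,590)]),
    (3361, Small_order 840),
    (3371, Arcs 1684 [(2,3,746), (2,7,1020), (2,9,1604)] [(2,1,746), (6,1,1020), (8,1,1604)]),
    (3373, Small_order 281),
    (3389, Arcs 1694 [(2,1,460), (12,1,1432), (10,1,1496)] [(2,3,1576), (16,1,1260), (2,7,552)]),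
    (3391, Arcs 2396 [(4,1,1500), (10,1,196), (2,5,1500), (2,11,194)] [(2,1,1696), (2,3,1694)]),
    (3407, Arcs 1704 [(2,1,658), (4,1,1702), (2,11,1046)] [(2,3,658), (2,5,1700), (10,1,1048)]),
    (3413, Arcs 1706 [(2,1,988), (2,5,1664), (2,9,760)] [(2,3,986), (4,1,1664), (8,1,762)]),
    (3433, Small_order 858),
    (3449, Arcs 1722 [(2,3,1270), (2,7,1440), (2,11,738)] [(2,1,1270), (6,1,1440), (10,1,738)]),
    (3457, Small_order 864),
    (3461, Arcs 1730 [(2,1,1466), (4,1,1184), (6,1,810)] [(2,3,1466), (2,5,1184), (2,7,810)]),
    (3463, Arcs 1874 [(4,1,858), (10,1,1626), (2,9,978)] [(2,1,1732), (2,3,1730)]),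
    (3467, Arcs 1732 [(2,3,1188), (2,9,1560), (2,5,718)] [(2,1,1188), (8,1,1560), (4,1,718)]),
    (3469, Small_order 867),
    (3491, Arcs 1744 [(2,3,1400), (8,1,1366), (2,7,724)] [(2,1,1468), (10,1,1298), (6,1,724)]),
    (3499, Small_order 583), (3511, Small_order 135), (3517, Small_order 293),
    (3527, Arcs 1764 [(2,1,1156), (2,15,1472), (4,1,898)] [(2,3,1154), (14,1,1474), (2,5,898)]),
    (3529, Small_order 147),
    (3533, Arcs 1766 [(2,1,1426), (8,1,572), (4,1,1534)] [(2,3,1426), (2,9,572), (2,5,1534)]),
    (3539, Arcs 1768 [(2,3,1252), (12,1,1676), (2,5,610)] [(2,1,608), (6,1,1272), (10,1,1658)]),
    (3541, Small_order 885),
    (3547, Arcs 290 [(2,1,1774), (2,3,1772)] [(4,1,210), (16,1,1660), (2,19,1676)]),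
    (3557, Arcs 1778 [(2,1,704), (20,1,1292), (2,9,1560)] [(2,3,752), (22,1,1242), (8,1,1562)]),
    (3559, Arcs 2614 [(14,1,1206), (2,17,894), (2,19,1458)] [(2,1,1780), (2,3,1778)]),
    (3571, Arcs 2620 [(2,1,1786), (2,3,1784)] [(2,13,1608), (2,15,1620), (16,1,342)]),
    (3581, Arcs 1790 [(2,1,1588), (2,9,712), (2,15,1280)] [(2,3,1586), (8,1,1372), (16,1,622)]),
    (3583, Arcs 2272 [(4,1,1510), (8,1,814), (10,1,1258)] [(2,1,1792), (2,3,1790)])] 3584"
  by code_simp

lemma certs_3584_4096: "certs_ok 3584
   [(3593, Arcs 1794 [(2,3,956), (26,1,1642), (4,1,994)] [(2,1,1350), (28,1,1652), (18,1,590)]),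
    (3607, Small_order 601), (3613, Small_order 903),
    (3617, Arcs 1806 [(2,3,816), (2,7,1424), (8,1,1376)] [(2,1,816), (6,1,1426), (2,9,1374)]),
    (3623, Arcs 1812 [(2,1,1654), (2,17,1766), (6,1,202)] [(2,3,1652), (16,1,1768), (2,7,202)]),
    (3631, Small_order 605), (3637, Small_order 909),
    (3643, Arcs 2250 [(2,1,1822), (2,3,1820)] [(12,1,1518), (2,17,1542), (2,19,582)]),
    (3659, Arcs 1828 [(2,3,1334), (2,7,1582), (2,9,742)] [(2,1,1334), (6,1,1582), (8,1,742)]),
    (3671, Arcs 1836 [(2,1,648), (10,1,1370), (6,1,1652)] [(2,3,648), (2,11,1370), (2,7,1652)]),
    (3673, Small_order 459),
    (3677, Arcs 1838 [(2,1,1676), (2,9,1502), (2,5,498)] [(2,3,1674), (8,1,1502), (4,1,500)]),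
    (3691, Small_order 369), (3697, Small_order 231),
    (3701, Arcs 1850 [(2,1,1570), (2,27,1552), (2,23,578)] [(2,3,1568), (26,1,1552), (22,1,580)]),
    (3709, Small_order 927),
    (3719, Arcs 1860 [(2,1,1422), (8,1,928), (14,1,1368)] [(2,3,1688), (16,1,1810), (2,7,220)]),
    (3727, Arcs 3466 [(14,1,1228), (20,1,1282), (22,1,1216)] [(2,1,1864), (2,3,1862)]),
    (3733, Small_order 311), (3739, Small_order 623),
    (3761, Arcs 1878 [(2,3,972), (2,5,926), (2,7,1862)] [(2,1,972), (4,1,926), (6,1,1862)]),
    (3767, Arcs 1884 [(2,1,1360), (2,9,926), (4,1,1480)] [(2,3,1358), (8,1,928), (2,5,1480)]),
    (3769, Small_order 471),
    (3779, Arcs 1888 [(2,3,1370), (12,1,1812), (8,1,596)] [(2,1,1372), (2,13,1812), (2,9,594)]),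
    (3793, Small_order 948),
    (3797, Arcs 1898 [(2,1,790), (18,1,1600), (12,1,1406)] [(2,3,790), (2,19,1600), (2,13,1406)]),
    (3803, Arcs 1900 [(2,3,1194), (2,7,1130), (4,1,1478)] [(2,1,1194), (6,1,1132), (2,5,1476)]),
    (3821, Arcs 1910 [(2,1,1670), (10,1,1866), (4,1,284)] [(2,3,522), (8,1,1746), (2,7,1552)]),
    (3823, Arcs 2390 [(10,1,1450), (12,1,462), (2,11,1450), (2,13,460)] [(2,1,1912), (2,3,1910)]),
    (3833, Arcs 1914 [(2,3,124), (2,9,1844), (2,7,1864)] [(2,1,124), (8,1,1844), (6,1,1864)]),
    (3847, Small_order 641), (3851, Small_order 11), (3853, Small_order 321),
    (3863, Arcs 1932 [(2,1,1688), (2,5,312), (6,1,1862)] [(2,3,1686), (4,1,606), (8,1,1570)]),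
    (3877, Small_order 969), (3881, Small_order 388), (3889, Small_order 81),
    (3907, Small_order 651),
    (3911, Arcs 1956 [(2,1,1528), (6,1,936), (10,1,1446)] [(2,3,1528), (2,7,936), (2,11,1446)]),
    (3917, Arcs 1958 [(2,1,1350), (4,1,1796), (2,9,770)] [(2,3,1350), (2,5,1794), (8,1,772)]),
    (3919, Arcs 1930 [(4,1,750), (10,1,1210), (2,5,750), (2,11,1208)] [(2,1,1960), (2,3,1958)]),
    (3923, Arcs 1960 [(2,3,544), (2,9,1490), (2,5,1888)] [(2,1,544), (8,1,1490), (4,1,1888)]),
    (3929, Arcs 1962 [(2,3,1460), (2,11,1686), (2,7,782)] [(2,1,1460), (10,1,1686), (6,1,782)]),
    (3931, Arcs 740 [(2,1,1966), (2,3,1964)] [(2,5,1948), (12,1,40), (16,1,1942)]),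
    (3943, Arcs 2834 [(10,1,1038), (14,1,1046), (2,13,1858)] [(2,1,1972), (2,3,1970)]),
    (3947, Arcs 1972 [(2,3,1722), (2,11,794), (8,1,1430)] [(2,1,1722), (10,1,796), (2,9,1428)]),
    (3967, Small_order 661),
    (3989, Arcs 1994 [(2,1,1066), (2,5,1280), (2,9,1642)] [(2,3,1064), (4,1,1280), (8,1,1644)]),
    (4001, Arcs 1998 [(2,3,1938), (8,1,912), (2,7,1150)] [(2,1,1940), (2,9,910), (6,1,1150)]),
    (4003, Arcs 2536 [(2,1,2002), (2,3,2000)] [(8,1,198), (12,1,1804), (2,9,198), (2,13,1802)]),
    (4007, Arcs 2004 [(2,1,1978), (2,9,1802), (2,13,226)] [(2,3,1976), (8,1,1802), (12,1,228)]),
    (4013, Arcs 2006 [(2,1,1044), (6,1,1382), (4,1,1586)] [(2,3,1044), (2,7,1382), (2,5,1586)]),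
    (4019, Small_order 49), (4021, Small_order 1005),
    (4027, Arcs 3798 [(2,1,2014), (2,3,2012)] [(2,9,320), (10,1,1730), (12,1,1976)]),
    (4049, Arcs 2022 [(2,3,1588), (2,7,1502), (2,9,958)] [(2,1,1588), (6,1,1502), (8,1,958)]),
    (4051, Small_order 405), (4057, Small_order 169),
    (4073, Arcs 2034 [(2,3,1746), (2,17,1984), (20,1,342)] [(2,1,1746), (16,1,1986), (2,21,340)]),
    (4079, Arcs 2040 [(2,1,716), (4,1,2010), (2,11,1352)] [(2,3,716), (2,5,2008), (10,1,1354)]),
    (4091, Arcs 2044 [(2,3,1826), (10,1,1612), (2,7,652)] [(2,1,1828), (2,11,1610), (6,1,652)]),
    (4093, Small_order 341)] 4096"
  by code_simp

lemma small_prime_certificate: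
  assumes "prime p" "11 \<le> p" "p < 4096"
  shows "\<exists>c. cert_ok (int p) c"
proof -
  consider "p < 512" | "512 \<le> p" "p < 1024" | "1024 \<le> p" "p < 1536" | "1536 \<le> p" "p < 2048"
    | "2048 \<le> p" "p < 2560" | "2560 \<le> p" "p < 3072" | "3072 \<le> p" "p < 3584" | "3584 \<le> p"
    by linarith
  thus ?thesis
  proof cases
    case 1 show ?thesis by (rule certs_ok_correct[OF certs_11_512 assms(1)]) (use 1 assms in auto)
  next
    case 2 show ?thesis by (rule certs_ok_correct[OF certs_512_1024 assms(1)]) (use 2 in auto)
  next
    case 3 show ?thesis by (rule certs_ok_correct[OF certs_1024_1536 assms(1)]) (use 3 in auto)
  next
    case 4 show ?thesis by (rule certs_ok_correct[OF certs_1536_2048 assms(1)]) (use 4 in auto)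
  next
    case 5 show ?thesis by (rule certs_ok_correct[OF certs_2048_2560 assms(1)]) (use 5 in auto)
  next
    case 6 show ?thesis by (rule certs_ok_correct[OF certs_2560_3072 assms(1)]) (use 6 in auto)
  next
    case 7 show ?thesis by (rule certs_ok_correct[OF certs_3072_3584 assms(1)]) (use 7 in auto)
  next
    case 8 show ?thesis by (rule certs_ok_correct[OF certs_3584_4096 assms(1)]) (use 8 assms in auto)
  qed
qed

section \<open>Large primes\<close>

text \<open>As \<open>u\<close> is invertible, the second coefficient is free and determines the
  first.\<close>

lemma card_lines_through_point:
  fixes p :: nat and u v \<gamma> :: int
  assumes p: "prime p" and u: "\<not> int p dvd u"
  shows "card {l \<in> {0..<int p} \<times> {0..<int p}. [fst l * u + snd l * v = \<gamma>] (mod int p)} = p"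
    (is "card ?S = p")
proof -
  have p0: "int p > 0" using p prime_gt_0_nat by simp
  have "coprime u (int p)" using p u by (metis coprime_commute prime_imp_coprime prime_nat_int_transfer)
  then obtain u' where u': "[u * u' = 1] (mod int p)" using cong_solve_coprime_int by blast
  let ?f = "\<lambda>\<beta>. ((\<gamma> - \<beta> * v) * u' mod int p, \<beta>)"
  have "?S = ?f ` {0..<int p}"
  proof (intro equalityI subsetI)
    fix x assume "x \<in> ?S"
    then obtain \<alpha> \<beta> where x: "x = (\<alpha>, \<beta>)" "\<alpha> \<in> {0..<int p}" "\<beta> \<in> {0..<int p}"
      "[\<alpha> * u + \<beta> * v = \<gamma>] (mod int p)" by auto
    have "[\<alpha> * u + \<beta> * v - \<beta> * v = \<gamma> - \<beta> * v] (mod int p)" using x(4) by (intro cong_diff) auto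
    hence "[\<alpha> * u * u' = (\<gamma> - \<beta> * v) * u'] (mod int p)" by (intro cong_scalar_right) simp
    moreover have "[\<alpha> * (u * u') = \<alpha> * 1] (mod int p)" using u' by (rule cong_scalar_left)
    ultimately have "[\<alpha> = (\<gamma> - \<beta> * v) * u'] (mod int p)"
      by (metis cong_sym cong_trans mult.assoc mult_1_right)
    hence "\<alpha> = (\<gamma> - \<beta> * v) * u' mod int p" using x(2) by (simp add: cong_def)
    thus "x \<in> ?f ` {0..<int p}" using x by auto
  next
    fix x assume "x \<in> ?f ` {0..<int p}"
    then obtain \<beta> where x: "x = ?f \<beta>" "\<beta> \<in> {0..<int p}" by auto
    have "[(\<gamma> - \<beta> * v) * u' mod int p * u = (\<gamma> - \<beta> * v) * u' * u] (mod int p)"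
      by (intro cong_scalar_right) simp
    moreover have "[(\<gamma> - \<beta> * v) * (u * u') = (\<gamma> - \<beta> * v) * 1] (mod int p)"
      using u' by (rule cong_scalar_left)
    ultimately have "[(\<gamma> - \<beta> * v) * u' mod int p * u = \<gamma> - \<beta> * v] (mod int p)"
      by (metis cong_trans mult.assoc mult.commute mult_1_right)
    hence "[(\<gamma> - \<beta> * v) * u' mod int p * u + \<beta> * v = \<gamma> - \<beta> * v + \<beta> * v] (mod int p)"
      by (intro cong_add) auto
    thus "x \<in> ?S" using x p0 by simp
  qed
  moreover have "inj_on ?f {0..<int p}" by (auto simp: inj_on_def)
  ultimately show ?thesis by (simp add: card_image)
qed

text \<open>The difference of two common lines solves a homogeneous system, so it vanishes unless
  the determinant of the two points does. But proportional points on a common line coincide, because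
  \<open>\<gamma>\<close> is nonzero.\<close>

lemma card_lines_through_two_points:
  fixes p :: nat and u v u' v' \<gamma> :: int
  assumes p: "prime p" and \<gamma>: "\<not> int p dvd \<gamma>"
    and u: "u \<in> {0..<int p}" "u' \<in> {0..<int p}" "\<not> int p dvd u" "\<not> int p dvd u'"
    and v: "v \<in> {0..<int p}" "v' \<in> {0..<int p}" and ne: "(u, v) \<noteq> (u', v')"
  shows "card {l \<in> {0..<int p} \<times> {0..<int p}.
           [fst l * u + snd l * v = \<gamma>] (mod int p) \<and> [fst l * u' + snd l * v' = \<gamma>] (mod int p)} \<le> 1"
    (is "card ?S \<le> 1")
proof -
  have P: "prime (int p)" using p by simp
  have "x = y" if "x \<in> ?S" "y \<in> ?S" for x y
  proof -
    obtain a b c d where xy: "x = (a, b)" "y = (c, d)" by force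
    with that have r: "a \<in> {0..<int p}" "b \<in> {0..<int p}" "c \<in> {0..<int p}" "d \<in> {0..<int p}"
      and D: "int p dvd a * u + b * v - \<gamma>" "int p dvd a * u' + b * v' - \<gamma>"
        "int p dvd c * u + d * v - \<gamma>" "int p dvd c * u' + d * v' - \<gamma>"
      by (auto simp: cong_iff_dvd_diff)
    have 1: "int p dvd (a - c) * u + (b - d) * v" "int p dvd (a - c) * u' + (b - d) * v'"
      using dvd_diff[OF D(1) D(3)] dvd_diff[OF D(2) D(4)] by (simp_all add: algebra_simps)
    have "int p dvd u' * ((a - c) * u + (b - d) * v) - u * ((a - c) * u' + (b - d) * v')"
      by (rule dvd_diff[OF dvd_mult[OF 1(1)] dvd_mult[OF 1(2)]])
    also have "\<dots> = (b - d) * (u' * v - u * v')" by (simp add: algebra_simps)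
    finally have "int p dvd b - d \<or> int p dvd u' * v - u * v'"
      using P by (simp add: prime_dvd_mult_iff)
    moreover have "\<not> int p dvd u' * v - u * v'"
    proof
      assume *: "int p dvd u' * v - u * v'"
      have "int p dvd u' * (a * u + b * v - \<gamma>) - u * (a * u' + b * v' - \<gamma>) - b * (u' * v - u * v')"
        by (rule dvd_diff[OF dvd_diff[OF dvd_mult[OF D(1)] dvd_mult[OF D(2)]] dvd_mult[OF *]])
      also have "\<dots> = (u - u') * \<gamma>" by (simp add: algebra_simps)
      finally have "int p dvd u - u'" using P \<gamma> by (simp add: prime_dvd_mult_iff)
      hence uu: "u = u'" using u(1,2) by (metis cong_iff_dvd_diff cong_less_imp_eq_int atLeastLessThan_iff)
      hence "int p dvd u * (v - v')" using * by (simp add: algebra_simps)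
      hence "int p dvd v - v'" using P u by (simp add: prime_dvd_mult_iff)
      hence "v = v'" using v by (metis cong_iff_dvd_diff cong_less_imp_eq_int atLeastLessThan_iff)
      thus False using uu ne by simp
    qed
    ultimately have bd: "int p dvd b - d" by blast
    hence "b = d" using r by (metis cong_iff_dvd_diff cong_less_imp_eq_int atLeastLessThan_iff)
    hence "int p dvd (a - c) * u" using 1 by simp
    hence "int p dvd a - c" using P u by (simp add: prime_dvd_mult_iff)
    hence "a = c" using r by (metis cong_iff_dvd_diff cong_less_imp_eq_int atLeastLessThan_iff)
    thus ?thesis using \<open>b = d\<close> xy by simp
  qed
  moreover have "finite ?S" by (rule finite_subset[of _ "{0..<int p} \<times> {0..<int p}"]) auto
  ultimately show ?thesis by (metis (no_types, lifting) One_nat_def card_le_Suc0_iff_eq)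
qed

text \<open>The bound is the variance, over all lines \<open>\<alpha>u + \<beta>v = \<gamma>\<close>, of the number of incident points.\<close>

lemma incidence_exists:
  fixes p :: nat and \<gamma> :: int and P L :: "(int \<times> int) set"
  assumes p: "prime p" and \<gamma>: "\<not> int p dvd \<gamma>"
    and P: "P \<subseteq> {0..<int p} \<times> {0..<int p}" "\<And>u v. (u, v) \<in> P \<Longrightarrow> \<not> int p dvd u"
    and L: "L \<subseteq> {0..<int p} \<times> {0..<int p}"
    and card: "p ^ 3 < card L * card P"
  shows "\<exists>\<alpha> \<beta> u v. (\<alpha>, \<beta>) \<in> L \<and> (u, v) \<in> P \<and> [\<alpha> * u + \<beta> * v = \<gamma>] (mod int p)"
proof (rule ccontr)
  assume none: "\<not> ?thesis"
  define F where "F = {0..<int p} \<times> {0..<int p}"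
  define I :: "int \<times> int \<Rightarrow> int \<times> int \<Rightarrow> bool" where
    "I l x \<longleftrightarrow> [fst l * fst x + snd l * snd x = \<gamma>] (mod int p)" for l x
  define N :: "int \<times> int \<Rightarrow> int" where "N l = (\<Sum>x\<in>P. of_bool (I l x))" for l
  have finF: "finite F" and cardF: "card F = p ^ 2" by (auto simp: F_def power2_eq_square)
  have finP: "finite P" using P(1) finF finite_subset F_def by blast
  have count: "(\<Sum>l\<in>F. of_bool (Q l)) = int (card {l \<in> F. Q l})" for Q
    using finF by (simp add: of_bool_def sum.If_cases Int_def)
  have "(\<Sum>l\<in>F. N l) = (\<Sum>x\<in>P. \<Sum>l\<in>F. of_bool (I l x))"
    unfolding N_def by (rule sum.swap)
  also have "\<dots> = (\<Sum>x\<in>P. int p)"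
  proof (rule sum.cong)
    fix x assume "x \<in> P"
    moreover obtain u v where "x = (u, v)" by force
    ultimately show "(\<Sum>l\<in>F. of_bool (I l x)) = int p"
      using card_lines_through_point[OF p, of u v \<gamma>] P(2)[of u v]
      by (simp only: count) (simp add: F_def I_def)
  qed simp
  finally have sumN: "(\<Sum>l\<in>F. N l) = int p * int (card P)" by simp
  have "(\<Sum>l\<in>F. (N l)\<^sup>2) = (\<Sum>l\<in>F. \<Sum>x\<in>P. \<Sum>y\<in>P. of_bool (I l x \<and> I l y))"
    unfolding N_def power2_eq_square sum_product by (simp add: of_bool_conj)
  also have "\<dots> = (\<Sum>x\<in>P. \<Sum>l\<in>F. \<Sum>y\<in>P. of_bool (I l x \<and> I l y))"
    by (rule sum.swap)
  also have "\<dots> = (\<Sum>x\<in>P. \<Sum>y\<in>P. \<Sum>l\<in>F. of_bool (I l x \<and> I l y))"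
    by (intro sum.cong sum.swap refl)
  \<comment> \<open>Distinct points share at most one line, and a point lies on p lines. The
    diagonal bound 1 + p is one too large but makes the double sum split.\<close>
  also have "\<dots> \<le> (\<Sum>x\<in>P. \<Sum>y\<in>P. 1 + (if x = y then int p else 0))"
  proof (intro sum_mono)
    fix x y assume xy: "x \<in> P" "y \<in> P"
    obtain u v u' v' where uv: "x = (u, v)" "y = (u', v')" by force
    show "(\<Sum>l\<in>F. of_bool (I l x \<and> I l y)) \<le> 1 + (if x = y then int p else 0)"
    proof (cases "x = y")
      case True
      thus ?thesis using card_lines_through_point[OF p, of u v \<gamma>] P(2)[of u v] xy uv
        by (simp only: count) (simp add: F_def I_def)
    next
      case False
      have "u \<in> {0..<int p}" "u' \<in> {0..<int p}" "\<not> int p dvd u" "\<not> int p dvd u'"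
        "v \<in> {0..<int p}" "v' \<in> {0..<int p}" "(u, v) \<noteq> (u', v')"
        using False xy uv P by auto
      from card_lines_through_two_points[OF p \<gamma> this] show ?thesis using False uv
        by (simp only: count) (simp add: F_def I_def)
    qed
  qed
  also have "\<dots> = int (card P) ^ 2 + int p * int (card P)"
    using finP by (simp add: sum.distrib power2_eq_square algebra_simps)
  finally have sumN2: "(\<Sum>l\<in>F. (N l)\<^sup>2) \<le> int (card P) ^ 2 + int p * int (card P)" .
  \<comment> \<open>Over \<open>F\<close> the count \<open>N\<close> has mean card P / p; scaling by
    p avoids fractions. A line without incidences deviates from the scaled mean by all of
    \<open>card P\<close>.\<close>
  have "int (card L) * int (card P) ^ 2 = (\<Sum>l\<in>L. (int p * N l - int (card P)) ^ 2)"
  proof -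
    have "N l = 0" if "l \<in> L" for l
    proof -
      have "\<not> I l x" if "x \<in> P" for x
        using none \<open>l \<in> L\<close> that unfolding I_def by (metis prod.collapse)
      thus ?thesis by (simp add: N_def)
    qed
    thus ?thesis by simp
  qed
  also have "\<dots> \<le> (\<Sum>l\<in>F. (int p * N l - int (card P)) ^ 2)"
    using L finF by (intro sum_mono2) (auto simp: F_def)
  also have "\<dots> = (\<Sum>l\<in>F. int p ^ 2 * (N l)\<^sup>2 - 2 * int p * int (card P) * N l + int (card P) ^ 2)"
    by (simp add: power2_eq_square algebra_simps)
  also have "\<dots> = int p ^ 2 * (\<Sum>l\<in>F. (N l)\<^sup>2) - 2 * int p * int (card P) * (\<Sum>l\<in>F. N l)
                 + int p ^ 2 * int (card P) ^ 2"
    by (simp add: sum.distrib sum_subtractf sum_distrib_left cardF)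
  also have "\<dots> \<le> int p ^ 2 * (int (card P) ^ 2 + int p * int (card P))
                 - 2 * int p * int (card P) * (int p * int (card P)) + int p ^ 2 * int (card P) ^ 2"
    using mult_left_mono[OF sumN2, of "int p ^ 2"] by (simp add: sumN)
  also have "\<dots> = int p ^ 3 * int (card P)"
    by (simp add: algebra_simps power2_eq_square power3_eq_cube)
  finally have "int (card P) * (int (card L) * int (card P)) \<le> int (card P) * int p ^ 3"
    by (simp add: power2_eq_square algebra_simps)
  moreover have "int (card P) > 0"
    using card by (cases "card P") auto
  ultimately have "int (card L) * int (card P) \<le> int p ^ 3" by simp
  hence "card L * card P \<le> p ^ 3" by (metis of_nat_le_iff of_nat_mult of_nat_power)
  thus False using card by simp
qed

lemma covered_large_prime:
  fixes p :: nat and v :: int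
  assumes p: "prime p" "4096 < p" and ord: "ord p 9 = (p - 1) div 2" and v: "\<not> int p dvd v"
  shows "covered (int p) ((p + 1) div 2) v"
proof -
  \<comment> \<open>Even exponents up to 2w and odd ones up to 2w - 1 fit below (p + 1)/2. With k +
    m = w + 1, choosing \<open>a\<close>, \<open>b\<close> below k and \<open>c\<close>,
    \<open>d\<close> below m gives a + 1 + c at most w and b + d at most w - 1. Nearly equal k and m
    make the product km large.\<close>
  define w where "w = (p + 1) div 4"
  define k where "k = (w + 1) div 2"
  define m where "m = w + 1 - k"
  have kw: "k \<le> w" "k + m = w + 1" "m \<le> k + 1" "k \<le> m" using p by (auto simp: k_def m_def w_def)
  have wp: "p \<le> 4 * w + 2" "4 * w \<le> p + 1" by (auto simp: w_def)
  have P: "prime (int p)" using p by simp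
  have n3: "\<not> int p dvd 3" using p by (auto dest: zdvd_imp_le)
  have n9: "\<not> int p dvd 9 ^ t" for t
  proof
    assume "int p dvd 9 ^ t"
    hence "int p dvd 3 * 3" using P by (simp add: prime_dvd_power)
    thus False using n3 P prime_dvd_mult_iff by blast
  qed
  have inj: "a = b" if "c * 9 ^ a mod int p = c * 9 ^ b mod int p" "a \<le> w" "b \<le> w" "\<not> int p dvd c" for a b c
  proof -
    have "coprime c (int p)" using P that by (metis coprime_commute prime_imp_coprime)
    moreover have "[c * 9 ^ a = c * 9 ^ b] (mod int p)" using that by (simp add: cong_def)
    ultimately have "[(9::int) ^ a = 9 ^ b] (mod int p)" by (simp add: cong_mult_lcancel)
    hence "[a = b] (mod ord p 9)" using pow9_cong_iff[of p] p by simp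
    moreover have "w < ord p 9" using ord p by (simp add: w_def)
    ultimately show ?thesis using that by (simp add: cong_less_modulus_unique_nat)
  qed
  define f where "f = (\<lambda>(a, b). ((9::int) ^ a mod int p, (9::int) ^ b mod int p))"
  define g where "g = (\<lambda>(a, b). ((9::int) ^ Suc a mod int p, -3 * (9::int) ^ b mod int p))"
  define Pt where "Pt = f ` ({..<m} \<times> {..<m})"
  define L where "L = g ` ({..<k} \<times> {..<k})"
  have "inj_on f ({..<m} \<times> {..<m})"
    using inj[of 1] kw n9[of 0] by (auto simp: inj_on_def f_def)
  hence cP: "card Pt = m * m" by (simp add: Pt_def card_image)
  have "inj_on g ({..<k} \<times> {..<k})"
  proof (rule inj_onI, clarify)
    fix a b c d assume *: "a < k" "b < k" "c < k" "d < k" "g (a, b) = g (c, d)"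
    have "Suc a = Suc c" using * kw n9[of 0] inj[of 1 "Suc a" "Suc c"] by (simp add: g_def)
    moreover have "b = d" using * kw n3 inj[of "-3" b d] by (simp add: g_def)
    ultimately show "a = c \<and> b = d" by simp
  qed
  hence cL: "card L = k * k" by (simp add: L_def card_image)
  have "p ^ 3 < card L * card Pt"
  proof -
    \<comment> \<open>From k + m = w + 1 one gets 64 km at least p^2, hence (km)^2 is at least p^4 /
      4096, which exceeds p^3 for p > 4096.\<close>
    define M where "M = int k * int m"
    have "int k + int m = int w + 1" using kw by linarith
    have "4 * M = (int k + int m) ^ 2 - (int m - int k) ^ 2"
      by (simp add: M_def power2_eq_square algebra_simps)
    moreover have "(int m - int k) ^ 2 \<le> 1 ^ 2" using kw by (intro power_mono) auto
    ultimately have "4 * M \<ge> (int w + 1) ^ 2 - 1" using \<open>int k + int m = int w + 1\<close> by simp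
    hence "64 * M \<ge> (4 * int w + 4) ^ 2 - 16" by (simp add: power2_eq_square algebra_simps)
    moreover have "(4 * int w + 4) ^ 2 \<ge> (int p + 2) ^ 2" using wp by (intro power_mono) auto
    ultimately have "64 * M \<ge> (int p + 2) ^ 2 - 16" by linarith
    hence M: "64 * M \<ge> int p ^ 2" using p by (simp add: power2_eq_square algebra_simps)
    hence "(int p ^ 2) ^ 2 \<le> (64 * M) ^ 2" by (intro power_mono) auto
    hence "int p * int p ^ 3 \<le> 4096 * M ^ 2" by (simp add: power_mult_distrib power2_eq_square power3_eq_cube mult.assoc)
    moreover have "4096 * int p ^ 3 < int p * int p ^ 3"
      using p by (intro mult_strict_right_mono) auto
    ultimately have "int p ^ 3 < M ^ 2" by linarith
    also have "M ^ 2 = int (card L * card Pt)" by (simp add: M_def cP cL power2_eq_square)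
    finally show ?thesis by (metis of_nat_less_iff of_nat_power)
  qed
  moreover have "\<not> int p dvd a" if "(a, b) \<in> Pt" for a b
    using that n9 by (auto simp: Pt_def f_def dvd_mod_iff)
  moreover have "Pt \<subseteq> {0..<int p} \<times> {0..<int p}" "L \<subseteq> {0..<int p} \<times> {0..<int p}"
    using p by (auto simp: Pt_def L_def f_def g_def)
  ultimately obtain \<alpha> \<beta> u z where I: "(\<alpha>, \<beta>) \<in> L" "(u, z) \<in> Pt" "[\<alpha> * u + \<beta> * z = v] (mod int p)"
    using incidence_exists[OF p(1) v, of Pt L] by blast
  obtain a b c d where abcd: "a < k" "b < k" "c < m" "d < m"
    "\<alpha> = 9 ^ Suc a mod int p" "\<beta> = -3 * 9 ^ b mod int p" "u = 9 ^ c mod int p" "z = 9 ^ d mod int p"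
    using I by (auto simp: L_def Pt_def f_def g_def)
  have "[\<alpha> * u + \<beta> * z = 9 ^ Suc a * 9 ^ c + (-3 * 9 ^ b) * 9 ^ d] (mod int p)"
    unfolding abcd by (intro cong_add cong_mult) auto
  also have "9 ^ Suc a * 9 ^ c + (-3 * 9 ^ b) * 9 ^ d = (3 ^ (2 * (Suc a + c)) - 3 ^ (2 * (b + d) + 1) :: int)"
    by (simp add: power_add power_mult)
  finally have "[3 ^ (2 * (Suc a + c)) - 3 ^ (2 * (b + d) + 1) = v] (mod int p)"
    using I(3) cong_sym cong_trans by blast
  moreover have "2 * w \<le> (p + 1) div 2" by (auto simp: w_def)
  hence "2 * (Suc a + c) \<in> {1..(p + 1) div 2}" "2 * (b + d) + 1 \<in> {1..(p + 1) div 2}"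
    using abcd kw by auto
  ultimately show ?thesis unfolding covered_def
    by (intro exI[of _ "2 * (Suc a + c)"] exI[of _ "2 * (b + d) + 1"]) auto
qed

section \<open>Powers of 2 near the modulus, and all primes from 11 on\<close>

lemma two_power_interval:
  fixes d :: nat
  assumes "1 < d"
  shows "\<exists>e. 2 ^ e < d \<and> d \<le> 2 ^ Suc e"
proof -
  define e where "e = (LEAST e. d \<le> 2 ^ Suc e)"
  have "d \<le> 2 ^ Suc d" using less_exp[of "Suc d"] by linarith
  hence e: "d \<le> 2 ^ Suc e" unfolding e_def by (rule LeastI)
  have "2 ^ e < d"
  proof (cases e)
    case (Suc f)
    have "\<not> d \<le> 2 ^ Suc f" using not_less_Least[of f "\<lambda>e. d \<le> 2 ^ Suc e"] Suc e_def by auto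
    thus ?thesis using Suc by simp
  qed (use assms in simp)
  with e show ?thesis by blast
qed

lemma less_double_of_two_powers:
  fixes d n :: nat
  assumes "1 < d" "\<And>e. 2 ^ e < d \<Longrightarrow> 2 ^ e < n"
  shows "d < 2 * n"
  using two_power_interval[OF assms(1)] assms(2) by fastforce

lemma covered_prime:
  fixes p n :: nat and v :: int
  assumes p: "prime p" "11 \<le> p" and ord: "ord p 9 = (p - 1) div 2" and v: "\<not> int p dvd v"
    and n: "\<And>e. 2 ^ e < p \<Longrightarrow> 2 ^ e < n"
  shows "covered (int p) n v"
proof -
  have "p < 2 * n" using p n by (intro less_double_of_two_powers) auto
  hence half: "(p + 1) div 2 \<le> n" by simp
  have "odd p" using p prime_odd_nat[of p] by simp
  hence n4096: "p \<noteq> 4096" "p \<noteq> 16" by auto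
  show ?thesis
  proof (cases "p < 4096")
    case True
    then obtain c where "cert_ok (int p) c" using small_prime_certificate p by blast
    from cert_ok_correct[OF p True this ord v] show ?thesis
    proof (rule covered_mono)
      have "8 < n" using n[of 3] p by simp
      moreover have "p > 16 \<Longrightarrow> 16 < n" using n[of 4] by simp
      ultimately show "nat (range_bound (int p)) \<le> n"
        using half n4096 by (auto simp: range_bound_def nat_le_iff)
    qed
  next
    case False
    thus ?thesis using covered_large_prime[OF p(1) _ ord v] half covered_mono n4096 by force
  qed
qed

section \<open>Congruences between terms and periods\<close>

definition separates :: "nat \<Rightarrow> nat \<Rightarrow> nat \<Rightarrow> bool" where
  "separates q n m \<longleftrightarrow> pairwise (\<lambda>i j. \<not> [u_seq q i = u_seq q j] (mod int m)) {1..n}"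

lemma separatesD:
  "separates q n m \<Longrightarrow> i \<in> {1..n} \<Longrightarrow> j \<in> {1..n} \<Longrightarrow> [u_seq q i = u_seq q j] (mod int m) \<Longrightarrow> i = j"
  unfolding separates_def pairwise_def by blast

lemma separatesI:
  assumes "\<And>i j. i \<in> {1..n} \<Longrightarrow> j \<in> {1..n} \<Longrightarrow> i < j \<Longrightarrow> \<not> [u_seq q i = u_seq q j] (mod int m)"
  shows "separates q n m"
  unfolding separates_def pairwise_def
  using assms by (metis cong_sym linorder_neqE_nat)

lemma u_seq_cong_iff:
  assumes "odd q"
  shows "[u_seq q i = u_seq q j] (mod int m) \<longleftrightarrow>
           4 * int m dvd (3 ^ i - qstar q * (-1) ^ i) - (3 ^ j - qstar q * (-1) ^ j)"
proof -
  have *: "3 ^ k - qstar q * (-1) ^ k = 4 * u_seq q k" for k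
    using u_seq_exact[OF assms, of k] by (simp add: u_seq_def)
  show ?thesis unfolding * right_diff_distrib[symmetric] cong_iff_dvd_diff
    by (subst dvd_times_left_cancel_iff) simp_all
qed

lemma u_seq_cong_same_parity:
  assumes "odd q" "even i \<longleftrightarrow> even j"
  shows "[u_seq q i = u_seq q j] (mod int m) \<longleftrightarrow> 4 * int m dvd 3 ^ i - 3 ^ j"
proof -
  have "(-1 :: int) ^ i = (-1) ^ j" using assms(2) by (cases "even i") auto
  thus ?thesis using u_seq_cong_iff[OF assms(1)] by simp
qed

lemma u_seq_cong_opposite_parity:
  assumes "odd q" "even i" "odd j"
  shows "[u_seq q i = u_seq q j] (mod int m) \<longleftrightarrow> 4 * int m dvd 3 ^ i - 3 ^ j - 2 * qstar q"
proof -
  have "(3 ^ i - qstar q * (-1) ^ i) - (3 ^ j - qstar q * (-1) ^ j) = 3 ^ i - 3 ^ j - 2 * qstar q"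
    using assms by simp
  thus ?thesis using u_seq_cong_iff[OF assms(1)] by metis
qed

text \<open>For odd \<open>m\<close> the factor 4 from the denominator of \<open>u_seq\<close> is
  harmless: it is coprime to \<open>m\<close> and divides the difference anyway. The equivalence is
  a hypothesis so that both parity cases can be plugged in.\<close>

lemma odd_dvd_four_mult:
  fixes m :: nat and x y :: int
  assumes "odd m" "odd q" "[u_seq q i = u_seq q j] (mod int m) \<longleftrightarrow> 4 * int m dvd x" "4 dvd x"
  shows "[u_seq q i = u_seq q j] (mod int m) \<longleftrightarrow> int m dvd x"
proof -
  have "coprime (int m) (2 ^ 2)" using assms(1) by (subst coprime_power_right_iff) auto
  hence "coprime 4 (int m)" by (simp add: coprime_commute)
  thus ?thesis using assms(3,4) divides_mult[of 4 x "int m"] by (metis dvd_mult_right)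
qed

lemma u_seq_cong_odd_same_parity:
  assumes "odd q" "odd m" "even i \<longleftrightarrow> even j"
  shows "[u_seq q i = u_seq q j] (mod int m) \<longleftrightarrow> [3 ^ i = (3::int) ^ j] (mod int m)"
proof -
  \<comment> \<open>Instance \<open>m = 1\<close> of the criterion: any two terms agree modulo
    1.\<close>
  have "4 dvd (3::int) ^ i - 3 ^ j"
    using u_seq_exact[OF assms(1), of i] u_seq_exact[OF assms(1), of j]
      u_seq_cong_same_parity[OF assms(1,3), of 1] by simp
  thus ?thesis
    using odd_dvd_four_mult[OF assms(2,1) u_seq_cong_same_parity[OF assms(1,3)]]
    by (simp add: cong_iff_dvd_diff)
qed

lemma u_seq_cong_odd_opposite_parity:
  assumes "odd q" "odd m" "even i" "odd j"
  shows "[u_seq q i = u_seq q j] (mod int m) \<longleftrightarrow> [3 ^ i - 3 ^ j = 2 * qstar q] (mod int m)"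
proof -
  have "4 dvd (3::int) ^ i - 3 ^ j - 2 * qstar q"
    using u_seq_cong_opposite_parity[OF assms(1,3,4), of 1] by simp
  thus ?thesis
    using odd_dvd_four_mult[OF assms(2,1) u_seq_cong_opposite_parity[OF assms(1,3,4)]]
    by (simp add: cong_iff_dvd_diff)
qed

lemma separates_not_covered:
  assumes "separates q n m" "odd q" "odd m"
  shows "\<not> covered (int m) n (2 * qstar q)"
proof
  assume "covered (int m) n (2 * qstar q)"
  then obtain i j where ij: "even i" "odd j" "i \<in> {1..n}" "j \<in> {1..n}"
    "[3 ^ i - 3 ^ j = 2 * qstar q] (mod int m)"
    unfolding covered_def by blast
  hence "i = j" using assms u_seq_cong_odd_opposite_parity separatesD by metis
  thus False using ij by simp
qed

text \<open>Then 2k is a period of the sequence modulo \<open>m\<close>, not necessarily the least: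
  the even shift preserves the sign (-1)^j, and the factor 4 accounts for the denominator.\<close>

definition half_period :: "nat \<Rightarrow> nat \<Rightarrow> bool" where
  "half_period m k \<longleftrightarrow> 0 < k \<and> 4 * int m dvd 9 ^ k - 1"

text \<open>A factor \<open>3 ^ a\<close> of the modulus only delays the period, since
  \<open>3 ^ i\<close> absorbs it from index \<open>a\<close> on. Hence the terms at
  \<open>i\<close> and \<open>i + 2 * k\<close> collide.\<close>

lemma separates_le_period:
  assumes "separates q n (3 ^ a * m)" "odd q" "half_period m k" "1 \<le> i" "a \<le> i"
  shows "n < i + 2 * k"
proof (rule ccontr)
  assume *: "\<not> n < i + 2 * k"
  have "int (3 ^ a) * (4 * int m) dvd 3 ^ i * (9 ^ k - 1)"
    using assms by (intro mult_dvd_mono) (auto simp: half_period_def le_imp_power_dvd)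
  also have "(3::int) ^ i * (9 ^ k - 1) = 3 ^ (i + 2 * k) - 3 ^ i"
    by (simp add: power_add power_mult right_diff_distrib)
  also have "int (3 ^ a) * (4 * int m) = 4 * int (3 ^ a * m)" by simp
  finally have "[u_seq q (i + 2 * k) = u_seq q i] (mod int (3 ^ a * m))"
    using u_seq_cong_same_parity[OF assms(2), of "i + 2 * k" i "3 ^ a * m"] by simp
  hence "i + 2 * k = i"
    using assms * by (intro separatesD[OF assms(1)]) auto
  thus False using assms by (simp add: half_period_def)
qed

text \<open>The product is a common multiple of both exponents. As \<open>x\<close> is odd, the
  factor 4 can be left entirely to \<open>y\<close>.\<close>

lemma half_period_mult:
  assumes "half_period x a" "half_period y b" "coprime x y" "odd x"
  shows "half_period (x * y) (a * b)"
proof -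
  have dvd: "(9::int) ^ c - 1 dvd 9 ^ (c * d) - 1" for c d
    by (simp add: power_mult) (metis dvd_triv_left power_diff_1_eq)
  have "4 * int y dvd 9 ^ (a * b) - 1" "4 * int x dvd 9 ^ (a * b) - 1"
    using assms dvd[of a b] dvd[of b a] unfolding half_period_def
    by (metis dvd_trans mult.commute)+
  moreover have "coprime (int x) (4 * int y)"
  proof -
    have "coprime (int x) (2 ^ 2)" using assms(4) by (subst coprime_power_right_iff) auto
    thus ?thesis using assms(3) by simp
  qed
  ultimately have "int x * (4 * int y) dvd 9 ^ (a * b) - 1"
    by (intro divides_mult[of "int x"]) (auto dest: dvd_mult_right)
  thus ?thesis using assms by (simp add: half_period_def mult_ac)
qed

lemma half_period_odd:
  assumes "odd x" "[(9::nat) ^ k = 1] (mod x)" "0 < k"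
  shows "half_period x k"
proof -
  have "[(9::int) ^ k = 1] (mod int x)"
    using assms(2) by (metis cong_int_iff of_nat_1 of_nat_numeral of_nat_power)
  hence "int x dvd 9 ^ k - 1" by (simp add: cong_iff_dvd_diff)
  moreover have "[(9::int) ^ k = 1 ^ k] (mod 4)" by (rule cong_pow) (simp add: cong_def)
  hence "4 dvd (9::int) ^ k - 1" by (simp add: cong_iff_dvd_diff)
  moreover have "coprime 4 (int x)"
  proof -
    have "coprime (int x) (2 ^ 2)" using assms(1) by (subst coprime_power_right_iff) auto
    thus ?thesis by (simp add: coprime_commute)
  qed
  ultimately show ?thesis using assms(3) by (simp add: half_period_def divides_mult)
qed

text \<open>Euler's theorem for 3: the totient is even above 2, so half of it serves as exponent of
  9.\<close>

lemma half_period_odd_le: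
  assumes "odd x" "\<not> 3 dvd x" "1 < x"
  shows "\<exists>k. half_period x k \<and> 2 * k < x"
proof -
  have "2 < x" using assms by (cases "x = 2") auto
  then obtain k where k: "totient x = 2 * k" using totient_even by blast
  have "coprime 3 x" using assms(2) prime_imp_coprime[OF prime_3] by blast
  hence "[3 ^ totient x = 1] (mod x)" by (rule euler_theorem)
  hence "[9 ^ k = 1] (mod x)" by (simp add: k power_mult)
  moreover have "0 < k" using k assms(3) totient_gt_0_iff[of x] by linarith
  moreover have "2 * k < x" using totient_less[of x] assms(3) k by simp
  ultimately show ?thesis using half_period_odd assms(1) by blast
qed

lemma half_period_two_power: "half_period (2 ^ Suc b) (2 ^ b)"
proof -
  have "ord (2 ^ (b + 3)) (3::nat) = 2 ^ (b + 1)" using ord_twopow_3_5[of "b + 3" 3] by simp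
  hence "[(3::nat) ^ (2 ^ (b + 1)) = 1] (mod 2 ^ (b + 3))" by (simp add: ord_divides')
  hence "[(9::nat) ^ (2 ^ b) = 1] (mod 2 ^ (b + 3))" by (simp add: power_mult)
  hence "[(9::int) ^ (2 ^ b) = 1] (mod 2 ^ (b + 3))"
    by (metis cong_int_iff of_nat_1 of_nat_numeral of_nat_power)
  hence "2 ^ (b + 3) dvd (9::int) ^ (2 ^ b) - 1" by (simp add: cong_iff_dvd_diff)
  moreover have "(2::int) ^ (b + 3) = 4 * int (2 ^ Suc b)" by (simp add: power_add)
  ultimately show ?thesis by (simp add: half_period_def)
qed

lemma half_period_le:
  assumes "\<not> 3 dvd m" "1 < m"
  shows "\<exists>k. half_period m k \<and> 2 * k \<le> m"
proof -
  obtain x where x: "m = 2 ^ multiplicity 2 m * x" "odd x"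
    using assms multiplicity_decompose'[of m 2] by auto
  define b where "b = multiplicity 2 m"
  have n3: "\<not> 3 dvd x" using x assms(1) by (metis dvd_mult)
  show ?thesis
  proof (cases b)
    case 0
    thus ?thesis using half_period_odd_le[of m] x assms b_def by fastforce
  next
    case (Suc c)
    show ?thesis
    proof (cases "x = 1")
      case True
      thus ?thesis using x Suc half_period_two_power[of c] b_def by (intro exI[of _ "2 ^ c"]) auto
    next
      case False
      then obtain k where k: "half_period x k" "2 * k < x"
        using half_period_odd_le[OF x(2) n3] x(2) by (metis One_nat_def gr0I less_one nat_neq_iff even_zero)
      have "half_period (x * 2 ^ Suc c) (k * 2 ^ c)"
        using k x half_period_two_power by (intro half_period_mult) auto
      moreover have "2 * (k * 2 ^ c) \<le> x * 2 ^ Suc c" using k by simp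
      ultimately show ?thesis using x Suc b_def by (metis mult.commute)
    qed
  qed
qed

text \<open>Each factor allows its exponent to be halved, so the period 2k drops below half the
  modulus. A discriminator value m satisfies m < 2n, so this rules out moduli with two coprime
  factors of this kind.\<close>

lemma half_period_composite:
  assumes "odd x" "coprime x y" "1 < x" "1 < y" "\<not> 3 dvd x * y"
  shows "\<exists>k. half_period (x * y) k \<and> 4 * k < x * y"
proof -
  have n3: "\<not> 3 dvd x" "\<not> 3 dvd y" using assms(5) by (metis dvd_mult2, metis dvd_mult)
  obtain a where a: "half_period x a" "2 * a < x" using half_period_odd_le assms n3 by blast
  obtain b where b: "half_period y b" "2 * b \<le> y" using half_period_le assms n3 by blast
  have "(2 * a) * (2 * b) < x * y"
    using a b assms by (intro mult_less_le_imp_less) (auto simp: half_period_def)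
  thus ?thesis using half_period_mult[OF a(1) b(1) assms(2,1)] by (intro exI[of _ "a * b"]) auto
qed

section \<open>Prime powers\<close>

text \<open>Changing the exponents by multiples of h = (p - 1)/2, as exponents of 9, keeps the
  equation true modulo p. Both sides then run through residues in a single class modulo p, which has
  p^k = 2r + 1 members modulo p^(k+1); r + 1 values on each side must meet.\<close>

lemma covered_lift:
  fixes p k n :: nat and c :: int
  assumes p: "prime p" "5 \<le> p" and k: "1 \<le> k"
    and ord: "ord (p ^ Suc k) 9 = p ^ k * ((p - 1) div 2)"
    and sol: "even i0" "odd j0" "[3 ^ i0 - 3 ^ j0 = c] (mod int p)"
    and n: "p ^ Suc k < 2 * n"
  shows "covered (int (p ^ Suc k)) n c"
proof -
  define h where "h = (p - 1) div 2"
  define d where "d = p ^ Suc k"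
  define r where "r = p ^ k div 2"
  have "odd p" using p prime_odd_nat[of p] by simp
  hence h: "p = 2 * h + 1" "0 < h" using p by (auto simp: h_def)
  have r: "p ^ k = 2 * r + 1" using \<open>odd p\<close> unfolding r_def by (metis odd_two_times_div_two_succ even_power)
  \<comment> \<open>Here \<open>1 \<le> k\<close> matters: \<open>h \<le> r\<close> makes the
    largest exponent 2(h + rh) fit below 2rh + h + r + 1, which is half of p^(k+1) = (2h + 1)(2r +
    1) rounded up.\<close>
  have "p ^ 1 \<le> p ^ k" using k p by (intro power_increasing) auto
  hence hr: "h \<le> r" using h r by simp
  have "\<not> p dvd 3" using p by (auto dest: dvd_imp_le)
  hence cop3: "coprime p 3" using p prime_imp_coprime by blast
  hence "coprime d (3 ^ 2)" unfolding d_def coprime_power_left_iff coprime_power_right_iff by blast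
  hence cop: "coprime d 9" by simp
  have pd: "int p dvd int d" by (simp add: d_def)
  have d0: "0 < int d" using p by (simp add: d_def)
  have fermat: "[(9::int) ^ h = 1] (mod int p)"
  proof -
    have "[3 ^ (p - 1) = 1] (mod p)" using p(1) \<open>\<not> p dvd 3\<close> by (rule fermat_theorem)
    hence "[(9::nat) ^ h = 1] (mod p)" using h by (simp add: power_mult)
    thus ?thesis by (metis cong_int_iff of_nat_1 of_nat_numeral of_nat_power)
  qed
  have shift: "[(9::int) ^ (a + s * h) = 9 ^ a] (mod int p)" for a s
  proof -
    have "[(9::int) ^ a * (9 ^ h) ^ s = 9 ^ a * 1 ^ s] (mod int p)"
      using fermat by (intro cong_mult cong_pow) auto
    thus ?thesis by (simp add: power_add power_mult mult.commute)
  qed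
  obtain a0 b0 where ab0: "i0 = 2 * a0" "j0 = 2 * b0 + 1" using sol by (metis evenE oddE)
  \<comment> \<open>Representatives are taken in 1..h for \<open>a\<close>, as the exponent
    \<open>2 * a\<close> must be positive, and in 0..h-1 for \<open>b\<close>, which belongs to the
    exponent \<open>2 * b + 1\<close>.\<close>
  define a where "a = (a0 + (h - 1)) mod h + 1"
  define b where "b = b0 mod h"
  have a: "1 \<le> a" "a \<le> h" and b: "b < h" using h by (auto simp: a_def b_def Suc_leI)
  have "[(9::int) ^ a = 9 ^ a0] (mod int p)"
  proof -
    have "a + (a0 + (h - 1)) div h * h = a0 + 1 * h"
      using h div_mult_mod_eq[of "a0 + (h - 1)" h] by (simp add: a_def)
    thus ?thesis using shift[of a "(a0 + (h - 1)) div h"] shift[of a0 1]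
      by (metis cong_sym cong_trans)
  qed
  moreover have "[(9::int) ^ b = 9 ^ b0] (mod int p)"
    using shift[of b "b0 div h"] by (simp add: b_def cong_sym_eq add.commute)
  hence "[3 * (9::int) ^ b = 3 * 9 ^ b0] (mod int p)" by (rule cong_scalar_left)
  moreover have "[9 ^ a0 - 3 * 9 ^ b0 = c] (mod int p)"
    using sol(3) by (simp add: ab0 power_mult)
  ultimately have "[9 ^ a - 3 * 9 ^ b = c] (mod int p)"
    by (meson cong_diff cong_trans)
  hence sol': "[c + 3 * 9 ^ b = 9 ^ a] (mod int p)"
    by (metis cong_add_rcancel cong_sym diff_add_cancel)
  define \<rho> where "\<rho> = (9::int) ^ a mod int p"
  \<comment> \<open>The pigeonholes: all residues modulo \<open>d\<close> that are congruent to
    \<open>9 ^ a\<close> modulo p.\<close>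
  define X where "X = (\<lambda>y. \<rho> + int p * y) ` {0..<int (p ^ k)}"
  define A where "A = (\<lambda>s. (9::int) ^ (a + s * h) mod int d) ` {..r}"
  define B where "B = (\<lambda>t. (c + 3 * 9 ^ (b + t * h)) mod int d) ` {..r}"
  have X: "x mod int d \<in> X" if "[x = 9 ^ a] (mod int p)" for x
  proof -
    have "x mod int d mod int p = \<rho>" using that pd by (simp add: mod_mod_cancel cong_def \<rho>_def)
    hence "x mod int d = \<rho> + int p * (x mod int d div int p)" by (metis mod_mult_div_eq)
    moreover have "x mod int d < int p ^ k * int p" "0 \<le> x mod int d" using d0 by (auto simp: d_def mult.commute)
    moreover have "z div int p < P" if "z < P * int p" for z P
    proof (rule ccontr)
      assume "\<not> z div int p < P"
      hence "P * int p \<le> z div int p * int p" by (intro mult_right_mono) auto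
      also have "\<dots> \<le> z" using div_mult_mod_eq[of z "int p"] pos_mod_sign[of "int p" z] p by linarith
      finally show False using that by simp
    qed
    moreover have "0 \<le> x mod int d div int p" using d0 p by (simp add: pos_imp_zdiv_nonneg_iff)
    ultimately show ?thesis unfolding X_def by (intro image_eqI) auto
  qed
  have inj: "s = t" if "[(9::int) ^ (x + s * h) = 9 ^ (x + t * h)] (mod int d)" "s \<le> r" "t \<le> r" for x s t
  proof -
    have "[x + s * h = x + t * h] (mod p ^ k * h)"
      using that pow9_cong_iff_coprime[OF cop] ord by (simp add: d_def h_def)
    hence "[s * h = t * h] (mod p ^ k * h)" by (simp only: cong_add_lcancel_nat)
    hence "s mod p ^ k * h = t mod p ^ k * h" unfolding cong_def mod_mult_mult2 .
    hence "[s = t] (mod p ^ k)" using h by (simp add: cong_def)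
    thus ?thesis using that r by (simp add: cong_less_modulus_unique_nat)
  qed
  have "card A = r + 1"
    unfolding A_def by (subst card_image) (auto simp: inj_on_def cong_def intro!: inj)
  moreover have "card B = r + 1"
    unfolding B_def
  proof (subst card_image)
    show "inj_on (\<lambda>t. (c + 3 * 9 ^ (b + t * h)) mod int d) {..r}"
    proof (rule inj_onI)
      fix s t assume st: "s \<in> {..r}" "t \<in> {..r}"
        "(c + 3 * 9 ^ (b + s * h)) mod int d = (c + 3 * 9 ^ (b + t * h)) mod int d"
      hence "[c + 3 * 9 ^ (b + s * h) = c + 3 * 9 ^ (b + t * h)] (mod int d)" by (simp add: cong_def)
      hence "[3 * 9 ^ (b + s * h) = 3 * (9::int) ^ (b + t * h)] (mod int d)"
        by (simp only: cong_add_lcancel)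
      moreover have "coprime (3::int) (int d)"
      proof -
        have "coprime 3 d" using cop3 by (simp add: d_def coprime_commute)
        hence "coprime (int 3) (int d)" by (simp only: coprime_int_iff)
        thus ?thesis by simp
      qed
      ultimately have "[9 ^ (b + s * h) = (9::int) ^ (b + t * h)] (mod int d)"
        by (simp only: cong_mult_lcancel)
      thus "s = t" using st inj by auto
    qed
  qed simp
  moreover have "A \<union> B \<subseteq> X"
  proof -
    have "[c + 3 * 9 ^ (b + t * h) = c + 3 * 9 ^ b] (mod int p)" for t
      using shift by (intro cong_add cong_mult) auto
    hence "[c + 3 * 9 ^ (b + t * h) = 9 ^ a] (mod int p)" for t using sol' cong_trans by blast
    thus ?thesis using shift by (auto simp: A_def B_def intro!: X)
  qed
  hence "card (A \<union> B) \<le> card X" by (intro card_mono) (auto simp: X_def)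
  moreover have "card X \<le> p ^ k" 
    unfolding X_def by (rule order_trans[OF card_image_le]) (simp_all del: of_nat_power)
  ultimately have "A \<inter> B \<noteq> {}"
    using r card_Un_disjoint[of A B] by (auto simp: A_def B_def)
  then obtain s t where st: "s \<le> r" "t \<le> r"
    "[9 ^ (a + s * h) = c + 3 * 9 ^ (b + t * h)] (mod int d)"
    by (auto simp: A_def B_def cong_def)
  define i j where "i = 2 * (a + s * h)" and "j = 2 * (b + t * h) + 1"
  have "[9 ^ (a + s * h) - 3 * 9 ^ (b + t * h) = c + 3 * 9 ^ (b + t * h) - 3 * 9 ^ (b + t * h)] (mod int d)"
    using st(3) by (intro cong_diff) auto
  hence "[3 ^ i - 3 ^ j = c] (mod int d)" unfolding i_def j_def by (simp add: power_add power_mult)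
  moreover have sh: "s * h \<le> r * h" "t * h \<le> r * h" using st by auto
  have bound: "2 * (r * h) + h + r + 1 \<le> n"
  proof -
    have "p ^ Suc k = 2 * (2 * (r * h) + h + r) + 1" using h(1) r by (simp add: algebra_simps)
    thus ?thesis using n by simp
  qed
  have lin: "2 * (x + S) \<le> n \<and> (x < h \<longrightarrow> 2 * (x + S) + 1 \<le> n)"
    if "S \<le> R" "x \<le> h" "2 * R + h + r + 1 \<le> n" for x S R
    using that hr by auto
  have "i \<le> n" using lin[OF sh(1) a(2) bound] unfolding i_def by blast
  moreover have "j \<le> n" using lin[OF sh(2) _ bound, of b] b unfolding j_def by simp
  moreover have "1 \<le> i" "1 \<le> j" using a by (simp_all add: i_def j_def)
  ultimately have "i \<in> {1..n}" "j \<in> {1..n}" "[3 ^ i - 3 ^ j = c] (mod int d)" by auto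
  thus ?thesis unfolding covered_def d_def[symmetric]
    by (intro exI[of _ i] exI[of _ j]) (auto simp: i_def j_def)
qed

text \<open>In y^p - 1 = (y - 1)(1 + y + ... + y^(p-1)) the last factor has p summands congruent to
  1, so each p-th power gains a factor p.\<close>

lemma cong_one_prime_power:
  fixes x :: int and p a k :: nat
  assumes "1 \<le> a" "[x = 1] (mod int p ^ a)"
  shows "[x ^ (p ^ k) = 1] (mod int p ^ (a + k))"
proof (induction k)
  case (Suc k)
  define y where "y = x ^ (p ^ k)"
  have y: "int p ^ (a + k) dvd y - 1" using Suc by (simp add: y_def cong_iff_dvd_diff)
  have "int p dvd int p ^ (a + k)" using assms(1) by simp
  hence "[y = 1] (mod int p)" using y by (metis cong_iff_dvd_diff dvd_trans)
  hence "[(\<Sum>i<p. y ^ i) = (\<Sum>i<p. 1 ^ i)] (mod int p)" by (intro cong_sum cong_pow)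
  hence "int p dvd (\<Sum>i<p. y ^ i)" by (simp add: cong_def dvd_eq_mod_eq_0)
  hence "int p ^ (a + k) * int p dvd (y - 1) * (\<Sum>i<p. y ^ i)" using y by (intro mult_dvd_mono)
  also have "(y - 1) * (\<Sum>i<p. y ^ i) = y ^ p - 1" by (rule power_diff_1_eq[symmetric])
  also have "y ^ p = x ^ (p ^ Suc k)" by (simp add: y_def mult.commute flip: power_mult)
  finally show ?case by (simp add: cong_iff_dvd_diff mult.commute)
qed (use assms in simp)

text \<open>If a proper divisor s of p^k (p - 1)/2 were an exponent with 9^s = 1, the period 2s
  would be at most half of p^k (p - 1), hence smaller than \<open>n\<close>.\<close>

lemma separates_prime_power_ord:
  assumes p: "prime p" "5 \<le> p" and q: "odd q"
    and sep: "separates q n (p ^ Suc k)" and n: "p ^ Suc k < 2 * n"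
  shows "ord (p ^ Suc k) 9 = p ^ k * ((p - 1) div 2)" "ord p 9 = (p - 1) div 2"
    "n \<le> p ^ k * (p - 1)"
proof -
  define h where "h = (p - 1) div 2"
  define d where "d = p ^ Suc k"
  have "odd p" using p prime_odd_nat[of p] by simp
  hence h: "p = 2 * h + 1" "0 < h" using p by (auto simp: h_def)
  have "odd d" using \<open>odd p\<close> by (simp add: d_def)
  have "\<not> p dvd 3" using p by (auto dest: dvd_imp_le)
  hence cop3: "coprime p 3" using p prime_imp_coprime by blast
  have cop9: "coprime p (3 ^ 2)" "coprime d (3 ^ 2)"
    using cop3 unfolding d_def coprime_power_left_iff coprime_power_right_iff by auto
  have bound: "n \<le> 2 * s" if "[(9::nat) ^ s = 1] (mod d)" "0 < s" for s
    using separates_le_period[of q n 0 d s 1] half_period_odd[OF \<open>odd d\<close> that] sep q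
    by (simp add: d_def)
  have "[3 ^ totient d = 1] (mod d)"
    using cop3 by (intro euler_theorem) (simp add: d_def coprime_commute)
  moreover have tot: "totient d = 2 * (p ^ k * h)"
    unfolding d_def totient_prime_power_Suc[OF p(1)] using h(1) by simp
  ultimately have full: "[9 ^ (p ^ k * h) = 1] (mod d)" by (simp add: power_mult)
  hence "n \<le> 2 * (p ^ k * h)" using h by (intro bound) auto
  thus "n \<le> p ^ k * (p - 1)" using h by simp
  have eq: "s = p ^ k * h" if s: "[(9::nat) ^ s = 1] (mod d)" "0 < s" "s dvd p ^ k * h" for s
  proof (rule ccontr)
    assume "s \<noteq> p ^ k * h"
    moreover obtain c where c: "p ^ k * h = s * c" using s(3) by blast
    moreover have "0 < c" using c h by (cases c) auto
    ultimately have "2 \<le> c" by (cases "c = 1") auto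
    hence "s * 2 \<le> p ^ k * h" unfolding c by simp
    hence "n \<le> p ^ k * h" using bound[OF s(1,2)] by simp
    moreover have "p * x = 2 * (x * h) + x" for x using h(1) by (simp add: algebra_simps)
    hence "2 * (p ^ k * h) \<le> d" by (simp add: d_def)
    ultimately show False using n unfolding d_def by linarith
  qed
  have ord0: "0 < ord d 9" "0 < ord p 9" using cop9 by simp_all
  show "ord (p ^ Suc k) 9 = p ^ k * ((p - 1) div 2)"
    using eq[of "ord d 9"] ord[of 9 d] ord0 full ord_divides[of 9 "p ^ k * h" d]
    unfolding d_def h_def by blast
  \<comment> \<open>Raising to the power \<open>p ^ k\<close> lifts this relation to the modulus
    \<open>d\<close>, so a small order modulo p would give a small order modulo
    \<open>d\<close>.\<close>
  have "[9 ^ ord p 9 = 1] (mod p)" by (rule ord)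
  hence "[(9::int) ^ ord p 9 = 1] (mod int p ^ 1)"
    by (metis cong_int_iff of_nat_1 of_nat_numeral of_nat_power power_one_right)
  from cong_one_prime_power[OF _ this, of k]
  have "[(9::int) ^ (ord p 9 * p ^ k) = 1] (mod int d)" by (simp add: power_mult d_def)
  hence "[(9::nat) ^ (p ^ k * ord p 9) = 1] (mod d)"
    by (metis cong_int_iff of_nat_1 of_nat_numeral of_nat_power mult.commute)
  moreover have "ord p 9 dvd h"
  proof -
    have "[3 ^ totient p = 1] (mod p)" using cop3 by (intro euler_theorem) (simp add: coprime_commute)
    hence "[9 ^ h = 1] (mod p)" using p h by (simp add: totient_prime power_mult)
    thus ?thesis using ord_divides by blast
  qed
  ultimately have "p ^ k * ord p 9 = p ^ k * h" using ord0 p by (intro eq) auto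
  thus "ord p 9 = (p - 1) div 2" using p by (simp add: h_def)
qed

text \<open>With h = (q - 1)/2 as the order of 9, the order of 3 is h or 2h. If it is h, then h is
  odd, for otherwise 9^(h/2) = 1. That alternative is refuted later by a collision.\<close>

lemma primroot_of_ord9:
  assumes q: "prime q" "5 \<le> q" and ord9: "ord q 9 = (q - 1) div 2"
  shows "residue_primroot q 3 \<or> odd ((q - 1) div 2) \<and> [3 ^ ((q - 1) div 2) = 1] (mod q)"
proof -
  define h where "h = (q - 1) div 2"
  have "odd q" using q prime_odd_nat[of q] by simp
  hence h: "q = 2 * h + 1" "2 \<le> h" using q by (auto simp: h_def)
  have "\<not> q dvd 3" using q by (auto dest: dvd_imp_le)
  hence cop3: "coprime q 3" using q prime_imp_coprime by blast
  show ?thesis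
  proof (cases "[3 ^ h = 1] (mod q)")
    case True
    have "odd h"
    proof
      assume "even h"
      then obtain t where t: "h = 2 * t" by blast
      hence "[9 ^ t = 1] (mod q)" using True by (simp add: power_mult)
      hence "h dvd t" using ord9 ord_divides h_def by metis
      thus False using t h by (auto dest: dvd_imp_le)
    qed
    thus ?thesis using True h_def by simp
  next
    case False
    define r where "r = ord q 3"
    have "[3 ^ totient q = 1] (mod q)" using cop3 by (intro euler_theorem) (simp add: coprime_commute)
    hence "r dvd 2 * h" using q h ord_divides[of 3 "2 * h" q] by (simp add: totient_prime r_def)
    moreover have "[9 ^ r = 1] (mod q)"
    proof -
      have "[(3 ^ r) ^ 2 = 1 ^ 2] (mod q)" unfolding r_def by (intro cong_pow ord)
      moreover have "((3::nat) ^ r) ^ 2 = 9 ^ r" by (simp add: power2_eq_square flip: power_mult_distrib)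
      ultimately show ?thesis by simp
    qed
    hence "h dvd r" using ord9 ord_divides h_def by metis
    then obtain c where c: "r = h * c" by blast
    ultimately have "c dvd 2" using h by (simp add: mult.commute)
    hence "c = 1 \<or> c = 2" by (metis two_is_prime_nat prime_nat_iff)
    moreover have "c \<noteq> 1" using False c ord[of 3 q] r_def by (auto simp: ord_divides)
    ultimately have "ord q 3 = totient q" using c r_def q h by (simp add: totient_prime)
    thus ?thesis using cop3 q by (simp add: residue_primroot_def prime_gt_0_nat)
  qed
qed

section \<open>The primes 5 and 7, and the classes modulo 28\<close>

lemma coveredI:
  assumes "even i" "odd j" "1 \<le> i" "i \<le> n" "1 \<le> j" "j \<le> n" "(3 ^ i - 3 ^ j) mod p = v mod p"
  shows "covered p n v"
  using assms unfolding covered_def cong_def by auto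

lemma covered_5:
  assumes "\<not> 5 dvd v"
  shows "covered 5 5 v"
proof -
  have "v mod 5 = 1 \<or> v mod 5 = 2 \<or> v mod 5 = 3 \<or> v mod 5 = 4" using assms by presburger
  thus ?thesis
  proof (elim disjE)
    assume "v mod 5 = 1"
    thus ?thesis by (intro coveredI[of 2 1]) simp_all
  next
    assume "v mod 5 = 2"
    thus ?thesis by (intro coveredI[of 2 3]) simp_all
  next
    assume "v mod 5 = 3"
    thus ?thesis by (intro coveredI[of 4 1]) simp_all
  next
    assume "v mod 5 = 4"
    thus ?thesis by (intro coveredI[of 4 3]) simp_all
  qed
qed

text \<open>The residue 2 arises only through 3^6 - 3^3; five terms miss it. This gap is the source
  of the exceptional value.\<close>

lemma covered_7:
  assumes "\<not> 7 dvd v" "6 \<le> n \<or> 5 \<le> n \<and> v mod 7 \<noteq> 2"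
  shows "covered 7 n v"
proof -
  have "v mod 7 = 1 \<or> v mod 7 = 2 \<or> v mod 7 = 3 \<or> v mod 7 = 4 \<or> v mod 7 = 5 \<or> v mod 7 = 6"
    using assms(1) by presburger
  moreover have n: "5 \<le> n" "v mod 7 = 2 \<Longrightarrow> 6 \<le> n" using assms(2) by auto
  ultimately show ?thesis
  proof (elim disjE)
    assume "v mod 7 = 1"
    thus ?thesis using n by (intro coveredI[of 4 1]) simp_all
  next
    assume "v mod 7 = 2"
    thus ?thesis using n by (intro coveredI[of 6 3]) simp_all
  next
    assume "v mod 7 = 3"
    thus ?thesis using n by (intro coveredI[of 2 3]) simp_all
  next
    assume "v mod 7 = 4"
    thus ?thesis using n by (intro coveredI[of 2 5]) simp_all
  next
    assume "v mod 7 = 5"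
    thus ?thesis using n by (intro coveredI[of 4 3]) simp_all
  next
    assume "v mod 7 = 6"
    thus ?thesis using n by (intro coveredI[of 2 1]) simp_all
  qed
qed

text \<open>To be applied with x = \<open>qstar q\<close>, which is 1 modulo 4; so the condition
  modulo 7 becomes one modulo 28, and -1 is excluded. The sign in \<open>qstar\<close> later turns 1
  into the two classes of q.\<close>

lemma cong_28_iff:
  fixes x :: int
  assumes "4 dvd x - 1"
  shows "2 * x mod 7 = 2 \<longleftrightarrow> [x = 1] (mod 28)" and "\<not> [x = -1] (mod 28)"
proof -
  have "2 * x mod 7 = 2 \<longleftrightarrow> 7 dvd x - 1" by presburger
  also have "\<dots> \<longleftrightarrow> 4 * 7 dvd x - 1"
  proof
    assume "7 dvd x - 1"
    moreover have "coprime (4 :: int) 7" by (simp add: coprime_iff_gcd_eq_1 gcd_non_0_int)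
    ultimately show "4 * 7 dvd x - 1" using assms by (intro divides_mult)
  qed (rule dvd_mult_right)
  finally show "2 * x mod 7 = 2 \<longleftrightarrow> [x = 1] (mod 28)" by (simp add: cong_iff_dvd_diff)
  show "\<not> [x = -1] (mod 28)"
  proof
    assume "[x = -1] (mod 28)"
    hence "4 * 7 dvd x + 1" by (simp add: cong_iff_dvd_diff)
    hence "4 dvd x + 1" by (rule dvd_mult_left)
    with assms show False by presburger
  qed
qed

lemma qstar_mod_7:
  assumes "odd q"
  shows "2 * qstar q mod 7 = 2 \<longleftrightarrow> [int q = 1] (mod 28) \<or> [int q = -1] (mod 28)"
proof -
  obtain k where k: "q = 2 * k + 1" using assms by (auto elim: oddE)
  show ?thesis
  proof (cases "even k")
    case True
    hence "qstar q = int q" "4 dvd int q - 1" using k by (auto simp: qstar_def elim!: evenE)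
    thus ?thesis using cong_28_iff[of "int q"] by simp
  next
    case False
    then obtain l where "k = 2 * l + 1" by (auto elim: oddE)
    hence "qstar q = - int q" "- int q - 1 = 4 * - (int l + 1)" using k by (auto simp: qstar_def)
    hence "qstar q = - int q" "4 dvd - int q - 1" by (simp_all only: dvd_triv_left)
    moreover have "[int q = a] (mod 28) \<longleftrightarrow> [- int q = - a] (mod 28)" for a
      by (simp add: cong_minus_minus_iff)
    ultimately show ?thesis using cong_28_iff[of "- int q"] by auto
  qed
qed

lemma not_dvd_two_qstar:
  assumes "prime p" "prime q" "p \<noteq> q" "p \<noteq> 2"
  shows "\<not> int p dvd 2 * qstar q"
proof
  assume "int p dvd 2 * qstar q"
  hence "int p dvd 2 * int q"
    by (cases "even ((q - 1) div 2)") (auto simp: qstar_def)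
  hence "int p dvd int (2 * q)" by simp
  hence "p dvd 2 * q" by (simp only: int_dvd_int_iff)
  hence "p dvd 2 \<or> p dvd q" using assms(1) by (simp add: prime_dvd_mult_iff)
  thus False using assms by (metis primes_dvd_imp_eq two_is_prime_nat)
qed

text \<open>For p different from q, any solution modulo p forces k = 0 by lifting. Then p = 5 fails
  by its period 4, p = 7 leaves the exception, and larger p are covered. For p = q the target is
  0.\<close>

lemma separates_prime_power:
  assumes p: "prime p" "5 \<le> p" and q: "prime q" "5 \<le> q"
    and sep: "separates q n (p ^ Suc k)" and pow: "\<And>e. 2 ^ e < p ^ Suc k \<Longrightarrow> 2 ^ e < n"
  shows "p ^ Suc k = 7 \<and> n = 5 \<and> ([int q = 1] (mod 28) \<or> [int q = -1] (mod 28)) \<or>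
    p = q \<and> Artin_prime q \<and> (k = 0 \<or> \<not> Mirimanoff_prime q) \<and> n \<le> q ^ k * (q - 1)"
proof -
  have odd: "odd p" "odd q" using p q prime_odd_nat[of p] prime_odd_nat[of q] by auto
  have "1 < p ^ Suc k" using p by (intro one_less_power) auto
  hence half: "p ^ Suc k < 2 * n" using pow by (rule less_double_of_two_powers)
  note ord = separates_prime_power_ord[OF p odd(2) sep half]
  have unc: "\<not> covered (int (p ^ Suc k)) n (2 * qstar q)"
    using separates_not_covered[OF sep odd(2)] odd by simp
  have lift: "k = 0" if "even i" "odd j" "[3 ^ i - 3 ^ j = 2 * qstar q] (mod int p)" for i j
    using covered_lift[OF p _ ord(1) that half] unc by (cases k) auto
  show ?thesis
  proof (cases "p = q")
    case False
    have nd: "\<not> int p dvd 2 * qstar q" using not_dvd_two_qstar p q False by auto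
    have "\<not> prime (6::nat)" "\<not> prime (8::nat)" "\<not> prime (9::nat)" "\<not> prime (10::nat)" by simp_all
    hence "p \<noteq> 6" "p \<noteq> 8" "p \<noteq> 9" "p \<noteq> 10" using p(1) by blast+
    then consider "p = 5" | "p = 7" | "11 \<le> p" using p(2) by linarith
    hence "covered (int p) p (2 * qstar q)"
    proof cases
      case 1 thus ?thesis using covered_5 nd by simp
    next
      case 2 thus ?thesis using covered_7 nd by simp
    next
      case 3 show ?thesis using covered_prime[OF p(1) 3 ord(2) nd] by simp
    qed
    hence k: "k = 0" using lift unfolding covered_def by blast
    consider "p = 5" | "p = 7" | "11 \<le> p" using \<open>p \<noteq> 6\<close> \<open>p \<noteq> 8\<close> \<open>p \<noteq> 9\<close> \<open>p \<noteq> 10\<close> p(2) by linarith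
    thus ?thesis
    proof cases
      case 1
      hence "4 < n" using pow[of 2] by (simp add: k)
      thus ?thesis using ord(3) 1 k by simp
    next
      case 2
      hence "4 < n" using pow[of 2] by (simp add: k)
      hence "\<not> 6 \<le> n" "2 * qstar q mod 7 = 2"
        using covered_7[of "2 * qstar q" n] nd unc 2 k by auto
      thus ?thesis using \<open>4 < n\<close> qstar_mod_7[OF odd(2)] 2 k by auto
    next
      case 3
      have "covered (int p) n (2 * qstar q)"
        using covered_prime[OF p(1) 3 ord(2) nd] pow k by simp
      thus ?thesis using unc k by simp
    qed
  next
    case True
    define h where "h = (q - 1) div 2"
    have h: "q = 2 * h + 1" "0 < h" using odd q by (auto simp: h_def)
    \<comment> \<open>Otherwise 3^(h+1) - 3^1 = 0 = 2 \<open>qstar q\<close> modulo q with h + 1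
      even: a collision, and h + 1 is at most n since q < 2n.\<close>
    have "\<not> (odd h \<and> [3 ^ h = 1] (mod q))"
    proof
      assume *: "odd h \<and> [3 ^ h = 1] (mod q)"
      hence "[(3::int) ^ h = 1] (mod int q)"
        by (metis cong_int_iff of_nat_1 of_nat_numeral of_nat_power)
      hence "[(3::int) ^ h * 3 = 1 * 3] (mod int q)" by (rule cong_scalar_right)
      hence "[(3::int) ^ (h + 1) - 3 ^ 1 = 3 - 3] (mod int q)" by (intro cong_diff) (simp_all add: mult.commute)
      moreover have "[0 = 2 * qstar q] (mod int q)" by (simp add: qstar_def cong_def)
      ultimately have sol: "[(3::int) ^ (h + 1) - 3 ^ 1 = 2 * qstar q] (mod int q)"
        using cong_trans by fastforce
      have "k = 0" by (rule lift[of "h + 1" 1]) (use * sol True in auto)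
      hence "h + 1 \<le> n" using half h True by simp
      hence "covered (int q) n (2 * qstar q)"
        using sol * unfolding covered_def by (intro exI[of _ "h + 1"] exI[of _ 1]) auto
      thus False using unc True \<open>k = 0\<close> by simp
    qed
    hence "residue_primroot q 3" using primroot_of_ord9[OF q] ord(2) True h_def by auto
    \<comment> \<open>A relation 9^h = 1 already valid modulo q^2 lifts to exponent h q^(k-1) modulo
      q^(k+1), a factor q below the order just established.\<close>
    moreover have "k = 0 \<or> \<not> Mirimanoff_prime q"
    proof (rule ccontr)
      assume *: "\<not> ?thesis"
      then obtain l where l: "k = Suc l" by (cases k) auto
      have "[3 ^ (2 * h) = 1] (mod q\<^sup>2)" using * h by (simp add: Mirimanoff_prime_def)
      hence "[(9::nat) ^ h = 1] (mod q\<^sup>2)" by (simp add: power_mult)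
      hence "[(9::int) ^ h = 1] (mod int q ^ 2)"
        by (metis cong_int_iff of_nat_1 of_nat_numeral of_nat_power)
      from cong_one_prime_power[OF _ this, of l]
      have "[(9::int) ^ (h * q ^ l) = 1] (mod int (q ^ Suc k))" by (simp add: power_mult l)
      hence "[(9::nat) ^ (h * q ^ l) = 1] (mod q ^ Suc k)"
        by (metis cong_int_iff of_nat_1 of_nat_numeral of_nat_power)
      hence "q ^ k * h dvd h * q ^ l" using ord(1) True h_def ord_divides by metis
      hence "q ^ k * h \<le> h * q ^ l" using h by (intro dvd_imp_le) auto
      thus False using h q l by simp
    qed
    ultimately show ?thesis using True q ord(3) by (auto simp: Artin_prime_def)
  qed
qed

section \<open>Classification of the separating moduli\<close>

text \<open>A factor 3^a multiplies the modulus but costs only a delay of \<open>a\<close> before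
  the period: n < a + 2k with 2k at most x, whereas m is at least (2a + 1) x and must be below
  2n.\<close>

lemma separates_three_dvd:
  assumes "separates q n m" "odd q" "3 dvd m" "0 < m" "\<And>e. 2 ^ e < m \<Longrightarrow> 2 ^ e < n"
  shows False
proof -
  have "1 < m" using assms(3,4) by (cases "m = 1") auto
  hence half: "m < 2 * n" using assms(5) by (rule less_double_of_two_powers)
  obtain x where x: "m = 3 ^ multiplicity 3 m * x" "\<not> 3 dvd x"
    using assms(4) multiplicity_decompose'[of m 3] by auto
  define a where "a = multiplicity 3 m"
  have a: "1 \<le> a" using x assms(3) a_def by (cases a) auto
  have sep: "separates q n (3 ^ a * x)" using assms(1) x a_def by simp
  have pow: "2 * a + 1 \<le> 3 ^ a" by (induction a) auto
  show False
  proof (cases "x = 1")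
    case True
    have "half_period 1 1" by (simp add: half_period_def)
    hence n: "n < a + 2" using separates_le_period[of q n a x 1 a] sep assms(2) a True by simp
    \<comment> \<open>From a = 2 on, 3^a is at least 2a + 3, too large for m < 2n and n < a + 2. For
      m = 3 the power 2 < 3 forces n > 2 instead.\<close>
    have "a = 1"
    proof (rule ccontr)
      assume "a \<noteq> 1"
      define b where "b = a - 2"
      have b: "a = Suc (Suc b)" using a \<open>a \<noteq> 1\<close> by (simp add: b_def)
      have "2 * b + 7 \<le> 3 * 3 * 3 ^ b" by (induction b) auto
      thus False using half n x True a_def[symmetric] b by simp
    qed
    moreover have "2 < n" using assms(5)[of 1] x True a_def[symmetric] \<open>a = 1\<close> by simp
    ultimately show False using n by simp
  next
    case False
    hence "1 < x" using x assms(4) by (cases x) auto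
    then obtain k where k: "half_period x k" "2 * k \<le> x" using half_period_le x(2) by blast
    have n: "n < a + 2 * k" using separates_le_period[OF sep assms(2) k(1) a] by simp
    have "(2 * a + 1) * x \<le> m" using pow x a_def by (metis mult_le_mono1)
    moreover obtain y where y: "x = y + 1" using \<open>1 < x\<close> by (cases x) auto
    moreover have "y \<le> a * y" using a by simp
    ultimately show False using n k half by (simp add: algebra_simps)
  qed
qed

lemma separates_classification:
  assumes q: "prime q" "5 \<le> q" and m: "0 < m" and sep: "separates q n m"
    and pow: "\<And>e. 2 ^ e < m \<Longrightarrow> 2 ^ e < n"
  shows "(\<exists>e. m = 2 ^ e) \<or>
    m = 7 \<and> n = 5 \<and> ([int q = 1] (mod 28) \<or> [int q = -1] (mod 28)) \<or>
    (\<exists>k. m = q ^ Suc k \<and> Artin_prime q \<and> (k = 0 \<or> \<not> Mirimanoff_prime q) \<and> n \<le> q ^ k * (q - 1))"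
proof -
  have oq: "odd q" using q prime_odd_nat[of q] by auto
  have n3: "\<not> 3 dvd m" using separates_three_dvd[OF sep oq _ m pow] by blast
  obtain x where x: "m = 2 ^ multiplicity 2 m * x" "odd x"
    using m multiplicity_decompose'[of m 2] by auto
  show ?thesis
  proof (cases "x = 1")
    case True
    thus ?thesis using x by auto
  next
    case False
    then obtain p where p: "prime p" "p dvd x" using prime_factor_nat by blast
    have pm: "p dvd m" using p(2) x(1) by (metis dvd_mult)
    have "odd p" using p(2) x(2) dvd_trans by blast
    moreover have "p \<noteq> 3" using pm n3 by blast
    ultimately have "p \<noteq> 2" "p \<noteq> 3" "p \<noteq> 4" by auto
    hence p5: "5 \<le> p" using prime_ge_2_nat[OF p(1)] by linarith
    obtain y where y: "m = p ^ multiplicity p m * y" "\<not> p dvd y"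
      using m p5 multiplicity_decompose'[of m p] by auto
    obtain k where k: "multiplicity p m = Suc k"
      using y pm by (cases "multiplicity p m") auto
    show ?thesis
    proof (cases "y = 1")
      case True
      hence m': "m = p ^ Suc k" using y k by simp
      show ?thesis
        using separates_prime_power[OF p(1) p5 q, of n k] sep pow unfolding m' by blast
    next
      case False
      hence "1 < y" using y m by (cases y) auto
      have "1 < p ^ Suc k" using p5 by (intro one_less_power) auto
      moreover have "coprime (p ^ Suc k) y" using p y(2) prime_imp_coprime by auto
      ultimately obtain l where l: "half_period m l" "4 * l < m"
        using half_period_composite[of "p ^ Suc k" y] \<open>odd p\<close> \<open>1 < y\<close> n3 y k by auto
      have "n < 1 + 2 * l" using separates_le_period[of q n 0 m l 1] sep oq l by simp
      moreover have "m < 2 * n"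
        using l pow by (intro less_double_of_two_powers) (auto simp: half_period_def)
      ultimately show ?thesis using l by simp
    qed
  qed
qed

section \<open>Moduli that do separate\<close>

lemma separatesI_parity:
  assumes "odd q"
    and "\<And>i j. i \<in> {1..n} \<Longrightarrow> j \<in> {1..n} \<Longrightarrow> even i = even j \<Longrightarrow>
           4 * int m dvd 3 ^ i - 3 ^ j \<Longrightarrow> i = j"
    and "\<And>i j. i \<in> {1..n} \<Longrightarrow> j \<in> {1..n} \<Longrightarrow> even i \<Longrightarrow> odd j \<Longrightarrow>
           \<not> 4 * int m dvd 3 ^ i - 3 ^ j - 2 * qstar q"
  shows "separates q n m"
proof (rule separatesI)
  fix i j assume ij: "i \<in> {1..n}" "j \<in> {1..n}" "i < j"
  show "\<not> [u_seq q i = u_seq q j] (mod int m)"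
  proof
    assume *: "[u_seq q i = u_seq q j] (mod int m)"
    consider "even i = even j" | "even i" "odd j" | "odd i" "even j" by blast
    thus False
    proof cases
      case 1
      hence "i = j" using * u_seq_cong_same_parity[OF assms(1), of i j m] assms(2)[of i j] ij by simp
      thus False using ij by simp
    next
      case 2
      thus False using * u_seq_cong_opposite_parity[OF assms(1), of i j m] assms(3)[of i j] ij by simp
    next
      case 3
      thus False
        using cong_sym[OF *] u_seq_cong_opposite_parity[OF assms(1), of j i m] assms(3)[of j i] ij by simp
    qed
  qed
qed

lemma cong_atLeastAtMost_eq:
  fixes i j n m :: nat
  assumes "[i = j] (mod m)" "i \<in> {1..n}" "j \<in> {1..n}" "n \<le> m"
  shows "i = j"
proof -
  have "[(i - 1) + 1 = (j - 1) + 1] (mod m)" using assms by simp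
  hence "[i - 1 = j - 1] (mod m)" by (simp only: cong_add_rcancel_nat)
  moreover have "i - 1 < m" "j - 1 < m" using assms by auto
  ultimately have "i - 1 = j - 1" by (simp add: cong_less_modulus_unique_nat)
  thus ?thesis using assms by auto
qed

text \<open>Same parity: 3 has order 2^e modulo 2^(e+2). Opposite parity: modulo 8 the difference is
  1 - 3 - 2 \<open>qstar q\<close> = 4, since \<open>qstar q\<close> is 1 modulo 4.\<close>

lemma separates_two_power:
  assumes q: "odd q" and n: "n \<le> 2 ^ e"
  shows "separates q n (2 ^ e)"
proof (cases e)
  case 0
  thus ?thesis using n by (intro separatesI) auto
next
  case (Suc f)
  have m: "4 * int (2 ^ e) = int (2 ^ (e + 2))" by (simp add: power_add)
  show ?thesis
  proof (rule separatesI_parity[OF q])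
    fix i j assume ij: "i \<in> {1..n}" "j \<in> {1..n}" "4 * int (2 ^ e) dvd 3 ^ i - 3 ^ j"
    have "[(3::int) ^ i = 3 ^ j] (mod int (2 ^ (e + 2)))"
      using ij(3) unfolding m cong_iff_dvd_diff .
    moreover have "coprime (2 ^ (e + 2)) (3 :: nat)" by (subst coprime_power_left_iff) simp
    moreover have "ord (2 ^ (e + 2)) (3 :: nat) = 2 ^ e"
      using ord_twopow_3_5[of "e + 2" 3] Suc by simp
    ultimately have "[i = j] (mod 2 ^ e)" using pow3_cong_iff_coprime by metis
    thus "i = j" using cong_atLeastAtMost_eq ij n by blast
  next
    fix i j :: nat assume ij: "even i" "odd j"
    obtain a b where ab: "i = 2 * a" "j = 2 * b + 1" using ij by (metis evenE oddE)
    show "\<not> 4 * int (2 ^ e) dvd 3 ^ i - 3 ^ j - 2 * qstar q"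
    proof
      assume "4 * int (2 ^ e) dvd 3 ^ i - 3 ^ j - 2 * qstar q"
      moreover have "8 dvd 4 * int (2 ^ e)" by (simp add: Suc)
      ultimately have main: "8 dvd 3 ^ i - 3 ^ j - 2 * qstar q" using dvd_trans by blast
      have "[(9::int) ^ c = 1 ^ c] (mod 8)" for c by (rule cong_pow) (simp add: cong_def)
      hence nine: "8 dvd (9::int) ^ c - 1" for c by (simp add: cong_iff_dvd_diff)
      have "8 dvd (3 ^ i - 3 ^ j - 2 * qstar q) - (9 ^ a - 1) + 3 * (9 ^ b - 1)"
        by (rule dvd_add[OF dvd_diff[OF main nine] dvd_mult[OF nine]])
      moreover have "(3::int) ^ i = 9 ^ a" "(3::int) ^ j = 3 * 9 ^ b" by (simp_all add: ab power_mult)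
      ultimately have "8 dvd - 2 - 2 * qstar q" by (simp add: algebra_simps)
      moreover have "4 dvd qstar q - 1" using qstar_cong_1[OF q] by (simp add: cong_iff_dvd_diff)
      ultimately show False by presburger
    qed
  qed
qed

lemma separates_odd:
  assumes "odd q" "odd m"
    and "\<And>i j. i \<in> {1..n} \<Longrightarrow> j \<in> {1..n} \<Longrightarrow> even i = even j \<Longrightarrow>
           [(3::int) ^ i = 3 ^ j] (mod int m) \<Longrightarrow> i = j"
    and "\<not> covered (int m) n (2 * qstar q)"
  shows "separates q n m"
proof (rule separatesI_parity[OF assms(1)])
  fix i j assume "i \<in> {1..n}" "j \<in> {1..n}" "even i = even j" "4 * int m dvd 3 ^ i - 3 ^ j"
  thus "i = j"
    using assms(3) u_seq_cong_same_parity u_seq_cong_odd_same_parity assms(1,2) by metis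
next
  fix i j assume *: "i \<in> {1..n}" "j \<in> {1..n}" "even i" "odd j"
  show "\<not> 4 * int m dvd 3 ^ i - 3 ^ j - 2 * qstar q"
  proof
    assume "4 * int m dvd 3 ^ i - 3 ^ j - 2 * qstar q"
    hence "[3 ^ i - 3 ^ j = 2 * qstar q] (mod int m)"
      unfolding cong_iff_dvd_diff by (rule dvd_mult_right)
    thus False using assms(4) * unfolding covered_def by blast
  qed
qed

text \<open>3 remains a primitive root modulo q^(k+1), so equal powers mean exponents congruent
  modulo the totient. Opposite parity would give 3^i = 3^j modulo q, hence i = j modulo the even
  number q - 1.\<close>

lemma separates_Artin:
  assumes q: "prime q" "5 \<le> q" and Artin: "Artin_prime q" and k: "k = 0 \<or> \<not> Mirimanoff_prime q"
    and n: "n \<le> q ^ k * (q - 1)"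
  shows "separates q n (q ^ Suc k)"
proof (rule separates_odd)
  show oq: "odd q" using q prime_odd_nat[of q] by auto
  thus "odd (q ^ Suc k)" by simp
  have prim: "residue_primroot q 3" using Artin by (simp add: Artin_prime_def)
  have prim': "residue_primroot (q ^ Suc k) 3"
  proof (cases k)
    case 0
    thus ?thesis using prim by simp
  next
    case (Suc l)
    hence "[3 ^ (q - 1) \<noteq> 1] (mod q\<^sup>2)" using k q by (simp add: Mirimanoff_prime_def)
    thus ?thesis using residue_primroot_prime_lift_iff[OF q(1) oq prim] by blast
  qed
  have ord: "ord (q ^ Suc k) 3 = q ^ k * (q - 1)" "coprime (q ^ Suc k) 3"
    "ord q 3 = q - 1" "coprime q 3"
    using prim prim' totient_prime[OF q(1)] totient_prime_power_Suc[OF q(1), of k]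
    by (simp_all only: residue_primroot_def)
  show "i = j" if "i \<in> {1..n}" "j \<in> {1..n}" "[(3::int) ^ i = 3 ^ j] (mod int (q ^ Suc k))" for i j
    using that pow3_cong_iff_coprime[OF ord(2)] ord(1) n cong_atLeastAtMost_eq by metis
  show "\<not> covered (int (q ^ Suc k)) n (2 * qstar q)"
  proof
    assume "covered (int (q ^ Suc k)) n (2 * qstar q)"
    then obtain i j where ij: "even i" "odd j" "[3 ^ i - 3 ^ j = 2 * qstar q] (mod int (q ^ Suc k))"
      unfolding covered_def by blast
    have "[3 ^ i - 3 ^ j = 2 * qstar q] (mod int q)"
      by (rule cong_dvd_modulus[OF ij(3)]) simp
    moreover have "[2 * qstar q = 0] (mod int q)" by (simp add: qstar_def cong_def)
    ultimately have "[3 ^ i - 3 ^ j = (0::int)] (mod int q)" using cong_trans by blast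
    hence "[(3::int) ^ i = 3 ^ j] (mod int q)" by (simp add: cong_iff_dvd_diff)
    hence "[i = j] (mod (q - 1))" using pow3_cong_iff_coprime[OF ord(4)] ord(3) by metis
    moreover have "2 dvd q - 1" using oq by simp
    ultimately have "[i = j] (mod 2)" by (rule cong_dvd_modulus_nat)
    thus False using ij(1,2) by (auto simp: cong_def even_iff_mod_2_eq_zero)
  qed
qed

lemma separates_5_7:
  assumes "odd q" "2 * qstar q mod 7 = 2"
  shows "separates q 5 7"
proof (rule separates_odd[OF assms(1)])
  have ivl: "i = 1 \<or> i = 2 \<or> i = 3 \<or> i = 4 \<or> i = 5" if "i \<in> {1..5}" for i :: nat
    using that by auto
  show "i = j" if "i \<in> {1..5}" "j \<in> {1..5}" "even i = even j"
    "[(3::int) ^ i = 3 ^ j] (mod int 7)" for i j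
    using ivl[OF that(1)] ivl[OF that(2)] that(3,4) by (elim disjE) (simp_all add: cong_def)
  show "\<not> covered (int 7) 5 (2 * qstar q)"
  proof
    assume "covered (int 7) 5 (2 * qstar q)"
    then obtain i j where ij: "i \<in> {1..5}" "j \<in> {1..5}" "even i" "odd j"
      "[3 ^ i - 3 ^ j = 2 * qstar q] (mod int 7)"
      unfolding covered_def by blast
    have "(3 ^ i - 3 ^ j) mod 7 = (2 :: int)" using ij(5) assms(2) by (simp add: cong_def)
    thus False using ivl[OF ij(1)] ivl[OF ij(2)] ij(3,4) by (elim disjE) simp_all
  qed
qed simp

section \<open>The least separating modulus\<close>

lemma discriminator_le: "0 < m \<Longrightarrow> separates q n m \<Longrightarrow> discriminator q n \<le> m"
  unfolding discriminator_def separates_def by (rule Least_le) blast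

lemma discriminator_separates:
  assumes "odd q"
  shows "0 < discriminator q n" "separates q n (discriminator q n)"
proof -
  \<comment> \<open>Some modulus separates, so the \<open>LEAST\<close> is attained.\<close>
  have "separates q n (2 ^ n)" by (rule separates_two_power[OF assms]) simp
  hence "0 < (2::nat) ^ n \<and> separates q n (2 ^ n)" by simp
  hence "0 < discriminator q n \<and> separates q n (discriminator q n)"
    unfolding discriminator_def separates_def by (rule LeastI)
  thus "0 < discriminator q n" "separates q n (discriminator q n)" by auto
qed

lemma separates_le:
  assumes "separates q n m" "0 < m"
  shows "n \<le> m"
proof -
  have "inj_on (\<lambda>i. u_seq q i mod int m) {1..n}"
  proof (rule inj_onI)
    fix i j assume "i \<in> {1..n}" "j \<in> {1..n}" "u_seq q i mod int m = u_seq q j mod int m"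
    thus "i = j" by (intro separatesD[OF assms(1)]) (simp_all add: cong_def)
  qed
  hence "card {1..n} \<le> card {0..<int m}"
    using assms(2) by (intro card_inj_on_le) auto
  thus ?thesis by simp
qed

lemma discriminator_cases [consumes 2, case_names two seven Artin]:
  assumes q: "prime q" "5 \<le> q"
  obtains (two) e where "discriminator q n = 2 ^ e" "n \<le> 2 ^ e"
  | (seven) "discriminator q n = 7" "n = 5" "[int q = 1] (mod 28) \<or> [int q = -1] (mod 28)"
  | (Artin) k where "discriminator q n = q ^ Suc k" "Artin_prime q"
      "k = 0 \<or> \<not> Mirimanoff_prime q" "n \<le> q ^ k * (q - 1)"
proof -
  have oq: "odd q" using q prime_odd_nat[of q] by auto
  note D = discriminator_separates[OF oq, of n]
  have "2 ^ e < n" if "2 ^ e < discriminator q n" for e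
  proof (rule ccontr)
    assume "\<not> 2 ^ e < n"
    hence "discriminator q n \<le> 2 ^ e"
      using separates_two_power[OF oq, of n e] by (intro discriminator_le) auto
    thus False using that by simp
  qed
  from separates_classification[OF q D this] separates_le[OF D(2,1)] that
  show ?thesis by metis
qed

text \<open>Clearing the denominator turns the real bound into the length of the period modulo q^f;
  the exponent f = 0 drops out because the bound exceeds 1.\<close>

lemma real_power_ge_iff:
  fixes q n f :: nat
  assumes "2 \<le> q" "1 \<le> n"
  shows "real q / (real q - 1) * real n \<le> real (q ^ f) \<longleftrightarrow> (\<exists>k. f = Suc k \<and> n \<le> q ^ k * (q - 1))"
proof -
  have q1: "real q - 1 = real (q - 1)" "0 < real (q - 1)" "0 < real q" using assms by (auto simp: of_nat_diff)
  have "real q / (real q - 1) * real n \<le> real (q ^ f) \<longleftrightarrow> real (q * n) \<le> real (q ^ f * (q - 1))"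
    unfolding q1 using q1 by (simp add: field_simps)
  also have "\<dots> \<longleftrightarrow> q * n \<le> q ^ f * (q - 1)" by (rule of_nat_le_iff)
  also have "\<dots> \<longleftrightarrow> (\<exists>k. f = Suc k \<and> n \<le> q ^ k * (q - 1))"
  proof (cases f)
    case 0
    have "q * 1 \<le> q * n" using assms by (intro mult_left_mono) auto
    hence "q - 1 < q * n" using assms by linarith
    thus ?thesis using 0 by simp
  next
    case (Suc k)
    thus ?thesis using assms by (simp add: mult.assoc)
  qed
  finally show ?thesis .
qed

text \<open>\<open>E\<close> is the integer part of the binary logarithm of q^(k+1), so the
  fractional part is the logarithm of q^(k+1) / 2^E. Comparing this quotient with q / (q - 1) gives
  the right-hand side.\<close>

lemma frac_log_gt_iff:
  fixes q k E :: nat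
  assumes "2 \<le> q" "2 ^ E \<le> q ^ Suc k" "q ^ Suc k < 2 ^ Suc E"
  shows "frac (real (Suc k) * (ln (real q) / ln 2)) > ln (real q / (real q - 1)) / ln 2 \<longleftrightarrow>
           2 ^ E < q ^ k * (q - 1)"
proof -
  have q: "real q - 1 = real (q - 1)" "0 < real (q - 1)" "0 < real q" using assms by (auto simp: of_nat_diff)
  have ln2: "ln 2 > (0::real)" by simp
  define L where "L = real (Suc k) * (ln (real q) / ln 2)"
  have L: "L * ln 2 = ln (real (q ^ Suc k))" using q by (simp add: L_def ln_realpow del: power_Suc)
  have "real (2 ^ E) \<le> real (q ^ Suc k)" "real (q ^ Suc k) < real (2 ^ Suc E)"
    using assms(2,3) by (simp_all only: of_nat_le_iff of_nat_less_iff)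
  hence pow: "2 ^ E \<le> real (q ^ Suc k)" "real (q ^ Suc k) < 2 ^ Suc E"
    unfolding of_nat_power of_nat_numeral by simp_all
  have pos: "0 < real (q ^ Suc k)" using q by simp
  have "ln (2 ^ E :: real) \<le> ln (real (q ^ Suc k))"
    using pow(1) pos by (subst ln_le_cancel_iff) simp_all
  hence "real E * ln 2 \<le> L * ln 2" unfolding L by (simp add: ln_realpow)
  moreover have "ln (real (q ^ Suc k)) < ln (2 ^ Suc E :: real)"
    using pow(2) pos by (subst ln_less_cancel_iff) simp_all
  hence "L * ln 2 < real (Suc E) * ln 2" unfolding L by (simp add: ln_realpow del: power_Suc)
  ultimately have "real E \<le> L" "L < real E + 1" using ln2 by auto
  hence "frac L = L - real E" by (simp add: frac_unique_iff)
  hence "frac L > ln (real q / (real q - 1)) / ln 2 \<longleftrightarrow> ln (real q / (real q - 1)) < (L - real E) * ln 2"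
    using ln2 by (simp add: divide_less_eq)
  also have "(L - real E) * ln 2 = ln (real (q ^ Suc k)) - ln (2 ^ E)"
    by (simp add: left_diff_distrib L ln_realpow del: power_Suc)
  also have "\<dots> = ln (real (q ^ Suc k) / 2 ^ E)" using q by (simp add: ln_div)
  also have "ln (real q / (real q - 1)) < ln (real (q ^ Suc k) / 2 ^ E) \<longleftrightarrow>
      real q / real (q - 1) < real (q ^ Suc k) / 2 ^ E"
    unfolding q using q by (intro ln_less_cancel_iff) auto
  also have "\<dots> \<longleftrightarrow> real q * 2 ^ E < real q * (real q ^ k * real (q - 1))"
    using q by (simp add: field_simps)
  also have "\<dots> \<longleftrightarrow> 2 ^ E < real q ^ k * real (q - 1)" using q by simp
  also have "\<dots> \<longleftrightarrow> real (2 ^ E) < real (q ^ k * (q - 1))" by simp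
  also have "\<dots> \<longleftrightarrow> 2 ^ E < q ^ k * (q - 1)" by (rule of_nat_less_iff)
  finally show ?thesis unfolding L_def .
qed

section \<open>The discriminator\<close>

lemma discriminator_le_two_power: "odd q \<Longrightarrow> n \<le> 2 ^ e \<Longrightarrow> discriminator q n \<le> 2 ^ e"
  by (intro discriminator_le separates_two_power) auto

lemma discriminator_two_power: "odd q \<Longrightarrow> discriminator q (2 ^ e) = 2 ^ e"
  using discriminator_le_two_power[of q "2 ^ e" e] discriminator_separates separates_le
  by (metis le_antisym order_refl)

lemma discriminator_exceptional:
  assumes q: "prime q" "5 \<le> q" and cong: "[int q = 1] (mod 28) \<or> [int q = -1] (mod 28)"
  shows "discriminator q 5 = 7"
proof -
  have oq: "odd q" using q prime_odd_nat[of q] by auto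
  have "discriminator q 5 \<le> 7"
    using separates_5_7[OF oq] qstar_mod_7[OF oq] cong by (intro discriminator_le) auto
  \<comment> \<open>Neither 5 nor 7 is 1 or -1 modulo 28. So powers of q are too large, and no power
    of 2 lies between 5 and 7.\<close>
  have "7 < q"
  proof (rule ccontr)
    assume "\<not> 7 < q"
    hence "q = 5 \<or> q = 6 \<or> q = 7" using q by linarith
    thus False using cong by (auto simp: cong_def)
  qed
  show ?thesis
  using q
  proof (cases rule: discriminator_cases[where n = 5])
    case (two e)
    have "2 ^ e < (2::nat) ^ 3" using two(1) \<open>discriminator q 5 \<le> 7\<close> by simp
    hence "e < 3" by (rule power_less_imp_less_exp[rotated]) simp
    hence "(2::nat) ^ e \<le> 2 ^ 2" by (intro power_increasing) auto
    thus ?thesis using two(2) by simp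
  next
    case (Artin k)
    have "q ^ 1 \<le> q ^ Suc k" using q by (intro power_increasing) auto
    hence "q \<le> discriminator q 5" using Artin(1) by simp
    thus ?thesis using \<open>7 < q\<close> \<open>discriminator q 5 \<le> 7\<close> by linarith
  qed
qed

theorem theorem2:
  fixes q :: nat
  assumes "prime q" and "q \<ge> 5"
  shows "(\<forall>n\<ge>1. discriminator q n =
      (if n = 5 \<and> ([int q = 1] (mod 28) \<or> [int q = -1] (mod 28)) then 7
       else if Artin_prime q \<and> \<not> Mirimanoff_prime q then
         Inf ({2 ^ e | e. 2 ^ e \<ge> n} \<union> {q ^ f | f. real (q ^ f) \<ge> real q / (real q - 1) * real n})
       else if Artin_prime q \<and> Mirimanoff_prime q \<and> \<not> Fermat_prime q then
         Inf ({2 ^ e | e. 2 ^ e \<ge> n} \<union> {m. m = q \<and> q \<ge> n + 1})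
       else Inf {2 ^ e | e. 2 ^ e \<ge> n}))
    \<and> (\<forall>e. \<exists>n\<ge>1. discriminator q n = 2 ^ e)
    \<and> (Artin_prime q \<and> Mirimanoff_prime q \<and> \<not> Fermat_prime q \<longrightarrow>
         (\<exists>n\<ge>1. discriminator q n = q))
    \<and> (Artin_prime q \<and> \<not> Mirimanoff_prime q \<longrightarrow>
         (\<forall>f\<ge>1. (\<exists>n\<ge>1. discriminator q n = q ^ f) \<longleftrightarrow>
            frac (real f * (ln (real q) / ln 2)) > ln (real q / (real q - 1)) / ln 2))"
proof (intro conjI allI impI)
  note q = assms
  have oq: "odd q" using q prime_odd_nat[of q] by auto
  note le_two = discriminator_le_two_power[OF oq]
  have le_Artin: "discriminator q n \<le> q ^ Suc k"
    if "Artin_prime q" "k = 0 \<or> \<not> Mirimanoff_prime q" "n \<le> q ^ k * (q - 1)" for n k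
    using separates_Artin[OF q that] q by (intro discriminator_le) auto
  fix n :: nat assume n: "1 \<le> n"
  let ?exc = "n = 5 \<and> ([int q = 1] (mod 28) \<or> [int q = -1] (mod 28))"
  show "discriminator q n =
      (if ?exc then 7
       else if Artin_prime q \<and> \<not> Mirimanoff_prime q then
         Inf ({2 ^ e | e. 2 ^ e \<ge> n} \<union> {q ^ f | f. real (q ^ f) \<ge> real q / (real q - 1) * real n})
       else if Artin_prime q \<and> Mirimanoff_prime q \<and> \<not> Fermat_prime q then
         Inf ({2 ^ e | e. 2 ^ e \<ge> n} \<union> {m. m = q \<and> q \<ge> n + 1})
       else Inf {2 ^ e | e. 2 ^ e \<ge> n})"
  proof (cases ?exc)
    case True
    thus ?thesis using discriminator_exceptional[OF q] by simp
  next
    case False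
    consider (lift) "Artin_prime q" "\<not> Mirimanoff_prime q"
      | (mir) "Artin_prime q" "Mirimanoff_prime q" "\<not> Fermat_prime q"
      | (fermat) "Artin_prime q" "Mirimanoff_prime q" "Fermat_prime q"
      | (other) "\<not> Artin_prime q" by blast
    thus ?thesis
    proof cases
      case lift
      have X: "{q ^ f | f. real (q ^ f) \<ge> real q / (real q - 1) * real n} =
          {q ^ Suc k | k. n \<le> q ^ k * (q - 1)}"
        using q n by (simp only: real_power_ge_iff) blast
      \<comment> \<open>The pattern for all cases: the discriminator belongs to the set by
        \<open>discriminator_cases\<close>, and it bounds the set below because every member
        separates.\<close>
      have "Inf ({2 ^ e | e. 2 ^ e \<ge> n} \<union> {q ^ Suc k | k. n \<le> q ^ k * (q - 1)}) = discriminator q n"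
      proof (rule cInf_eq_minimum)
        show "discriminator q n \<in> {2 ^ e | e. 2 ^ e \<ge> n} \<union> {q ^ Suc k | k. n \<le> q ^ k * (q - 1)}"
          using q False by (cases rule: discriminator_cases[where n = n]) auto
      qed (use le_two le_Artin lift in auto)
      thus ?thesis unfolding X if_not_P[OF False] using lift by simp
    next
      case mir
      have "Inf ({2 ^ e | e. 2 ^ e \<ge> n} \<union> {m. m = q \<and> q \<ge> n + 1}) = discriminator q n"
      proof (rule cInf_eq_minimum)
        show "discriminator q n \<in> {2 ^ e | e. 2 ^ e \<ge> n} \<union> {m. m = q \<and> q \<ge> n + 1}"
          using q
        proof (cases rule: discriminator_cases[where n = n])
          case (Artin k)
          hence "k = 0" using mir by simp
          hence "discriminator q n = q" "n + 1 \<le> q" using Artin q by auto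
          thus ?thesis by simp
        qed (use False in auto)
      qed (use le_two le_Artin[of 0 n] mir in auto)
      thus ?thesis unfolding if_not_P[OF False] using mir by simp
    next
      case fermat
      then obtain m where m: "q = 2 ^ m + 1" unfolding Fermat_prime_def by blast
      have "Inf {2 ^ e | e. 2 ^ e \<ge> n} = discriminator q n"
      proof (rule cInf_eq_minimum)
        show "discriminator q n \<in> {2 ^ e | e. 2 ^ e \<ge> n}"
        using q
  proof (cases rule: discriminator_cases[where n = n])
          case (Artin k)
          hence "k = 0" using fermat by simp
          \<comment> \<open>For q = 2^m + 1 the bound n at most q - 1 = 2^m lets the smaller modulus
            2^m separate too.\<close>
          hence "discriminator q n = q" "discriminator q n \<le> 2 ^ m" using Artin m le_two[of n m] by auto
          thus ?thesis using m by simp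
        qed (use False in auto)
      qed (use le_two in auto)
      thus ?thesis unfolding if_not_P[OF False] using fermat by simp
    next
      case other
      have "Inf {2 ^ e | e. 2 ^ e \<ge> n} = discriminator q n"
      proof (rule cInf_eq_minimum)
        show "discriminator q n \<in> {2 ^ e | e. 2 ^ e \<ge> n}"
          using q False other by (cases rule: discriminator_cases[where n = n]) auto
      qed (use le_two in auto)
      thus ?thesis unfolding if_not_P[OF False] using other by simp
    qed
  qed
next
  have "odd q" using assms prime_odd_nat[of q] by auto
  thus "\<exists>n\<ge>1. discriminator q n = 2 ^ e" for e
    by (intro exI[of _ "2 ^ e"]) (simp add: discriminator_two_power)
next
  note q = assms
  have oq: "odd q" using q prime_odd_nat[of q] by auto
  \<comment> \<open>The witness below is n = q - 1, the last n for which q separates; being even, it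
    avoids the exceptional n = 5.\<close>
  have ne: "q - 1 \<noteq> 5" using oq by presburger
  assume *: "Artin_prime q \<and> Mirimanoff_prime q \<and> \<not> Fermat_prime q"
  have "discriminator q (q - 1) \<le> q ^ Suc 0"
    using separates_Artin[OF q, of 0 "q - 1"] * q by (intro discriminator_le) auto
  hence le: "discriminator q (q - 1) \<le> q" by simp
  have "discriminator q (q - 1) = q"
  using q
  proof (cases rule: discriminator_cases[where n = "q - 1"])
    case (two e)
    have "2 ^ e \<noteq> q - 1"
    proof
      assume "2 ^ e = q - 1"
      hence "q = 2 ^ e + 1" "e \<noteq> 0" using q by (auto intro!: Nat.gr0I)
      thus False using * q(1) unfolding Fermat_prime_def by (metis Suc_leI gr0I One_nat_def)
    qed
    thus ?thesis using two le by simp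
  next
    case (Artin k)
    thus ?thesis using * by simp
  qed (use ne in auto)
  thus "\<exists>n\<ge>1. discriminator q n = q" using q by (intro exI[of _ "q - 1"]) auto
next
  note q = assms
  have oq: "odd q" using q prime_odd_nat[of q] by auto
  fix f :: nat assume A: "Artin_prime q \<and> \<not> Mirimanoff_prime q" and f: "1 \<le> f"
  then obtain k where k: "f = Suc k" by (cases f) auto
  have "1 < q ^ Suc k" using q by (intro one_less_power) auto
  then obtain E where E: "2 ^ E < q ^ Suc k" "q ^ Suc k \<le> 2 ^ Suc E"
    using two_power_interval by blast
  have "odd (q ^ Suc k)" using oq by simp
  hence "q ^ Suc k \<noteq> 2 ^ Suc E" by (metis even_mult_iff even_numeral power_Suc)
  hence E': "q ^ Suc k < 2 ^ Suc E" using E(2) by simp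
  have frac: "frac (real f * (ln (real q) / ln 2)) > ln (real q / (real q - 1)) / ln 2 \<longleftrightarrow>
      2 ^ E < q ^ k * (q - 1)"
    unfolding k using frac_log_gt_iff[of q E k] E E' q by simp
  \<comment> \<open>The odd number q^(k+1) > 1 is no power of 2, and it is not the exceptional 7,
    since q = 7 violates the condition modulo 28. So only the Artin case remains.\<close>
  have exact: "n \<le> q ^ k * (q - 1)" if D: "discriminator q n = q ^ Suc k" for n
  using q
  proof (cases rule: discriminator_cases[where n = n])
    case (two e)
    hence "e = 0" using D \<open>odd (q ^ Suc k)\<close> by (cases e) auto
    thus ?thesis using two D \<open>1 < q ^ Suc k\<close> by simp
  next
    case seven
    hence "q ^ Suc k = 7" using D by simp
    hence "q dvd 7" by (metis dvd_triv_left power_Suc)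
    hence "q \<le> 7" by (rule dvd_imp_le) simp
    hence "q = 5 \<or> q = 6 \<or> q = 7" using q by linarith
    thus ?thesis using seven(3) by (auto simp: cong_def)
  next
    case (Artin l)
    hence "l = k" using D q power_inject_exp[of q "Suc l" "Suc k"] by simp
    thus ?thesis using Artin by simp
  qed
  show "(\<exists>n\<ge>1. discriminator q n = q ^ f) \<longleftrightarrow>
      frac (real f * (ln (real q) / ln 2)) > ln (real q / (real q - 1)) / ln 2"
    unfolding frac
  proof
    assume "\<exists>n\<ge>1. discriminator q n = q ^ f"
    then obtain n where n: "discriminator q n = q ^ Suc k" unfolding k by blast
    have "\<not> n \<le> 2 ^ E"
      using discriminator_le_two_power[OF oq, of n E] n E(1) by auto
    thus "2 ^ E < q ^ k * (q - 1)" using exact[OF n] by simp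
  next
    assume lt: "2 ^ E < q ^ k * (q - 1)"
    \<comment> \<open>The largest n that q^(k+1) separates. It exceeds \<open>2 ^ E\<close>, and the
      next power of 2 is already larger than q^(k+1).\<close>
    define n where "n = q ^ k * (q - 1)"
    have "even n" "1 \<le> n" using oq q by (auto simp: n_def)
    have le: "discriminator q n \<le> q ^ Suc k"
      using separates_Artin[OF q, of k n] A q by (intro discriminator_le) (auto simp: n_def)
    have "discriminator q n = q ^ Suc k"
    using q
  proof (cases rule: discriminator_cases[where n = n])
      case (two e)
      have "(2::nat) ^ E < 2 ^ e" using two(2) lt unfolding n_def by (rule less_le_trans[rotated])
      hence "Suc E \<le> e" by (simp add: Suc_leI)
      hence "(2::nat) ^ Suc E \<le> 2 ^ e" by (intro power_increasing) auto
      thus ?thesis using two(1) le E' by simp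
    next
      case seven
      thus ?thesis using \<open>even n\<close> by simp
    next
      case (Artin l)
      have "q ^ k \<le> q ^ l" using Artin(4) q by (simp add: n_def)
      hence "q ^ Suc k \<le> q ^ Suc l" by simp
      thus ?thesis using Artin(1) le by linarith
    qed
    thus "\<exists>n\<ge>1. discriminator q n = q ^ f" using \<open>1 \<le> n\<close> k by blast
  qed
qed

end
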